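(* For $\vec{x}=(a,b,c,d,e,f,g)^T\in V$, $$S(f-a)\,A(1-a,e-a,f-a,g-a)\,A(1+a-g,1+b-g,1+c-g,1+d-g)\,K_{p_0}(\vec{x})$$ $$-\,S(g-a)\,A(f-a,f-b,f-c,f-d)\,A(a,1+a-e,1+a-f,1+a-g)\,K_{n_4}(\vec{x})-B_2(\vec{x})\,L_4(\vec{x})=0.$$
   Context: $V=\{(a,b,c,d,e,f,g)^T\in\mathbb{C}^7: e+f+g-a-b-c-d=1\}$. ${}_4F_3\left[\begin{smallmatrix}a,b,c,d\\ e,f,g\end{smallmatrix};1\right]=\sum_{n\ge0}\frac{(a)_n(b)_n(c)_n(d)_n}{n!(e)_n(f)_n(g)_n}$, with $(a)_n$ the rising factorial. For $(a,b,c,d,e,f,g)^T\in V$, $$K(a;b,c,d;e,f,g)=\frac{{}_4F_3\left[\begin{smallmatrix}a,b,c,d\\ e,f,g\end{smallmatrix};1\right]}{\sin\pi a\,\Gamma(a)\Gamma(1+a-e)\Gamma(1+a-f)\Gamma(1+a-g)\Gamma(e)\Gamma(f)\Gamma(g)}+\frac{{}_4F_3\left[\begin{smallmatrix}a,1+a-e,1+a-f,1+a-g\\ 1+a-b,1+a-c,1+a-d\end{smallmatrix};1\right]}{\sin\pi a\,\Gamma(a)\Gamma(b)\Gamma(c)\Gamma(d)\Gamma(1+a-b)\Gamma(1+a-c)\Gamma(1+a-d)},$$ $$L(a,b,c,d;e;f,g)=\frac{{}_4F_3\left[\begin{smallmatrix}a,b,c,d\\ e,f,g\end{smallmatrix};1\right]}{\sin\pi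 e\,\Gamma(1+a-e)\Gamma(1+b-e)\Gamma(1+c-e)\Gamma(1+d-e)\Gamma(e)\Gamma(f)\Gamma(g)}-\frac{{}_4F_3\left[\begin{smallmatrix}1+a-e,1+b-e,1+c-e,1+d-e\\ 2-e,1+f-e,1+g-e\end{smallmatrix};1\right]}{\sin\pi e\,\Gamma(a)\Gamma(b)\Gamma(c)\Gamma(d)\Gamma(2-e)\Gamma(1+f-e)\Gamma(1+g-e)}.$$ Notation: $S(a_1,\dots,a_n)=\sin\pi a_1\cdots\sin\pi a_n$; $A(x,y,z,w)=\frac{1}{\Gamma(x)\Gamma(y)\Gamma(z)\Gamma(w)}$ (with $1/\Gamma=0$ at nonpositive integers). The relation is asserted for those $\vec{x}\in V$ at which the $K$ and $L$ functions occurring are defined (no lower parameter of an occurring series is a nonpositive integer, no sine in an occurring denominator vanishes). Here $K_{p_0}(\vec{x})=K(a;b,c,d;e,f,g)$, $K_{n_4}(\vec{x})=K(e-a;e-b,e-c,e-d;1+e-f,1+e-g,e)$, $L_4(\vec{x})=L(a,b,c,d;g;f,e)$, and $B_2(\vec{x})=\pi^{-4}S(f-a,g-a)\,[S(b-a,c-a,d-a)+S(e-2a,f-a,g-a)]$. *)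

theory Defs
  imports "HOL-Analysis.Analysis"
begin

(* The column vectors of C^7 are rendered as 7-tuples. *)
type_synonym c7 = "complex \<times> complex \<times> complex \<times> complex \<times> complex \<times> complex \<times> complex"

definition V :: "c7 set" where
  "V = {(a, b, c, d, e, f, g). e + f + g - a - b - c - d = 1}"

(* Argument order: upper parameters a, b, c, d, then lower parameters e, f, g.  For the series
   used below the lower parameters exceed the upper ones by 1 in total, so the series converges
   absolutely as soon as no lower parameter is a nonpositive integer. *)
definition hyp4F3 ::
  "complex \<Rightarrow> complex \<Rightarrow> complex \<Rightarrow> complex \<Rightarrow> complex \<Rightarrow> complex \<Rightarrow> complex \<Rightarrow> complex" where
  "hyp4F3 a b c d e f g =
     (\<Sum>n. (pochhammer a n * pochhammer b n * pochhammer c n * pochhammer d n) /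
           (fact n * pochhammer e n * pochhammer f n * pochhammer g n))"

(* Every reciprocal 1 / Gamma is written with the entire function rGamma, which is 0 at the
   nonpositive integers. *)
definition Kfun ::
  "complex \<Rightarrow> complex \<Rightarrow> complex \<Rightarrow> complex \<Rightarrow> complex \<Rightarrow> complex \<Rightarrow> complex \<Rightarrow> complex" where
  "Kfun a b c d e f g =
     hyp4F3 a b c d e f g / sin (of_real pi * a) *
       (rGamma a * rGamma (1 + a - e) * rGamma (1 + a - f) * rGamma (1 + a - g) *
        rGamma e * rGamma f * rGamma g)
   + hyp4F3 a (1 + a - e) (1 + a - f) (1 + a - g) (1 + a - b) (1 + a - c) (1 + a - d) /
       sin (of_real pi * a) *
       (rGamma a * rGamma b * rGamma c * rGamma d *
        rGamma (1 + a - b) * rGamma (1 + a - c) * rGamma (1 + a - d))"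

definition Lfun ::
  "complex \<Rightarrow> complex \<Rightarrow> complex \<Rightarrow> complex \<Rightarrow> complex \<Rightarrow> complex \<Rightarrow> complex \<Rightarrow> complex" where
  "Lfun a b c d e f g =
     hyp4F3 a b c d e f g / sin (of_real pi * e) *
       (rGamma (1 + a - e) * rGamma (1 + b - e) * rGamma (1 + c - e) * rGamma (1 + d - e) *
        rGamma e * rGamma f * rGamma g)
   - hyp4F3 (1 + a - e) (1 + b - e) (1 + c - e) (1 + d - e) (2 - e) (1 + f - e) (1 + g - e) /
       sin (of_real pi * e) *
       (rGamma a * rGamma b * rGamma c * rGamma d *
        rGamma (2 - e) * rGamma (1 + f - e) * rGamma (1 + g - e))"

definition K_defined ::
  "complex \<Rightarrow> complex \<Rightarrow> complex \<Rightarrow> complex \<Rightarrow> complex \<Rightarrow> complex \<Rightarrow> complex \<Rightarrow> bool" where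
  "K_defined a b c d e f g \<longleftrightarrow>
     sin (of_real pi * a) \<noteq> 0 \<and>
     {e, f, g, 1 + a - b, 1 + a - c, 1 + a - d} \<inter> \<int>\<^sub>\<le>\<^sub>0 = {}"

definition L_defined ::
  "complex \<Rightarrow> complex \<Rightarrow> complex \<Rightarrow> complex \<Rightarrow> complex \<Rightarrow> complex \<Rightarrow> complex \<Rightarrow> bool" where
  "L_defined a b c d e f g \<longleftrightarrow>
     sin (of_real pi * e) \<noteq> 0 \<and>
     {e, f, g, 2 - e, 1 + f - e, 1 + g - e} \<inter> \<int>\<^sub>\<le>\<^sub>0 = {}"

fun K_p0 :: "c7 \<Rightarrow> complex" where
  "K_p0 (a, b, c, d, e, f, g) = Kfun a b c d e f g"

fun K_p0_defined :: "c7 \<Rightarrow> bool" where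
  "K_p0_defined (a, b, c, d, e, f, g) \<longleftrightarrow> K_defined a b c d e f g"

fun K_n4 :: "c7 \<Rightarrow> complex" where
  "K_n4 (a, b, c, d, e, f, g) =
     Kfun (e - a) (e - b) (e - c) (e - d) (1 + e - f) (1 + e - g) e"

fun K_n4_defined :: "c7 \<Rightarrow> bool" where
  "K_n4_defined (a, b, c, d, e, f, g) \<longleftrightarrow>
     K_defined (e - a) (e - b) (e - c) (e - d) (1 + e - f) (1 + e - g) e"

fun L_4 :: "c7 \<Rightarrow> complex" where
  "L_4 (a, b, c, d, e, f, g) = Lfun a b c d g f e"

fun L_4_defined :: "c7 \<Rightarrow> bool" where
  "L_4_defined (a, b, c, d, e, f, g) \<longleftrightarrow> L_defined a b c d g f e"

definition sin_prod :: "complex list \<Rightarrow> complex" where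
  "sin_prod xs = (\<Prod>t\<leftarrow>xs. sin (of_real pi * t))"

definition A :: "complex \<Rightarrow> complex \<Rightarrow> complex \<Rightarrow> complex \<Rightarrow> complex" where
  "A x y z w = rGamma x * rGamma y * rGamma z * rGamma w"

fun B_2 :: "c7 \<Rightarrow> complex" where
  "B_2 (a, b, c, d, e, f, g) =
     1 / of_real pi ^ 4 * sin_prod [f - a, g - a] *
       (sin_prod [b - a, c - a, d - a] + sin_prod [e - 2 * a, f - a, g - a])"

end

theory Submission
  imports Defs "HOL-Complex_Analysis.Complex_Analysis" "HOL-Real_Asymp.Real_Asymp"
begin

text \<open>
  For parameters in general position both K functions are combinations of the same two L functions.

  Bailey's transformation of terminating very-well-poised series \<open>9F8\<close> follows from two applications of Dougall's sum.
  If the base and two parameters tend to infinity with the length of the series, either side splits into the two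
  \<open>4F3\<close> series of an L function, which gives the invariance of L under
  \<open>(p, q, u, v; h; b, c) \<mapsto> (b - q, b - p, u, v; h + b - p - q; b, c + b - p - q)\<close>. Applied twice it yields
  \<open>L(a,b,c,d; g; f,e) = L(e-a,e-b,e-c,e-d; 1+e-f; 1+e-g,e)\<close>, and the same with \<open>f\<close> and \<open>g\<close> exchanged.

  The terms of the series extend to entire functions \<open>r\<close>, and the sum of \<open>r(z + n)\<close> over all integers \<open>n\<close> is a
  trigonometric polynomial of degree 1 in \<open>z\<close>, so its values at \<open>0\<close>, \<open>1 - f\<close>, \<open>1 - g\<close>, \<open>-a\<close> are linearly dependent.
  This writes \<open>K(a;b,c,d;e,f,g)\<close> through \<open>L(a,b,c,d;f;g,e)\<close> and \<open>L(a,b,c,d;g;f,e)\<close>. The dual parameters give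
  \<open>K(e-a;\<dots>)\<close> through the same two functions; eliminating the first of them leaves the relation, whose
  coefficient \<open>B_2\<close> comes from an identity between products of four sines. The remaining parameters are
  reached by continuity along a line in \<open>V\<close>.
\<close>

section \<open>Terminating very-well-poised series\<close>

text \<open>The entire terms grow like exp(4 pi |Im z|), which alone would allow degree 2 in exp(2
  pi i z): a space of dimension five, where four values need not be dependent. The balance of the
  parameters supplies a further factor 1/|s|^2, whose sum over a translate of the integers tends to
  0 as |Im z| grows, and this removes the coefficients of degree 2 and -2.

  The same balance is behind all estimates. After two auxiliary linear factors are added, numerator
  and denominator of a term ratio have equal sums of shifts, so the ratio is 1 + O(1/|s|^2). From
  this one estimate come the convergence of the series, the majorants that justify the limits in the
  parameters and the growth of the entire terms.

  The points 0, 1 - f, 1 - g, -a are chosen because there the bilateral sum vanishes on one side of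
  the origin and becomes one of the 4F3 series in K and in the two L functions.

  General position is assumed until the end because the normalisations divide by Gamma products and
  sines that may vanish elsewhere.\<close>

lemma pochhammer_not_Ints_neq_0:
  fixes a :: complex
  assumes "a \<notin> \<int>" shows "pochhammer a n \<noteq> 0"
  using assms by (metis Ints_minus Ints_of_nat pochhammer_eq_0_iff)

lemma not_Ints_neq_0: "(a::complex) \<notin> \<int> \<Longrightarrow> a \<noteq> 0"
  by auto

lemma Ints_shift [simp]:
  fixes a b :: complex
  shows "a + 1 \<in> \<int> \<longleftrightarrow> a \<in> \<int>" "1 + a \<in> \<int> \<longleftrightarrow> a \<in> \<int>"
    "a + numeral w \<in> \<int> \<longleftrightarrow> a \<in> \<int>" "numeral w + a \<in> \<int> \<longleftrightarrow> a \<in> \<int>"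
    "a + of_nat n \<in> \<int> \<longleftrightarrow> a \<in> \<int>" "of_nat n + a \<in> \<int> \<longleftrightarrow> a \<in> \<int>"
    "a - 1 \<in> \<int> \<longleftrightarrow> a \<in> \<int>" "a - numeral w \<in> \<int> \<longleftrightarrow> a \<in> \<int>" "a - of_nat n \<in> \<int> \<longleftrightarrow> a \<in> \<int>"
    "1 + a - b \<in> \<int> \<longleftrightarrow> a - b \<in> \<int>" "numeral w + a - b \<in> \<int> \<longleftrightarrow> a - b \<in> \<int>"
proof -
  have *: "x + m \<in> \<int> \<longleftrightarrow> x \<in> \<int>" if "m \<in> \<int>" for x m :: complex
    using that by (metis Ints_add Ints_diff add_diff_cancel_right')
  have **: "x + m - y \<in> \<int> \<longleftrightarrow> x - y \<in> \<int>" if "m \<in> \<int>" for x y m :: complex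
    using *[OF that, of "x - y"] by (simp add: algebra_simps)
  show "a + 1 \<in> \<int> \<longleftrightarrow> a \<in> \<int>" "1 + a \<in> \<int> \<longleftrightarrow> a \<in> \<int>"
    "a + numeral w \<in> \<int> \<longleftrightarrow> a \<in> \<int>" "numeral w + a \<in> \<int> \<longleftrightarrow> a \<in> \<int>"
    "a + of_nat n \<in> \<int> \<longleftrightarrow> a \<in> \<int>" "of_nat n + a \<in> \<int> \<longleftrightarrow> a \<in> \<int>"
    using *[of 1 a] *[of "numeral w" a] *[of "of_nat n" a] by (simp_all add: add.commute)
  show "a - 1 \<in> \<int> \<longleftrightarrow> a \<in> \<int>" "a - numeral w \<in> \<int> \<longleftrightarrow> a \<in> \<int>" "a - of_nat n \<in> \<int> \<longleftrightarrow> a \<in> \<int>"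
    using *[of "-1" a] *[of "- numeral w" a] *[of "- of_nat n" a] by simp_all
  show "1 + a - b \<in> \<int> \<longleftrightarrow> a - b \<in> \<int>" "numeral w + a - b \<in> \<int> \<longleftrightarrow> a - b \<in> \<int>"
    using **[of 1 a b] **[of "numeral w" a b] by (simp_all add: add.commute)
qed

lemma one_minus_not_Ints: "x \<notin> \<int> \<Longrightarrow> 1 - x \<notin> \<int>" for x :: complex
  by (metis Ints_1 Ints_diff diff_diff_eq2 add_diff_cancel_left')

section \<open>Dougall's sum for terminating very-well-poised 7F6 series\<close>

text \<open>The factor (a + 2k)/a stands for the pair of parameters 1 + a/2 over a/2. The parameter
  \<open>e\<close> is free here; the sum has a closed form once \<open>e\<close> is tied to the
  others so that the series is 2-balanced.\<close>

definition dougall_term where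
  "dougall_term (a :: complex) b c d e N k =
     (a + 2 * of_nat k) / a * pochhammer a k * pochhammer b k * pochhammer c k * pochhammer d k
       * pochhammer e k * pochhammer (- of_nat N) k /
     (fact k * pochhammer (1 + a - b) k * pochhammer (1 + a - c) k * pochhammer (1 + a - d) k
       * pochhammer (1 + a - e) k * pochhammer (1 + a + of_nat N) k)"

definition dougall_value where
  "dougall_value (a :: complex) b c d N =
     pochhammer (1 + a) N * pochhammer (1 + a - b - c) N * pochhammer (1 + a - b - d) N
       * pochhammer (1 + a - c - d) N /
     (pochhammer (1 + a - b) N * pochhammer (1 + a - c) N * pochhammer (1 + a - d) N
       * pochhammer (1 + a - b - c - d) N)"

text \<open>The value is forced at index 1: the series with shifted parameters has constant term 1,
  so in the recurrence this factor is the difference of the two terms at k = 1.\<close>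

definition dougall_step where
  "dougall_step (a :: complex) b c d e N =
     - (of_nat N + 1 + e) * (of_nat N + 1 + a - e) * (a + 1) * (a + 2) * b * c * d /
     ((a - e) * (1 + a - b) * (1 + a - c) * (1 + a - d) * (1 + a - e) * (1 + a + of_nat N) * (2 + a + of_nat N))"

text \<open>
  With \<open>x = k (a + k)\<close>, \<open>X = (N + 1) (N + 1 + a)\<close> and \<open>E = e (a - e)\<close> the three terms have the ratios
  \<open>(1 + x / E) / (1 - x / X)\<close>, \<open>1\<close> and a multiple of \<open>x / (X - x)\<close>, which makes the sum a Pascal-type recurrence in \<open>N\<close>.
\<close>
lemma dougall_term_step:
  fixes a b c d e :: complex
  assumes "a \<notin> \<int>" "e \<notin> \<int>" "a - b \<notin> \<int>" "a - c \<notin> \<int>" "a - d \<notin> \<int>" "a - e \<notin> \<int>"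
  shows "dougall_term a b c d (e + 1) (Suc N) (Suc j) =
    dougall_term a b c d e N (Suc j)
    + dougall_step a b c d e N * dougall_term (a + 2) (b + 1) (c + 1) (d + 1) (e + 1) N j"
proof -
  define k where "k = Suc j"
  define J where "J = (of_nat j :: complex)"
  define n where "n = (of_nat N :: complex)"
  \<comment> \<open>The common part of the three terms: everything in \<open>a\<close>,
    \<open>b\<close>, \<open>c\<close>, \<open>d\<close> at index k, and the longest shared factors
    in \<open>e\<close> and \<open>N\<close>. The cofactors of \<open>M\<close> are rational
    functions of j and the claim becomes a polynomial identity.\<close>
  define M where "M = (a + 2 * (J + 1)) / a * pochhammer a k * pochhammer b k * pochhammer c k * pochhammer d k
       * pochhammer (e + 1) j * pochhammer (- n) j /
     (fact k * pochhammer (1 + a - b) k * pochhammer (1 + a - c) k * pochhammer (1 + a - d) k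
       * pochhammer (1 + a - e) j * pochhammer (3 + a + n) j)"
  have nz: "a \<noteq> 0" "a + 1 \<noteq> 0" "a + 2 \<noteq> 0" "e \<noteq> 0" "a - e \<noteq> 0" "1 + a - e \<noteq> 0" "1 + a - e + J \<noteq> 0"
     "1 + a + n \<noteq> 0" "2 + a + n \<noteq> 0" "2 + a + n + J \<noteq> 0" "1 + a - b \<noteq> 0" "1 + a - c \<noteq> 0" "1 + a - d \<noteq> 0"
    by (rule not_Ints_neq_0; use assms in \<open>simp add: J_def n_def\<close>)+
  have pnz: "pochhammer (1 + a - b) k \<noteq> 0" "pochhammer (1 + a - c) k \<noteq> 0" "pochhammer (1 + a - d) k \<noteq> 0"
    "pochhammer (1 + a - e) j \<noteq> 0" "pochhammer (3 + a + n) j \<noteq> 0"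
    by (rule pochhammer_not_Ints_neq_0; use assms in \<open>simp add: n_def\<close>)+
  have e2: "pochhammer e k = e * pochhammer (e + 1) j" 
    unfolding k_def by (rule pochhammer_rec)
  have e1: "pochhammer (e + 1) k = pochhammer (e + 1) j * (e + 1 + J)"
    by (simp add: k_def J_def pochhammer_Suc)
  have e3: "pochhammer (1 + a - (e + 1)) k = (a - e) * pochhammer (1 + a - e) j" 
    using pochhammer_rec[of "a - e" j] by (simp add: k_def algebra_simps)
  have e4: "pochhammer (1 + a - e) k = pochhammer (1 + a - e) j * (1 + a - e + J)"
    by (simp add: k_def J_def pochhammer_Suc)
  have N1: "pochhammer (- of_nat (Suc N)) k = - (n + 1) * pochhammer (- n) j"
    using pochhammer_rec[of "- of_nat (Suc N) :: complex" j] by (simp add: k_def n_def algebra_simps)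
  have N2: "pochhammer (- n) k = pochhammer (- n) j * (J - n)"
    by (simp add: k_def J_def pochhammer_Suc)
  have N3: "pochhammer (2 + a + n) k = (2 + a + n) * pochhammer (3 + a + n) j"
    using pochhammer_rec[of "2 + a + n" j] by (simp add: k_def algebra_simps)
  have N3': "pochhammer (2 + a + n) j * (2 + a + n + J) = (2 + a + n) * pochhammer (3 + a + n) j"
    using N3 by (simp add: k_def J_def pochhammer_Suc)
  have N4: "pochhammer (1 + a + n) k = (1 + a + n) * pochhammer (2 + a + n) j"
    using pochhammer_rec[of "1 + a + n" j] by (simp add: k_def algebra_simps)
  have N5: "pochhammer (2 + a + n) j = (2 + a + n) * pochhammer (3 + a + n) j / (2 + a + n + J)"
    using N3' nz by (simp add: field_simps)
  have T1: "dougall_term a b c d (e + 1) (Suc N) k = M * (- (e + 1 + J) * (n + 1) / ((a - e) * (2 + a + n)))"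
  proof -
    have *: "1 + a + of_nat (Suc N) = 2 + a + n" "of_nat k = J + 1" by (simp_all add: n_def k_def J_def)
    show ?thesis
      unfolding dougall_term_def * N1 N3 e1 e3 M_def
      by (simp only: divide_inverse inverse_mult_distrib mult_minus_left mult_minus_right mult_ac)
  qed
  have T2: "dougall_term a b c d e N k = M * (e * (J - n) * (2 + a + n + J) / ((1 + a - e + J) * (1 + a + n) * (2 + a + n)))"
  proof -
    have *: "of_nat k = J + 1" by (simp_all add: n_def k_def J_def)
    show ?thesis
      unfolding dougall_term_def * n_def[symmetric] N2 N4 N5 e2 e4 M_def
      by (simp only: divide_inverse inverse_mult_distrib inverse_inverse_eq mult_minus_left mult_minus_right mult_ac)
  qed
  have a1: "pochhammer (a + 2) j = pochhammer a k * (a + 1 + J) / (a * (a + 1))"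
  proof -
    have "a * (a + 1) * pochhammer (a + 2) j = pochhammer a (Suc (Suc j))"
      by (simp only: pochhammer_rec) (simp add: algebra_simps)
    also have "\<dots> = pochhammer a k * (a + 1 + J)" 
      by (simp only: pochhammer_Suc k_def J_def) (simp add: algebra_simps)
    finally show ?thesis using nz by (simp add: eq_divide_eq mult_ac)
  qed
  have b1: "pochhammer x k = x * pochhammer (x + 1) j" for x :: complex
    unfolding k_def by (rule pochhammer_rec)
  have b2: "pochhammer (1 + (a + 2) - (x + 1)) j = pochhammer (1 + a - x) k / (1 + a - x)" if "1 + a - x \<noteq> 0" for x
    using that pochhammer_rec[of "1 + a - x" j] by (simp add: k_def algebra_simps field_simps)
  have e5: "pochhammer (1 + (a + 2) - (e + 1)) j = pochhammer (1 + a - e) j * (1 + a - e + J) / (1 + a - e)"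
    using b2[of e] nz e4 by simp
  have T3: "dougall_step a b c d e N * dougall_term (a + 2) (b + 1) (c + 1) (d + 1) (e + 1) N j =
     M * (- (n + 1 + e) * (n + 1 + a - e) * (J + 1) * (a + 1 + J) / ((a - e) * (1 + a - e + J) * (1 + a + n) * (2 + a + n)))"
  proof -
    have *: "1 + (a + 2) + n = 3 + a + n" by simp
    have **: "a + 2 + 2 * J = a + 2 * (J + 1)" by simp
    have aux: "- x1 * x2 * a1 * a2 * b * c * d / (q1 * b' * c' * d' * q2 * q3 * q4) *
        (A / a2 * (pa * y / (a * a1)) * pb * pc * pd * pe * pn /
          (F * (rb / b') * (rc / c') * (rd / d') * (re * w / q2) * z)) =
        A / a * pa * (b * pb) * (c * pc) * (d * pd) * pe * pn /
          ((J1 * F) * rb * rc * rd * re * z) * (- x1 * x2 * J1 * y / (q1 * w * q3 * q4))"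
        (is "?L = ?R")
      if "a1 \<noteq> 0" "a2 \<noteq> 0" "b' \<noteq> 0" "c' \<noteq> 0" "d' \<noteq> 0" "q2 \<noteq> 0" "J1 \<noteq> 0"
      for x1 x2 a1 a2 b c d q1 b' c' d' q2 q3 q4 A pa y a pb pc pd pe pn F rb rc rd re w z J1 :: complex
    proof -
      \<comment> \<open>Both sides agree up to factors x / x. With these inserted they are the same
        product up to order, so only commutativity is used; the device recurs below.\<close>
      have "?L * (J1 / J1) = ?R * ((a1 / a1) * (a2 / a2) * (b' / b') * (c' / c') * (d' / d') * (q2 / q2))"
        by (simp only: divide_inverse inverse_mult_distrib inverse_inverse_eq mult_minus_left mult_minus_right mult_ac)
      thus ?thesis using that by simp
    qed
    have f: "fact k = (J + 1) * fact j" by (simp add: k_def J_def)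
    have J0: "J + 1 \<noteq> 0" unfolding J_def by (metis of_nat_neq_0 of_nat_Suc add.commute)
    show ?thesis
      unfolding dougall_step_def dougall_term_def n_def[symmetric] J_def[symmetric] * a1 e5 M_def f
       b2[OF nz(11)] b2[OF nz(12)] b2[OF nz(13)] b1[of b] b1[of c] b1[of d] **
      by (rule aux) (use nz J0 in auto)
  qed
  have aux: "x / (q1 * q5) = y / (q3 * q4 * q5) + z / (q1 * q3 * q4 * q5)"
    if "x * (q3 * q4) = y * q1 + z" "q1 \<noteq> 0" "q3 \<noteq> 0" "q4 \<noteq> 0" "q5 \<noteq> 0"
    for x y z q1 q3 q4 q5 :: complex
  proof -
    have "x / (q1 * q5) = (x * (q3 * q4)) / (q1 * q3 * q4 * q5)"
      using that(2-) by simp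
    also have "\<dots> = y / (q3 * q4 * q5) + z / (q1 * q3 * q4 * q5)"
      unfolding that(1) using that(2-) by (simp add: add_divide_distrib)
    finally show ?thesis .
  qed
  have "- (e + 1 + J) * (n + 1) / ((a - e) * (2 + a + n)) = 
    e * (J - n) * (2 + a + n + J) / ((1 + a - e + J) * (1 + a + n) * (2 + a + n)) +
    - (n + 1 + e) * (n + 1 + a - e) * (J + 1) * (a + 1 + J) / ((a - e) * (1 + a - e + J) * (1 + a + n) * (2 + a + n))"
  proof (rule aux)
    show "- (e + 1 + J) * (n + 1) * ((1 + a - e + J) * (1 + a + n)) = 
      e * (J - n) * (2 + a + n + J) * (a - e) + - (n + 1 + e) * (n + 1 + a - e) * (J + 1) * (a + 1 + J)"
      by algebra
  qed (use nz in simp_all)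
  then show ?thesis
    using T1 T2 T3 unfolding k_def by (simp add: distrib_left)
qed

text \<open>The closed form obeys the same recurrence. After division by the value at
  \<open>N\<close> it reads, with n = 1 + a + N, n(n-b-c)(n-b-d)(n-c-d) = (n-b)(n-c)(n-d)(n-b-c-d) +
  (2n-b-c-d)bcd. The balance enters through N + 1 + e = 2n - b - c - d.\<close>

lemma dougall_value_step:
  fixes a b c d e :: complex
  assumes e: "e = 1 + 2 * a + of_nat N - b - c - d"
  assumes "a \<notin> \<int>" "e \<notin> \<int>" "a - b \<notin> \<int>" "a - c \<notin> \<int>" "a - d \<notin> \<int>" "a - e \<notin> \<int>"
  shows "dougall_value a b c d (Suc N) =
    dougall_value a b c d N
    + dougall_step a b c d e N * dougall_value (a + 2) (b + 1) (c + 1) (d + 1) N"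
proof -
  define n where "n = 1 + a + of_nat N"
  define s where "s = a - b - c - d"
  have "1 + a - e = - of_nat N - s"
    unfolding e s_def by (simp add: algebra_simps)
  hence sZ: "s \<notin> \<int>"
    using assms by (metis Ints_1 Ints_add Ints_minus Ints_of_nat Ints_diff Ints_shift(10))
  have nz: "a + 1 \<noteq> 0" "a + 2 \<noteq> 0" "1 + a - b \<noteq> 0" "1 + a - c \<noteq> 0" "1 + a - d \<noteq> 0"
    "n \<noteq> 0" "n + 1 \<noteq> 0" "s \<noteq> 0" "s + of_nat N \<noteq> 0" "s + of_nat N + 1 \<noteq> 0"
    by (rule not_Ints_neq_0; use assms sZ in \<open>simp add: n_def\<close>)+
  have nz2: "n - b \<noteq> 0" "n - c \<noteq> 0" "n - d \<noteq> 0"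
  proof -
    have "n - x \<noteq> 0" if "a - x \<notin> \<int>" for x
    proof -
      have "n - x = (1 + a - x) + of_nat N" by (simp add: n_def)
      thus ?thesis using that by (metis Ints_0 Ints_shift(10) Ints_shift(5))
    qed
    thus "n - b \<noteq> 0" "n - c \<noteq> 0" "n - d \<noteq> 0" using assms by auto
  qed
  have pnz: "pochhammer (1 + a - b) N \<noteq> 0" "pochhammer (1 + a - c) N \<noteq> 0" "pochhammer (1 + a - d) N \<noteq> 0"
    "pochhammer (1 + s) N \<noteq> 0"
    by (rule pochhammer_not_Ints_neq_0; use assms sZ in simp)+
  define P where "P = dougall_value a b c d N"
  have 1: "dougall_value a b c d (Suc N) =
     P * (n * (n - b - c) * (n - b - d) * (n - c - d) / ((n - b) * (n - c) * (n - d) * (s + of_nat N + 1)))"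
  proof -
    have E: "1 + a + of_nat N = n" "1 + a - b - c + of_nat N = n - b - c" "1 + a - b - d + of_nat N = n - b - d"
      "1 + a - c - d + of_nat N = n - c - d" "1 + a - b + of_nat N = n - b" "1 + a - c + of_nat N = n - c"
      "1 + a - d + of_nat N = n - d" "1 + a - b - c - d + of_nat N = s + of_nat N + 1"
      by (simp_all add: n_def s_def algebra_simps)
    show ?thesis
      unfolding dougall_value_def P_def pochhammer_Suc E by (simp only: times_divide_times_eq mult_ac)
  qed
  have 2: "dougall_value (a + 2) (b + 1) (c + 1) (d + 1) N =
     P * (n * (n + 1) * (1 + a - b) * (1 + a - c) * (1 + a - d) * (s + of_nat N) /
        ((a + 1) * (a + 2) * (n - b) * (n - c) * (n - d) * s))"
  proof -
    have u: "pochhammer (x + 1) N = pochhammer x N * (x + of_nat N) / x" if "x \<noteq> 0" for x :: complex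
      using that pochhammer_rec[of x N] pochhammer_Suc[of x N] by (simp add: field_simps)
    have e1: "pochhammer (1 + (a + 2)) N = pochhammer (1 + a) N * n * (n + 1) / ((a + 1) * (a + 2))"
    proof -
      have "pochhammer (1 + (a + 2)) N = pochhammer (a + 2) N * (a + 2 + of_nat N) / (a + 2)"
        using u[of "a + 2"] nz by (simp add: add_ac)
      also have "pochhammer (a + 2) N = pochhammer (1 + a) N * (a + 1 + of_nat N) / (a + 1)"
        using u[of "a + 1"] nz by (simp add: add_ac)
      finally show ?thesis using nz by (simp add: n_def add_ac mult_ac)
    qed
    have e2: "pochhammer (1 + (a + 2) - (x + 1)) N = pochhammer (1 + a - x) N * (n - x) / (1 + a - x)"
      if "1 + a - x \<noteq> 0" for x
      using u[OF that] by (simp add: n_def algebra_simps)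
    have e3: "pochhammer (1 + (a + 2) - (b + 1) - (c + 1) - (d + 1)) N = pochhammer (1 + s) N * s / (s + of_nat N)"
    proof -
      have "1 + (a + 2) - (b + 1) - (c + 1) - (d + 1) = s" by (simp add: s_def)
      thus ?thesis using u[of s] nz by (simp add: add_ac)
    qed
    have e4: "1 + (a + 2) - (x + 1) - (y + 1) = 1 + a - x - y" for x y by simp
    have e5: "1 + a - b - c - d = 1 + s" by (simp add: s_def)
    show ?thesis
      unfolding dougall_value_def P_def e5 e1 e2[OF nz(3)] e2[OF nz(4)] e2[OF nz(5)] e3
      unfolding e4
      by (simp only: divide_inverse inverse_mult_distrib inverse_inverse_eq mult_ac)
  qed
  define m1 m2 where "m1 = s + of_nat N" and "m2 = s + of_nat N + 1"
  have m: "m1 \<noteq> 0" "m2 \<noteq> 0" using nz by (auto simp: m1_def m2_def)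
  have e1: "of_nat N + 1 + e = 2 * n - b - c - d" "of_nat N + 1 + a - e = - s" "a - e = - m2"
     "1 + a - e = - m1" "2 + a + of_nat N = n + 1" "1 + a + of_nat N = n"
    by (simp_all add: e n_def s_def m1_def m2_def algebra_simps)
  have 3: "dougall_step a b c d e N * dougall_value (a + 2) (b + 1) (c + 1) (d + 1) N
     = P * ((2 * n - b - c - d) * b * c * d / ((n - b) * (n - c) * (n - d) * (s + of_nat N + 1)))"
  proof -
    have aux: "- x * - s * a1 * a2 * b * c * d / (- m2 * b' * c' * d' * - m1 * n * n1) *
        (P * (n * n1 * b' * c' * d' * m1 / (a1 * a2 * nb * nc * nd * s))) =
        P * (x * b * c * d / (nb * nc * nd * m2))"
      if "a1 \<noteq> 0" "a2 \<noteq> 0" "b' \<noteq> 0" "c' \<noteq> 0" "d' \<noteq> 0" "s \<noteq> 0" "m1 \<noteq> 0" "n \<noteq> 0" "n1 \<noteq> 0"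
      for x s a1 a2 b c d m2 b' c' d' m1 n n1 P nb nc nd :: complex
      using that by (simp add: divide_inverse mult_ac) (simp add: field_simps)
    show ?thesis
      unfolding 2 dougall_step_def e1 unfolding m2_def[symmetric] unfolding m1_def[symmetric]
      by (rule aux) (use nz m in auto)
  qed
  have s': "s + of_nat N + 1 = n - b - c - d" by (simp add: s_def n_def)
  have "n * (n - b - c) * (n - b - d) * (n - c - d) =
     (n - b) * (n - c) * (n - d) * (n - b - c - d) + (2 * n - b - c - d) * b * c * d"
    by algebra
  hence "n * (n - b - c) * (n - b - d) * (n - c - d) / ((n - b) * (n - c) * (n - d) * (s + of_nat N + 1))
    = 1 + (2 * n - b - c - d) * b * c * d / ((n - b) * (n - c) * (n - d) * (s + of_nat N + 1))"
    using nz nz2 unfolding s' by (simp add: divide_simps)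
  thus ?thesis
    unfolding 1 3 P_def[symmetric] by (simp add: distrib_left)
qed

theorem dougall:
  fixes a b c d e :: complex
  assumes e: "e = 1 + 2 * a + of_nat N - b - c - d"
  assumes "a \<notin> \<int>" "e \<notin> \<int>" "a - b \<notin> \<int>" "a - c \<notin> \<int>" "a - d \<notin> \<int>" "a - e \<notin> \<int>"
  shows "(\<Sum>k\<le>N. dougall_term a b c d e N k) = dougall_value a b c d N"
  using assms
proof (induction N arbitrary: a b c d e)
  case 0
  thus ?case by (auto simp: dougall_term_def dougall_value_def)
next
  case (Suc N)
  \<comment> \<open>Lowering \<open>N\<close> by 1 lowers the balanced \<open>e\<close> by 1, and
    the shifts of a, b, c, d by 2, 1, 1, 1 raise it again by 1. Hence the induction hypothesis
    covers both series of the recurrence.\<close>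
  define e' where "e' = e - 1"
  have e': "e = e' + 1" by (simp add: e'_def)
  have *: "e' = 1 + 2 * a + of_nat N - b - c - d" 
    using Suc.prems(1) by (simp add: e'_def)
  have Z: "a \<notin> \<int>" "e' \<notin> \<int>" "a - b \<notin> \<int>" "a - c \<notin> \<int>" "a - d \<notin> \<int>" "a - e' \<notin> \<int>"
    using Suc.prems Ints_shift(10)[of a e] by (auto simp: e'_def algebra_simps)
  have sh: "a + 2 - (x + 1) \<in> \<int> \<longleftrightarrow> a - x \<in> \<int>" for x
    using Ints_shift(10)[of a x] by (simp add: algebra_simps)
  have IH1: "(\<Sum>k\<le>N. dougall_term a b c d e' N k) = dougall_value a b c d N"
    by (rule Suc.IH) (use * Z in auto)
  have IH2: "(\<Sum>k\<le>N. dougall_term (a + 2) (b + 1) (c + 1) (d + 1) (e' + 1) N k) = dougall_value (a + 2) (b + 1) (c + 1) (d + 1) N"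
    by (rule Suc.IH) (use * Z sh in \<open>auto simp: algebra_simps\<close>)
  \<comment> \<open>The series of length \<open>N\<close> is padded with a zero term so that both
    sums have the same range.\<close>
  have "dougall_term a b c d e' N (Suc N) = 0"
    by (simp add: dougall_term_def pochhammer_of_nat_eq_0_lemma)
  hence "dougall_value a b c d N = (\<Sum>k\<le>Suc N. dougall_term a b c d e' N k)"
    using IH1 by simp
  also have "\<dots> = dougall_term a b c d e' N 0 + (\<Sum>k\<le>N. dougall_term a b c d e' N (Suc k))"
    by (rule sum.atMost_Suc_shift)
  finally have 1: "dougall_value a b c d N = \<dots>" .
  have "(\<Sum>k\<le>Suc N. dougall_term a b c d e (Suc N) k) = 
     dougall_term a b c d e (Suc N) 0 + (\<Sum>k\<le>N. dougall_term a b c d e (Suc N) (Suc k))"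
    by (rule sum.atMost_Suc_shift)
  also have "(\<Sum>k\<le>N. dougall_term a b c d e (Suc N) (Suc k)) =
     (\<Sum>k\<le>N. dougall_term a b c d e' N (Suc k)) + 
     dougall_step a b c d e' N * (\<Sum>k\<le>N. dougall_term (a + 2) (b + 1) (c + 1) (d + 1) (e' + 1) N k)"
    unfolding e' dougall_term_step[OF Z(1,2,3,4,5,6)] by (simp add: sum.distrib sum_distrib_left)
  also have "dougall_term a b c d e (Suc N) 0 = dougall_term a b c d e' N 0"
    by (simp add: dougall_term_def)
  finally show ?case
    using 1 dougall_value_step[OF * Z] by (simp add: IH2)
qed

section \<open>Bailey's transformation of terminating very-well-poised 9F8 series\<close>

definition bailey_term where
  "bailey_term (a :: complex) b c d e f g N k =
     (a + 2 * of_nat k) / a * pochhammer a k * pochhammer b k * pochhammer c k * pochhammer d k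
       * pochhammer e k * pochhammer f k * pochhammer g k * pochhammer (- of_nat N) k /
     (fact k * pochhammer (1 + a - b) k * pochhammer (1 + a - c) k * pochhammer (1 + a - d) k
       * pochhammer (1 + a - e) k * pochhammer (1 + a - f) k * pochhammer (1 + a - g) k
       * pochhammer (1 + a + of_nat N) k)"

definition bailey_factor where
  "bailey_factor (a :: complex) l e f N =
     pochhammer (1 + a) N * pochhammer (1 + a - e - f) N * pochhammer (1 + l - e) N * pochhammer (1 + l - f) N /
     (pochhammer (1 + a - e) N * pochhammer (1 + a - f) N * pochhammer (1 + l) N * pochhammer (1 + l - e - f) N)"

lemma pochhammer_reflect:
  "pochhammer (x::complex) j = (-1) ^ j * pochhammer (1 - x - of_nat j) j"
  using pochhammer_minus[of "-x" j] by (simp add: algebra_simps)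

lemma pochhammer_diff_reflect:
  assumes "j \<le> N" "pochhammer (1 - x - of_nat N) j \<noteq> 0"
  shows "pochhammer (x::complex) (N - j) = pochhammer x N * (-1) ^ j / pochhammer (1 - x - of_nat N) j"
proof -
  have "pochhammer x N = pochhammer x (N - j) * pochhammer (x + of_nat (N - j)) j"
    using assms pochhammer_product'[of x "N - j" j] by simp
  also have "pochhammer (x + of_nat (N - j)) j = (-1) ^ j * pochhammer (1 - x - of_nat N) j"
    using assms by (subst pochhammer_reflect) (simp add: of_nat_diff algebra_simps)
  finally show ?thesis using assms by (simp add: field_simps)
qed

lemma pochhammer_uminus_nat:
  "pochhammer (- of_nat (j + m)) j = ((-1) ^ j * (fact (j + m) / fact m) :: complex)"
proof -
  have "fact (j + m) = pochhammer (1::complex) (m + j)"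
    by (simp add: pochhammer_fact add.commute)
  also have "\<dots> = fact m * pochhammer (1 + of_nat m) j"
    by (simp only: pochhammer_product') (simp add: pochhammer_fact)
  finally show ?thesis
    by (subst pochhammer_reflect) (simp add: algebra_simps)
qed

text \<open>Both (x)_{j+m} (x+j+m)_j and (x)_{2j} (x+2j)_m equal (x)_{2j+m}. This is how the base a
  + 2j of the inner sum arises.\<close>

lemma pochhammer_double:
  assumes "pochhammer (x + of_nat (j + m)) j \<noteq> 0"
  shows "pochhammer (x::complex) (j + m) =
     pochhammer x (2 * j) * pochhammer (x + 2 * of_nat j) m / pochhammer (x + of_nat (j + m)) j"
proof -
  have "pochhammer x (j + m) * pochhammer (x + of_nat (j + m)) j = pochhammer x (2 * j + m)"
    by (subst pochhammer_product'[symmetric]) (simp only: mult_2 add_ac)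
  also have "\<dots> = pochhammer x (2 * j) * pochhammer (x + 2 * of_nat j) m"
    by (simp only: pochhammer_product') simp
  finally show ?thesis using assms by (simp add: field_simps)
qed

text \<open>What depends on j alone in the double sum after the substitution k = j + m.\<close>

definition bailey_outer where
  "bailey_outer (a :: complex) l B C D e f g N j =
     (a + 2 * of_nat j) / a * pochhammer a (2 * j) * pochhammer e j * pochhammer f j * pochhammer g j
       * pochhammer (- of_nat N) j /
     (pochhammer (1 + a - e) j * pochhammer (1 + a - f) j * pochhammer (1 + a - g) j
       * pochhammer (1 + a + of_nat N) j * pochhammer (1 + l) (2 * j)) *
     ((l + 2 * of_nat j) / l * pochhammer l j * pochhammer B j * pochhammer C j * pochhammer D j /
     (fact j * pochhammer (1 + l - B) j * pochhammer (1 + l - C) j * pochhammer (1 + l - D) j))"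

text \<open>
  The quotient of shifted factorials in \<open>b\<close>, \<open>c\<close>, \<open>d\<close> is itself a Dougall sum over \<open>j\<close> with base \<open>l\<close>;
  after exchanging the summations the sum over \<open>m = k - j\<close> is again of Dougall type, with base \<open>a + 2 j\<close>.
\<close>
lemma bailey_inner:
  fixes a l e f g B C D :: complex
  assumes "a \<notin> \<int>" "l \<notin> \<int>" "l - a \<notin> \<int>" and N: "j + m \<le> N"
  shows "(a + 2 * of_nat (j + m)) / a * pochhammer a (j + m) * pochhammer e (j + m) * pochhammer f (j + m)
       * pochhammer g (j + m) * pochhammer (- of_nat N) (j + m) /
     (fact (j + m) * pochhammer (1 + a - e) (j + m) * pochhammer (1 + a - f) (j + m)
       * pochhammer (1 + a - g) (j + m) * pochhammer (1 + a + of_nat N) (j + m))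
     * pochhammer (a - l) (j + m) / pochhammer (1 + l) (j + m)
     * dougall_term l B C D (a + of_nat (j + m)) (j + m) j
   = bailey_outer a l B C D e f g N j
     * dougall_term (a + 2 * of_nat j) (a - l) (e + of_nat j) (f + of_nat j) (g + of_nat j) (N - j) m"
proof -
  define k where "k = j + m"
  have x1: "pochhammer (a + of_nat k) j \<noteq> 0" and x3: "pochhammer (1 + l + of_nat k) j \<noteq> 0"
    and x2: "pochhammer (1 + l - (a + of_nat k)) j \<noteq> 0" and a2j: "a + 2 * of_nat j \<noteq> 0"
  proof -
    have "l - a - of_nat k \<notin> \<int>" "a + of_nat (2 * j) \<notin> \<int>" using assms by (simp_all only: Ints_shift not_False_eq_True)
    thus "pochhammer (1 + l - (a + of_nat k)) j \<noteq> 0" "a + 2 * of_nat j \<noteq> 0"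
      using not_Ints_neq_0[of "a + of_nat (2 * j)"]
      by (auto intro!: pochhammer_not_Ints_neq_0 simp: diff_diff_add)
  qed (rule pochhammer_not_Ints_neq_0; use assms in simp)+
  have s: "(-1) ^ j * (-1) ^ j = (1::complex)" by (simp flip: power_mult_distrib)
  have P: "pochhammer a k = pochhammer a (2 * j) * pochhammer (a + 2 * of_nat j) m / pochhammer (a + of_nat k) j"
    using pochhammer_double[of a j m] x1 by (simp add: k_def)
  have L: "pochhammer (1 + l) k = pochhammer (1 + l) (2 * j) * pochhammer (1 + l + 2 * of_nat j) m / pochhammer (1 + l + of_nat k) j"
    using pochhammer_double[of "1 + l" j m] x3 by (simp add: k_def)
  have q: "pochhammer (a - l) k = (-1) ^ j * (pochhammer (a - l) m * pochhammer (1 + l - (a + of_nat k)) j)"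
    using pochhammer_product'[of "a - l" m j] pochhammer_reflect[of "a - l + of_nat m" j]
    by (simp add: k_def algebra_simps)
  have split: "pochhammer x k = pochhammer x j * pochhammer (x + of_nat j) m" for x :: complex
    unfolding k_def by (rule pochhammer_product')
  have F: "pochhammer (- of_nat k) j = (-1) ^ j * ((fact k / fact m)::complex)"
    unfolding k_def by (rule pochhammer_uminus_nat)
  have base: "1 + (a + 2 * of_nat j) - (a - l) = 1 + l + 2 * of_nat j"
     "1 + (a + 2 * of_nat j) - (x + of_nat j) = 1 + a - x + of_nat j"
     "- of_nat (N - j) = - of_nat N + (of_nat j :: complex)"
     "1 + (a + 2 * of_nat j) + of_nat (N - j) = 1 + a + of_nat N + of_nat j"
     "a + 2 * of_nat j + 2 * of_nat m = a + 2 * of_nat k" for x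
    using N by (simp_all add: k_def of_nat_diff algebra_simps)
  have aux: "a2k / a * (P1 * P2 / x1) * (e1 * e2) * (f1 * f2) * (g1 * g2) * (n1 * n2) /
      (F * (ee1 * ee2) * (ff1 * ff2) * (gg1 * gg2) * (nn1 * nn2)) * (s * (q * x2)) / (L1 * L2 / x3)
      * (l2j / l * lj * Bj * Cj * Dj * x1 * (s * (F / mf)) / (fj * b1 * c1 * d1 * x2 * x3))
    = (a2j / a * P1 * e1 * f1 * g1 * n1 / (ee1 * ff1 * gg1 * nn1 * L1) * (l2j / l * lj * Bj * Cj * Dj / (fj * b1 * c1 * d1)))
      * (a2k / a2j * P2 * q * e2 * f2 * g2 * n2 / (mf * L2 * ee2 * ff2 * gg2 * nn2))" (is "?L = ?R")
    if "x1 \<noteq> 0" "x2 \<noteq> 0" "x3 \<noteq> 0" "a2j \<noteq> 0" "F \<noteq> 0" "s * s = 1"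
    for a2k a P1 P2 x1 e1 e2 f1 f2 g1 g2 n1 n2 F ee1 ee2 ff1 ff2 gg1 gg2 nn1 nn2 s q x2 L1 L2 x3
      l2j l lj Bj Cj Dj mf fj b1 c1 d1 a2j :: complex
  proof -
    have "?L * (a2j / a2j) = ?R * ((x1 / x1) * (x2 / x2) * (x3 / x3) * (F / F) * (s * s))"
      by (simp only: divide_inverse inverse_mult_distrib inverse_inverse_eq mult_ac)
    thus ?thesis using that by simp
  qed
  show ?thesis
    unfolding bailey_outer_def dougall_term_def k_def[symmetric] base P L q F
      split[of e] split[of f] split[of g] split[of "1 + a - e"] split[of "1 + a - f"] split[of "1 + a - g"]
      split[of "- of_nat N"] split[of "1 + a + of_nat N"]
    by (rule aux) (use x1 x2 x3 a2j s in auto)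
qed

text \<open>The hypothesis on \<open>g\<close> means 1 + a - e - f = g - l - N and 1 + l - e - f = g
  - a - N. Reversing the factorials of length N - j therefore produces 1/(1+l-g)_j and 1/(1+a-g)_j,
  which are what turns the coefficient into a term with base \<open>l\<close>.\<close>

lemma bailey_outer_value:
  fixes a l e f g B C D :: complex
  assumes g: "g = 1 + a + l + of_nat N - e - f" and j: "j \<le> N"
  assumes "a \<notin> \<int>" "l \<notin> \<int>" "a - e \<notin> \<int>" "a - f \<notin> \<int>" "a - g \<notin> \<int>" "l - e \<notin> \<int>" "l - f \<notin> \<int>" "l - g \<notin> \<int>"
  shows "bailey_outer a l B C D e f g N j * dougall_value (a + 2 * of_nat j) (a - l) (e + of_nat j) (f + of_nat j) (N - j)
    = bailey_factor a l e f N * bailey_term l B C D e f g N j"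
proof -
  define M where "M = N - j"
  have NM: "N = j + M" using j by (simp add: M_def)
  have nz: "pochhammer (1 + l - e) j \<noteq> 0" "pochhammer (1 + l - f) j \<noteq> 0" "pochhammer (1 + l - g) j \<noteq> 0"
    "pochhammer (1 + a - g) j \<noteq> 0" "pochhammer (1 + a + of_nat N) j \<noteq> 0" "pochhammer (1 + l + of_nat N) j \<noteq> 0"
    "pochhammer (1 + a - e) j \<noteq> 0" "pochhammer (1 + a - f) j \<noteq> 0" "pochhammer (1 + l) (2 * j) \<noteq> 0"
    by (rule pochhammer_not_Ints_neq_0; use assms(3-) in simp)+
  have a0: "a \<noteq> 0" using assms by auto
  have r: "pochhammer (x + of_nat j) M = pochhammer x N / pochhammer x j" if "pochhammer x j \<noteq> 0" for x :: complex
    using that pochhammer_product'[of x j M] by (simp add: NM field_simps)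
  have d: "pochhammer (1 + x + 2 * of_nat j) M * pochhammer (1 + x) (2 * j) = pochhammer (1 + x) N * pochhammer (1 + x + of_nat N) j"
    for x :: complex
  proof -
    have "pochhammer (1 + x + 2 * of_nat j) M * pochhammer (1 + x) (2 * j) = pochhammer (1 + x) (2 * j + M)"
      by (simp add: pochhammer_product')
    also have "2 * j + M = N + j" by (simp add: NM)
    also have "pochhammer (1 + x) (N + j) = pochhammer (1 + x) N * pochhammer (1 + x + of_nat N) j"
      by (rule pochhammer_product')
    finally show ?thesis .
  qed
  have l1: "pochhammer (1 + l + 2 * of_nat j) M = pochhammer (1 + l) N * pochhammer (1 + l + of_nat N) j / pochhammer (1 + l) (2 * j)"
    using d[of l] nz by (simp add: field_simps)
  have a1: "(a + 2 * of_nat j) / a * pochhammer a (2 * j) = pochhammer (1 + a) (2 * j)"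
    using pochhammer_rec[of a "2 * j"] pochhammer_Suc[of a "2 * j"] a0 by (simp add: field_simps)
  have a2: "pochhammer (1 + (a + 2 * of_nat j)) M = pochhammer (1 + a) N * pochhammer (1 + a + of_nat N) j / pochhammer (1 + a) (2 * j)"
  proof -
    have "pochhammer (1 + a) (2 * j) \<noteq> 0" by (rule pochhammer_not_Ints_neq_0) (use assms in simp)
    thus ?thesis using d[of a] by (simp add: field_simps)
  qed
  have p2: "pochhammer (1 + a) (2 * j) \<noteq> 0" by (rule pochhammer_not_Ints_neq_0) (use assms in simp)
  have R1: "pochhammer (1 + a - e - f) M = pochhammer (1 + a - e - f) N * (-1) ^ j / pochhammer (1 + l - g) j"
    using pochhammer_diff_reflect[OF j, of "1 + a - e - f"] nz unfolding M_def g by (simp add: algebra_simps)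
  have R2: "pochhammer (1 + l - e - f) M = pochhammer (1 + l - e - f) N * (-1) ^ j / pochhammer (1 + a - g) j"
    using pochhammer_diff_reflect[OF j, of "1 + l - e - f"] nz unfolding M_def g by (simp add: algebra_simps)
  have base: "1 + (a + 2 * of_nat j) - (a - l) = 1 + l + 2 * of_nat j"
     "1 + (a + 2 * of_nat j) - (x + of_nat j) = 1 + a - x + of_nat j"
     "1 + (a + 2 * of_nat j) - (a - l) - (x + of_nat j) = 1 + l - x + of_nat j"
     "1 + (a + 2 * of_nat j) - (x + of_nat j) - (y + of_nat j) = 1 + a - x - y"
     "1 + (a + 2 * of_nat j) - (a - l) - (x + of_nat j) - (y + of_nat j) = 1 + l - x - y" for x y
    by (simp_all add: algebra_simps)
  have aux: "p2 * e1 * f1 * g1 * n1 / (ee1 * ff1 * gg1 * nn1 * L1) * (l2 / l * lj * Bj * Cj * Dj / (fj * b1 * c1 * d1)) *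
     ((A * nn1 / p2) * (E / ee2) * (F / ff2) * (X * s / gg2) / ((LN * ln1 / L1) * (EE / ee1) * (FF / ff1) * (Y * s / gg1)))
    = A * X * E * F / (EE * FF * LN * Y) *
     (l2 / l * lj * Bj * Cj * Dj * e1 * f1 * g1 * n1 / (fj * b1 * c1 * d1 * ee2 * ff2 * gg2 * ln1))" (is "?L = ?R")
    if "p2 \<noteq> 0" "ee1 \<noteq> 0" "ff1 \<noteq> 0" "gg1 \<noteq> 0" "nn1 \<noteq> 0" "L1 \<noteq> 0" "s \<noteq> 0"
    for p2 e1 f1 g1 n1 ee1 ff1 gg1 nn1 L1 l2 l lj Bj Cj Dj fj b1 c1 d1 A E ee2 F ff2 X s gg2 LN ln1 EE FF Y :: complex
  proof -
    have "?L = ?R * ((p2 / p2) * (ee1 / ee1) * (ff1 / ff1) * (gg1 / gg1) * (nn1 / nn1) * (L1 / L1) * (s / s))"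
      by (simp only: divide_inverse inverse_mult_distrib inverse_inverse_eq mult_ac)
    thus ?thesis using that by simp
  qed
  show ?thesis
    unfolding bailey_outer_def bailey_term_def bailey_factor_def dougall_value_def M_def[symmetric]
    unfolding base(5) unfolding base(3,4) unfolding base(1,2) a1 a2 l1 R1 R2
      r[OF nz(1)] r[OF nz(2)] r[OF nz(7)] r[OF nz(8)]
    by (rule aux) (use nz p2 in auto)
qed

theorem bailey_9F8:
  fixes a b c d e f g l :: complex
  assumes l: "l = 1 + 2 * a - b - c - d" and g: "g = 1 + a + l + of_nat N - e - f"
  assumes Z: "a \<notin> \<int>" "l \<notin> \<int>" "l - a \<notin> \<int>" "a - b \<notin> \<int>" "a - c \<notin> \<int>" "a - d \<notin> \<int>"
    "a - e \<notin> \<int>" "a - f \<notin> \<int>" "a - g \<notin> \<int>" "l - e \<notin> \<int>" "l - f \<notin> \<int>" "l - g \<notin> \<int>" "g \<notin> \<int>"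
  shows "(\<Sum>k\<le>N. bailey_term a b c d e f g N k) =
    bailey_factor a l e f N * (\<Sum>k\<le>N. bailey_term l (l + b - a) (l + c - a) (l + d - a) e f g N k)"
proof -
  define B C D where "B = l + b - a" and "C = l + c - a" and "D = l + d - a"
  \<comment> \<open>The part of the term without \<open>b\<close>, \<open>c\<close>,
    \<open>d\<close>, times (a-l)_k/(1+l)_k, which cancels the factors of the Dougall value with
    base \<open>l\<close> that involve neither of them individually.\<close>
  define co where "co k = (a + 2 * of_nat k) / a * pochhammer a k * pochhammer e k * pochhammer f k
       * pochhammer g k * pochhammer (- of_nat N) k /
     (fact k * pochhammer (1 + a - e) k * pochhammer (1 + a - f) k
       * pochhammer (1 + a - g) k * pochhammer (1 + a + of_nat N) k)
     * pochhammer (a - l) k / pochhammer (1 + l) k" for k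
  have 1: "bailey_term a b c d e f g N k = (\<Sum>j\<le>k. co k * dougall_term l B C D (a + of_nat k) k j)" for k
  proof -
    have D: "(\<Sum>j\<le>k. dougall_term l B C D (a + of_nat k) k j) = dougall_value l B C D k"
    proof (rule dougall)
      show "a + of_nat k = 1 + 2 * l + of_nat k - B - C - D"
        by (simp add: B_def C_def D_def l)
      have "l - a - of_nat k \<notin> \<int>" using Z by simp
      thus "l - (a + of_nat k) \<notin> \<int>" by (simp add: diff_diff_add)
    qed (use Z in \<open>simp_all add: B_def C_def D_def\<close>)
    have e: "1 + l - B - C = d" "1 + l - B - D = c" "1 + l - C - D = b" "1 + l - B = 1 + a - b"
      "1 + l - C = 1 + a - c" "1 + l - D = 1 + a - d" "1 + l - B - C - D = a - l"
      by (simp_all add: B_def C_def D_def l)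
    have nz: "pochhammer (a - l) k \<noteq> 0" "pochhammer (1 + l) k \<noteq> 0"
      by (rule pochhammer_not_Ints_neq_0; use Z in \<open>simp add: minus_diff_eq[of l a, symmetric] del: minus_diff_eq\<close>)+
    have "co k * dougall_value l B C D k = bailey_term a b c d e f g N k"
    proof -
      have aux: "a2 / a * pa * pe * pf * pg * pn / (F * ee * ff * gg * nn) * q / L * (L * d * c * b / (bb * cc * dd * q))
         = a2 / a * pa * b * c * d * pe * pf * pg * pn / (F * bb * cc * dd * ee * ff * gg * nn)" (is "?L = ?R")
        if "q \<noteq> 0" "L \<noteq> 0"
        for a2 a pa pe pf pg pn F ee ff gg nn q L d c b bb cc dd :: complex
      proof -
        have "?L = ?R * ((q / q) * (L / L))"
          by (simp only: divide_inverse inverse_mult_distrib inverse_inverse_eq mult_ac)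
        thus ?thesis using that by simp
      qed
      show ?thesis
        unfolding co_def dougall_value_def bailey_term_def
        unfolding e(7) unfolding e(1,2,3) unfolding e(4,5,6) by (rule aux) (use nz in auto)
    qed
    thus ?thesis by (simp only: sum_distrib_left[symmetric] D)
  qed
  define h where "h j m = bailey_outer a l B C D e f g N j
     * dougall_term (a + 2 * of_nat j) (a - l) (e + of_nat j) (f + of_nat j) (g + of_nat j) (N - j) m" for j m
  have 2: "co k * dougall_term l B C D (a + of_nat k) k j = h j (k - j)" if "j \<le> k" "k \<le> N" for j k
    using bailey_inner[OF Z(1,2,3), of j "k - j" N e f g B C D] that by (simp add: co_def h_def)
  have "(\<Sum>k\<le>N. bailey_term a b c d e f g N k) = (\<Sum>k\<le>N. \<Sum>j\<le>k. h j (k - j))"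
    unfolding 1 by (intro sum.cong) (auto simp: 2)
  also have "\<dots> = (\<Sum>(j,m)\<in>{(j,m). j + m \<le> N}. h j m)"
    by (rule sum.triangle_reindex_eq[symmetric])
  also have "{(j,m). j + m \<le> N} = Sigma {..N} (\<lambda>j. {..N - j})" by auto
  also have "(\<Sum>(j,m)\<in>Sigma {..N} (\<lambda>j. {..N - j}). h j m) = (\<Sum>j\<le>N. \<Sum>m\<le>N - j. h j m)"
    by (rule sum.Sigma[symmetric]) auto
  also have "\<dots> = (\<Sum>j\<le>N. bailey_factor a l e f N * bailey_term l B C D e f g N j)"
  proof (intro sum.cong refl)
    fix j assume "j \<in> {..N}"
    hence j: "j \<le> N" by simp
    have "(\<Sum>m\<le>N - j. dougall_term (a + 2 * of_nat j) (a - l) (e + of_nat j) (f + of_nat j) (g + of_nat j) (N - j) m)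
      = dougall_value (a + 2 * of_nat j) (a - l) (e + of_nat j) (f + of_nat j) (N - j)"
    proof (rule dougall)
      show "g + of_nat j = 1 + 2 * (a + 2 * of_nat j) + of_nat (N - j) - (a - l) - (e + of_nat j) - (f + of_nat j)"
        using j by (simp add: g of_nat_diff algebra_simps)
      have "a + of_nat (2 * j) \<notin> \<int>" "l + of_nat (2 * j) \<notin> \<int>" using Z by (simp_all only: Ints_shift not_False_eq_True)
      thus "a + 2 * of_nat j \<notin> \<int>" "a + 2 * of_nat j - (a - l) \<notin> \<int>" by (simp_all add: algebra_simps)
      have "a - x + of_nat j \<notin> \<int>" if "a - x \<notin> \<int>" for x using that by simp
      thus "a + 2 * of_nat j - (e + of_nat j) \<notin> \<int>" "a + 2 * of_nat j - (f + of_nat j) \<notin> \<int>"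
        "a + 2 * of_nat j - (g + of_nat j) \<notin> \<int>" using Z by (simp_all add: algebra_simps)
    qed (use Z in simp)
    thus "(\<Sum>m\<le>N - j. h j m) = bailey_factor a l e f N * bailey_term l B C D e f g N j"
      unfolding h_def sum_distrib_left[symmetric]
      using bailey_outer_value[OF g j, of B C D] Z by simp
  qed
  finally show ?thesis by (simp add: sum_distrib_left B_def C_def D_def)
qed

section \<open>Bounds and continuity of Saalschuetzian series\<close>

text \<open>Monomial by monomial the product is dominated by that of the 1 + |w|, hence by the
  exponential of the sum of the |w|. The second bound controls the remainder after the linear part
  and needs the first one in its induction step.\<close>

lemma norm_prod_list_one_plus:
  fixes ws :: "complex list"
  shows "norm (prod_list (map (\<lambda>w. 1 + w) ws) - 1) \<le> exp (sum_list (map norm ws)) - 1"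
    and "norm (prod_list (map (\<lambda>w. 1 + w) ws) - 1 - sum_list ws)
      \<le> exp (sum_list (map norm ws)) - 1 - sum_list (map norm ws)"
proof (induction ws)
  case (Cons w ws)
  define P where "P = prod_list (map (\<lambda>w. 1 + w) ws)"
  define W where "W = sum_list (map norm ws)"
  have e: "exp W * (1 + norm w) \<le> exp (norm w + W)"
    using exp_ge_add_one_self[of "norm w"] by (simp add: exp_add mult.commute)
  have P1: "norm (P - 1) \<le> exp W - 1" and P2: "norm (P - 1 - sum_list ws) \<le> exp W - 1 - W"
    using Cons.IH by (auto simp: P_def W_def)
  have "norm ((1 + w) * P - 1) = norm ((P - 1) + w * (P - 1) + w)" by (simp add: algebra_simps)
  also have "\<dots> \<le> norm (P - 1) + norm w * norm (P - 1) + norm w"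
    by (metis (no_types, opaque_lifting) add_mono norm_mult norm_triangle_ineq norm_triangle_le order_refl)
  also have "\<dots> \<le> (exp W - 1) + norm w * (exp W - 1) + norm w"
    using P1 by (intro add_mono mult_left_mono) auto
  also have "\<dots> = exp W * (1 + norm w) - 1" by (simp add: algebra_simps)
  finally have 1: "norm ((1 + w) * P - 1) \<le> exp (norm w + W) - 1" using e by linarith
  have "norm ((1 + w) * P - 1 - (w + sum_list ws)) = norm ((P - 1 - sum_list ws) + w * (P - 1))"
    by (simp add: algebra_simps)
  also have "\<dots> \<le> norm (P - 1 - sum_list ws) + norm w * norm (P - 1)"
    by (metis norm_mult norm_triangle_ineq)
  also have "\<dots> \<le> (exp W - 1 - W) + norm w * (exp W - 1)"
    using P1 P2 by (intro add_mono mult_left_mono) auto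
  also have "\<dots> = exp W * (1 + norm w) - 1 - (norm w + W)" by (simp add: algebra_simps)
  finally have 2: "norm ((1 + w) * P - 1 - (w + sum_list ws)) \<le> exp (norm w + W) - 1 - (norm w + W)"
    using e by linarith
  {
    case 1
    show ?case using \<open>norm ((1 + w) * P - 1) \<le> exp (norm w + W) - 1\<close> by (simp add: P_def W_def)
  next
    case 2
    show ?case using \<open>norm ((1 + w) * P - 1 - (w + sum_list ws)) \<le> exp (norm w + W) - 1 - (norm w + W)\<close>
      by (simp add: P_def W_def)
  }
qed auto

text \<open>Equal sums cancel the terms of first order in 1/s, so the quotient differs from 1 only
  to second order. The constant 8 is 2 over 1/4: the numerator error is at most 2 W^2 and the
  denominator at least 1/4.\<close>

lemma norm_prod_list_ratio:
  fixes us vs :: "complex list"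
  assumes len: "length us = n" "length vs = n" and sum: "sum_list us = sum_list vs"
    and B: "\<And>x. x \<in> set us \<union> set vs \<Longrightarrow> norm x \<le> B"
    and s: "norm s \<ge> 2 * real n * B" "s \<noteq> 0"
  shows "prod_list (map (\<lambda>v. s + v) vs) \<noteq> 0"
    and "norm (prod_list (map (\<lambda>u. s + u) us) / prod_list (map (\<lambda>v. s + v) vs) - 1) \<le> 8 * (n * B / norm s)\<^sup>2"
proof -
  define W where "W = n * B / norm s"
  define P where "P xs = prod_list (map (\<lambda>w. 1 + w) (map (\<lambda>x. x / s) xs))" for xs
  have W: "W \<le> 1 / 2" using s by (simp add: W_def field_simps)
  have bd: "norm (P xs - 1 - sum_list xs / s) \<le> W\<^sup>2" "sum_list (map norm (map (\<lambda>x. x / s) xs)) \<le> W" "0 \<le> W"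
    if "length xs = n" "\<And>x. x \<in> set xs \<Longrightarrow> norm x \<le> B" for xs
  proof -
    define w where "w = sum_list (map norm (map (\<lambda>x. x / s) xs))"
    have w0: "0 \<le> w" unfolding w_def by (intro sum_list_nonneg) auto
    have "w \<le> sum_list (map (\<lambda>x. B / norm s) xs)"
      unfolding w_def map_map by (intro sum_list_mono) (auto simp: norm_divide that divide_right_mono)
    also have "\<dots> = W" using that by (simp add: W_def sum_list_triv)
    finally have wW: "w \<le> W" .
    thus "sum_list (map norm (map (\<lambda>x. x / s) xs)) \<le> W" "0 \<le> W" using w0 by (auto simp: w_def)
    have "norm (P xs - 1 - sum_list (map (\<lambda>x. x / s) xs)) \<le> exp w - 1 - w"
      unfolding P_def w_def by (rule norm_prod_list_one_plus)
    also have "\<dots> \<le> w\<^sup>2" using exp_bound[of w] w0 wW W by simp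
    also have "\<dots> \<le> W\<^sup>2" using w0 wW by (simp add: power_mono)
    also have "sum_list (map (\<lambda>x. x / s) xs) = sum_list xs / s"
      by (induction xs) (auto simp: add_divide_distrib)
    finally show "norm (P xs - 1 - sum_list xs / s) \<le> W\<^sup>2" .
  qed
  have PQ: "norm (P us - P vs) \<le> 2 * W\<^sup>2"
  proof -
    have "P us - P vs = (P us - 1 - sum_list us / s) - (P vs - 1 - sum_list vs / s)"
      by (simp add: sum)
    also have "norm \<dots> \<le> norm (P us - 1 - sum_list us / s) + norm (P vs - 1 - sum_list vs / s)"
      by (rule norm_triangle_ineq4)
    also have "\<dots> \<le> W\<^sup>2 + W\<^sup>2"
      using bd(1)[of us] bd(1)[of vs] len B by (intro add_mono) auto
    finally show ?thesis by simp
  qed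
  have Q: "norm (P vs) \<ge> 1 / 4"
  proof -
    have W0: "0 \<le> W" using bd(3)[of us] len B by auto
    have "norm (P vs - 1) \<le> exp (sum_list (map norm (map (\<lambda>x. x / s) vs))) - 1"
      unfolding P_def by (rule norm_prod_list_one_plus)
    also have "\<dots> \<le> exp W - 1" using bd(2)[of vs] len B by simp
    also have "\<dots> \<le> W + W\<^sup>2" using exp_bound[of W] W W0 by simp
    also have "\<dots> \<le> 1 / 2 + (1 / 2)\<^sup>2" using W W0 by (intro add_mono power_mono) auto
    finally have "norm (P vs - 1) \<le> 3 / 4" by (simp add: power2_eq_square)
    thus ?thesis using norm_triangle_ineq2[of 1 "1 - P vs"] by (simp add: norm_minus_commute)
  qed
  have eq: "prod_list (map (\<lambda>u. s + u) xs) = s ^ length xs * P xs" for xs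
    using s(2) by (induction xs) (auto simp: P_def field_simps)
  from Q have Q0: "P vs \<noteq> 0" by auto
  thus "prod_list (map (\<lambda>v. s + v) vs) \<noteq> 0" using s(2) by (simp add: eq)
  have "prod_list (map (\<lambda>u. s + u) us) / prod_list (map (\<lambda>v. s + v) vs) - 1 = (P us - P vs) / P vs"
    using s(2) Q0 len by (simp add: eq divide_simps)
  also have "norm \<dots> \<le> (2 * W\<^sup>2) / (1 / 4)"
    unfolding norm_divide using PQ Q by (intro frac_le) auto
  finally show "norm (prod_list (map (\<lambda>u. s + u) us) / prod_list (map (\<lambda>v. s + v) vs) - 1) \<le> 8 * (n * B / norm s)\<^sup>2"
    by (simp add: W_def)
qed

lemma summable_inverse_one_plus_square: "summable (\<lambda>k. 1 / (1 + real k ^ 2))"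
proof (rule summable_comparison_test_ev)
  show "eventually (\<lambda>k. norm (1 / (1 + real k ^ 2)) \<le> 1 / real k ^ 2) sequentially"
    using eventually_gt_at_top[of 0] by eventually_elim (auto intro!: divide_left_mono mult_pos_pos add_pos_nonneg)
  show "summable (\<lambda>k. 1 / real k ^ 2)" using inverse_power_summable[of 2, where 'a = real] by (simp add: inverse_eq_divide)
qed

lemma exp_minus_double_le: "0 \<le> x \<Longrightarrow> x \<le> 1 / 2 \<Longrightarrow> exp (- (2 * x)) \<le> 1 - (x::real)"
proof -
  assume x: "0 \<le> x" "x \<le> 1 / 2"
  have "1 + 2 * x \<le> exp (2 * x)" by (rule exp_ge_add_one_self)
  hence "exp (- (2 * x)) \<le> 1 / (1 + 2 * x)"
    using x by (simp add: exp_minus inverse_eq_divide frac_le)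
  also have "\<dots> \<le> 1 - x" 
  proof -
    have "x * (1 - 2 * x) \<ge> 0" using x by simp
    hence "1 \<le> (1 - x) * (1 + 2 * x)" by (simp add: algebra_simps)
    thus ?thesis using x by (simp add: divide_le_eq)
  qed
  finally show ?thesis .
qed

lemma norm_add_nat_ge:
  assumes "Re s \<ge> 0" shows "norm (s + of_nat k) ^ 2 \<ge> norm s ^ 2 + real k ^ 2"
proof -
  have "norm (s + of_nat k) ^ 2 = norm s ^ 2 + real k ^ 2 + 2 * Re s * real k"
    by (simp only: cmod_power2) (simp add: power2_eq_square algebra_simps)
  thus ?thesis using assms by simp
qed

text \<open>The quotients of consecutive values are 1 + O(1/|s+k|^2), and |s+k|^2 is at least 1 +
  k^2 for Re s \<ge> 0, so their product converges. The constant depends only on \<open>n\<close>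
  and \<open>B\<close>, not on \<open>s\<close> or the lists, and the estimate is two-sided; both
  features matter later.\<close>

lemma telescoping_bound:
  fixes us vs :: "complex list" and q :: "nat \<Rightarrow> complex"
  assumes len: "length us = n" "length vs = n" and sum: "sum_list us = sum_list vs"
    and B: "\<And>x. x \<in> set us \<union> set vs \<Longrightarrow> norm x \<le> B" "B \<ge> 0"
    and s: "norm s \<ge> 4 * real n * B" "norm s \<ge> 1" "Re s \<ge> 0"
    and q: "\<And>k. q (Suc k) * prod_list (map (\<lambda>v. s + of_nat k + v) vs) =
                   q k * prod_list (map (\<lambda>u. s + of_nat k + u) us)"
  defines "K \<equiv> exp (16 * (n * B)\<^sup>2 * (\<Sum>k. 1 / (1 + real k ^ 2)))"
  shows "norm (q k) \<le> K * norm (q 0)" "norm (q 0) \<le> K * norm (q k)"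
proof -
  define x where "x k = 8 * (n * B / norm (s + of_nat k))\<^sup>2" for k :: nat
  have ge: "norm (s + of_nat k) \<ge> norm s" for k
  proof (rule power2_le_imp_le)
    have "(0::real) \<le> real k ^ 2" by simp
    thus "(norm s)\<^sup>2 \<le> (norm (s + of_nat k))\<^sup>2" using norm_add_nat_ge[OF s(3), of k] by linarith
  qed auto
  have sk: "s + of_nat k \<noteq> 0" for k using ge[of k] s(2) by auto
  have x12: "x k \<le> 1 / 2" "0 \<le> x k" for k
  proof -
    \<comment> \<open>The factor 4 in the assumption on |s| is chosen for x k \<le> 1/2, the range
      in which \<open>exp_minus_double_le\<close> bounds 1 - x k from below.\<close>
    have "n * B / norm (s + of_nat k) \<le> 1 / 4"
      using ge[of k] s sk[of k] by (simp add: field_simps)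
    hence "(n * B / norm (s + of_nat k))\<^sup>2 \<le> (1 / 4)\<^sup>2" using B(2) by (intro power_mono) auto
    also have "\<dots> = 1 / 16" by (simp add: power2_eq_square)
    finally show "x k \<le> 1 / 2" unfolding x_def by linarith
  qed (simp add: x_def)
  have r: "norm (q (Suc k)) \<le> (1 + x k) * norm (q k)" "(1 - x k) * norm (q k) \<le> norm (q (Suc k))" for k
  proof -
    define R where "R = prod_list (map (\<lambda>u. s + of_nat k + u) us) / prod_list (map (\<lambda>v. s + of_nat k + v) vs)"
    have bn: "2 * real n * B \<le> norm (s + of_nat k)"
    proof -
      have "2 * real n * B \<le> 4 * real n * B" using B(2) by (intro mult_right_mono) auto
      thus ?thesis using ge[of k] s(1) by linarith
    qed
    note * = norm_prod_list_ratio[OF len sum B(1) bn sk]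
    have "q (Suc k) = R * q k" using q[of k] *(1) by (simp add: R_def field_simps)
    moreover have "norm (R - 1) \<le> x k" using *(2) by (simp add: R_def x_def)
    hence "norm R \<le> 1 + x k" "norm R \<ge> 1 - x k"
      using norm_triangle_ineq2[of R 1] norm_triangle_ineq2[of 1 R] by (auto simp: norm_minus_commute)
    ultimately show "norm (q (Suc k)) \<le> (1 + x k) * norm (q k)" "(1 - x k) * norm (q k) \<le> norm (q (Suc k))"
      by (auto simp: norm_mult mult_right_mono)
  qed
  have up: "norm (q k) \<le> exp (\<Sum>i<k. 2 * x i) * norm (q 0)" for k
  proof (induction k)
    case (Suc k)
    have "norm (q (Suc k)) \<le> (1 + x k) * norm (q k)" by (rule r)
    also have "\<dots> \<le> exp (2 * x k) * norm (q k)"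
    proof (intro mult_right_mono)
      show "1 + x k \<le> exp (2 * x k)"
        using exp_ge_add_one_self[of "2 * x k"] x12(2)[of k] by linarith
    qed auto
    also have "\<dots> \<le> exp (2 * x k) * (exp (\<Sum>i<k. 2 * x i) * norm (q 0))"
      using Suc.IH by (intro mult_left_mono) auto
    finally show ?case by (simp add: exp_add mult_ac)
  qed auto
  have lo: "norm (q 0) \<le> exp (\<Sum>i<k. 2 * x i) * norm (q k)" for k
  proof (induction k)
    case (Suc k)
    have "exp (- (2 * x k)) * norm (q k) \<le> (1 - x k) * norm (q k)"
      using exp_minus_double_le[of "x k"] x12[of k] by (intro mult_right_mono) auto
    also have "\<dots> \<le> norm (q (Suc k))" by (rule r)
    finally have *: "norm (q k) \<le> exp (2 * x k) * norm (q (Suc k))"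
      by (simp add: exp_minus field_simps)
    note Suc.IH
    also have "exp (\<Sum>i<k. 2 * x i) * norm (q k) \<le> exp (\<Sum>i<k. 2 * x i) * (exp (2 * x k) * norm (q (Suc k)))"
      using * by (intro mult_left_mono) auto
    also have "\<dots> = exp (\<Sum>i<Suc k. 2 * x i) * norm (q (Suc k))"
      by (simp only: sum.lessThan_Suc exp_add mult_ac)
    finally show ?case .
  qed auto
  have "(\<Sum>i<k. 2 * x i) \<le> 16 * (n * B)\<^sup>2 * (\<Sum>k. 1 / (1 + real k ^ 2))" for k
  proof -
    have "2 * x i \<le> 16 * (n * B)\<^sup>2 * (1 / (1 + real i ^ 2))" for i
    proof -
      have "1 \<le> (norm s)\<^sup>2" using s(2) by simp
      hence "1 + real i ^ 2 \<le> norm (s + of_nat i) ^ 2" using norm_add_nat_ge[OF s(3), of i] by linarith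
      hence "(n * B)\<^sup>2 / norm (s + of_nat i) ^ 2 \<le> (n * B)\<^sup>2 / (1 + real i ^ 2)"
        by (intro divide_left_mono mult_pos_pos) (auto simp: add_pos_nonneg sk)
      thus ?thesis by (simp add: x_def power_divide)
    qed
    hence "(\<Sum>i<k. 2 * x i) \<le> (\<Sum>i<k. 16 * (n * B)\<^sup>2 * (1 / (1 + real i ^ 2)))"
      by (intro sum_mono)
    also have "\<dots> = 16 * (n * B)\<^sup>2 * (\<Sum>i<k. 1 / (1 + real i ^ 2))" by (rule sum_distrib_left[symmetric])
    also have "\<dots> \<le> 16 * (n * B)\<^sup>2 * (\<Sum>k. 1 / (1 + real k ^ 2))"
      by (intro mult_left_mono sum_le_suminf summable_inverse_one_plus_square) auto
    finally show ?thesis .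
  qed
  hence K: "exp (\<Sum>i<k. 2 * x i) \<le> K" for k by (simp add: K_def)
  show "norm (q k) \<le> K * norm (q 0)" "norm (q 0) \<le> K * norm (q k)"
    using up[of k] lo[of k] K[of k] by (meson mult_right_mono norm_ge_zero order_trans)+
qed

section \<open>Saalschuetzian 4F3 series: majorant and continuity in the parameters\<close>

definition hyp_term where
  "hyp_term (a :: complex) b c d e f g n =
     (pochhammer a n * pochhammer b n * pochhammer c n * pochhammer d n) /
           (fact n * pochhammer e n * pochhammer f n * pochhammer g n)"

lemma hyp4F3_eq_suminf: "hyp4F3 a b c d e f g = (\<Sum>n. hyp_term a b c d e f g n)"
  by (simp add: hyp4F3_def hyp_term_def)

text \<open>\<open>K\<close> and \<open>n0\<close> depend on the bound \<open>B\<close> only, so the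
  tail is controlled uniformly for all balanced parameters of bounded size, up to the norm of the
  single term at \<open>n0\<close>.\<close>

lemma hyp_term_bound:
  fixes B :: real
  obtains K n0 where "K \<ge> 0" "n0 > 0" "\<And>a b c d e f g k.
    \<lbrakk>e + f + g = 1 + a + b + c + d; \<forall>x\<in>{a,b,c,d,e,f,g}. norm x \<le> B\<rbrakk> \<Longrightarrow>
      norm (hyp_term a b c d e f g (n0 + k)) \<le> K * norm (hyp_term a b c d e f g n0) / real (n0 + k) ^ 2"
proof -
  define B' where "B' = max B 2"
  \<comment> \<open>20 is the 4 n of \<open>telescoping_bound\<close> with lists of length n = 5. It
    also puts \<open>n0\<close> beyond every zero of the lower linear factors; B' \<ge> 2 because 2
    occurs in one of the lists.\<close>
  define n0 where "n0 = nat \<lceil>20 * B'\<rceil>"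
  define K where "K = exp (16 * (5 * B')\<^sup>2 * (\<Sum>k. 1 / (1 + real k ^ 2)))"
  have B': "B' \<ge> 2" "B' \<ge> B" by (auto simp: B'_def)
  have n0: "real n0 \<ge> 20 * B'" using B' unfolding n0_def by linarith
  hence n0': "real n0 \<ge> 40" "n0 > 0" using B' by auto
  show ?thesis
  proof (rule that[of "K * (real n0 * (real n0 + 1))" n0])
    fix a b c d e f g :: complex and k :: nat
    assume bal: "e + f + g = 1 + a + b + c + d" and bd: "\<forall>x\<in>{a,b,c,d,e,f,g}. norm x \<le> B"
    define s where "s = (of_nat n0 :: complex)"
    define t where "t k = hyp_term a b c d e f g (n0 + k)" for k
    \<comment> \<open>Multiplication by m(m+1), m = n0 + k, changes the term ratio by (m+2)/m. With
      the 1 from the factorial the shifts are a, b, c, d, 2 over 0, 1, e, f, g, whose sums agree by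
      the balance.\<close>
    define q where "q k = t k * ((s + of_nat k) * (s + of_nat k + 1))" for k
    have nz: "x + of_nat (n0 + k) \<noteq> 0" if "norm x \<le> B" for x :: complex and k
    proof
      assume "x + of_nat (n0 + k) = 0"
      hence "x = - of_nat (n0 + k)" by (simp add: add_eq_0_iff2)
      hence "norm x = real (n0 + k)" by (metis norm_minus_cancel norm_of_nat)
      thus False using that n0 B' by simp
    qed
    have rec: "t (Suc k) * ((s + of_nat k + 1) * (s + of_nat k + e) * (s + of_nat k + f) * (s + of_nat k + g)) =
        t k * ((s + of_nat k + a) * (s + of_nat k + b) * (s + of_nat k + c) * (s + of_nat k + d))" for k
    proof -
      define m where "m = n0 + k"
      have m: "s + of_nat k = of_nat m" by (simp add: s_def m_def)
      have aux: "pa * a * (pb * b) * (pc * c) * (pd * d) / ((h * F) * (pe * e) * (pf * f) * (pg * g)) * (h * e * f * g)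
         = pa * pb * pc * pd / (F * pe * pf * pg) * (a * b * c * d)" (is "?L = ?R")
        if "h \<noteq> 0" "e \<noteq> 0" "f \<noteq> 0" "g \<noteq> 0" for pa a pb b pc c pd d h F pe e pf f pg g :: complex
      proof -
        have "?L = ?R * ((h / h) * (e / e) * (f / f) * (g / g))"
          by (simp only: divide_inverse inverse_mult_distrib mult_ac)
        thus ?thesis using that by simp
      qed
      have f: "fact (Suc m) = ((of_nat m + 1) * fact m :: complex)" by simp
      have *: "of_nat m + x = x + of_nat m" for x :: complex by simp
      have h: "1 + of_nat m \<noteq> (0::complex)" by (metis of_nat_Suc of_nat_neq_0)
      show ?thesis
        unfolding t_def hyp_term_def add_Suc_right m_def[symmetric] m pochhammer_Suc f *
        by (rule aux) (use nz bd h in \<open>simp_all add: m_def\<close>)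
    qed
    have K': "norm (q k) \<le> K * norm (q 0)"
      unfolding K_def
    proof (rule telescoping_bound[where us = "[a, b, c, d, 2]" and vs = "[0, 1, e, f, g]" and s = s and n = 5, simplified of_nat_numeral])
      show "sum_list [a, b, c, d, 2] = sum_list [0, 1, e, f, g]"
        using bal by (simp add: algebra_simps)
      show "norm x \<le> B'" if "x \<in> set [a, b, c, d, 2] \<union> set [0, 1, e, f, g]" for x
        using that bd B' by auto
      show "q (Suc k) * prod_list (map (\<lambda>v. s + of_nat k + v) [0, 1, e, f, g]) =
         q k * prod_list (map (\<lambda>u. s + of_nat k + u) [a, b, c, d, 2])" for k
        using arg_cong[OF rec[of k], of "\<lambda>z. z * ((s + of_nat k + 1) * (s + of_nat k + 2) * (s + of_nat k))"]
        by (simp add: q_def mult_ac add_ac)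
    qed (use B' n0 n0' in \<open>auto simp: s_def\<close>)
    have "norm (t k) * real (n0 + k) ^ 2 \<le> norm (q k)"
    proof -
      have "s + of_nat k = of_nat (n0 + k)" "s + of_nat k + 1 = of_nat (n0 + k + 1)" by (simp_all add: s_def)
      hence "norm (q k) = norm (t k) * (real (n0 + k) * real (n0 + k + 1))"
        by (simp only: q_def norm_mult norm_of_nat)
      thus ?thesis by (auto simp: power2_eq_square intro!: mult_left_mono)
    qed
    moreover have "norm (q 0) = norm (t 0) * (real n0 * (real n0 + 1))"
    proof -
      have "s + of_nat 0 = of_nat n0" "s + of_nat 0 + 1 = of_nat (n0 + 1)" by (simp_all add: s_def)
      hence "norm (q 0) = norm (t 0) * (real n0 * real (n0 + 1))"
        by (simp only: q_def norm_mult norm_of_nat)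
      thus ?thesis by simp
    qed
    ultimately have "norm (t k) * real (n0 + k) ^ 2 \<le> K * (norm (t 0) * (real n0 * (real n0 + 1)))"
      using K' by simp
    thus "norm (hyp_term a b c d e f g (n0 + k)) \<le> K * (real n0 * (real n0 + 1)) * norm (hyp_term a b c d e f g n0) / real (n0 + k) ^ 2"
      using n0' by (simp add: t_def field_simps)
  qed (use n0' in \<open>auto simp: K_def\<close>)
qed

lemma summable_inverse_shifted_square: "summable (\<lambda>k. C / real (n0 + k) ^ 2)"
proof -
  have "summable (\<lambda>k. C * (1 / real k ^ 2))"
    using inverse_power_summable[of 2, where 'a = real] by (intro summable_mult) (simp add: inverse_eq_divide)
  hence "summable (\<lambda>k. C * (1 / real (k + n0) ^ 2))" by (subst summable_iff_shift)
  thus ?thesis by (simp add: add.commute)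
qed

lemma summable_hyp_term:
  assumes "e + f + g = 1 + a + b + c + d"
  shows "summable (\<lambda>n. norm (hyp_term a b c d e f g n))"
proof -
  define B where "B = Max (norm ` {a,b,c,d,e,f,g})"
  obtain K n0 where K: "K \<ge> 0" "n0 > 0" "\<And>a b c d e f g k.
    \<lbrakk>e + f + g = 1 + a + b + c + d; \<forall>x\<in>{a,b,c,d,e,f,g}. norm x \<le> B\<rbrakk> \<Longrightarrow>
      norm (hyp_term a b c d e f g (n0 + k)) \<le> K * norm (hyp_term a b c d e f g n0) / real (n0 + k) ^ 2"
    using hyp_term_bound[of B] by blast
  have B: "\<forall>x\<in>{a,b,c,d,e,f,g}. norm x \<le> B" 
    unfolding B_def by (intro ballI Max_ge imageI finite_imageI) simp_all
  have "summable (\<lambda>k. norm (hyp_term a b c d e f g (n0 + k)))"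
  proof (rule summable_comparison_test'[OF summable_inverse_shifted_square])
    show "norm (norm (hyp_term a b c d e f g (n0 + k))) \<le> K * norm (hyp_term a b c d e f g n0) / real (n0 + k) ^ 2" for k
      using K(3)[OF assms B, of k] by (simp only: real_norm_def abs_norm_cancel)
  qed
  thus ?thesis by (subst (asm) add.commute, subst (asm) summable_iff_shift)
qed

lemma tendsto_pochhammer:
  fixes z :: "'a \<Rightarrow> complex"
  assumes "(z \<longlongrightarrow> z0) F" shows "((\<lambda>t. pochhammer (z t) n) \<longlongrightarrow> pochhammer z0 n) F"
  unfolding pochhammer_prod by (intro tendsto_prod tendsto_add tendsto_const assms)

text \<open>Tannery's theorem applies to the tail from \<open>n0\<close> on: the majorant involves
  the parameters only through the term at \<open>n0\<close>, which converges and hence is bounded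
  along the filter. The finitely many earlier terms converge one by one.\<close>

lemma tendsto_hyp4F3:
  assumes "(a \<longlongrightarrow> a0) F" "(b \<longlongrightarrow> b0) F" "(c \<longlongrightarrow> c0) F" "(d \<longlongrightarrow> d0) F"
    "(e \<longlongrightarrow> e0) F" "(f \<longlongrightarrow> f0) F" "(g \<longlongrightarrow> g0) F"
    and bal: "eventually (\<lambda>t. e t + f t + g t = 1 + a t + b t + c t + d t) F"
    and nz: "e0 \<notin> \<int>\<^sub>\<le>\<^sub>0" "f0 \<notin> \<int>\<^sub>\<le>\<^sub>0" "g0 \<notin> \<int>\<^sub>\<le>\<^sub>0" and F: "F \<noteq> bot"
  shows "((\<lambda>t. hyp4F3 (a t) (b t) (c t) (d t) (e t) (f t) (g t)) \<longlongrightarrow> hyp4F3 a0 b0 c0 d0 e0 f0 g0) F"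
proof -
  define h where "h n t = hyp_term (a t) (b t) (c t) (d t) (e t) (f t) (g t) n" for n t
  define h0 where "h0 n = hyp_term a0 b0 c0 d0 e0 f0 g0 n" for n
  have lim: "(h n \<longlongrightarrow> h0 n) F" for n
  proof -
    note p = tendsto_pochhammer
    have "pochhammer z n \<noteq> 0" if "z \<notin> \<int>\<^sub>\<le>\<^sub>0" for z :: complex
      using that pochhammer_eq_0_imp_nonpos_Int by blast
    thus ?thesis unfolding h_def h0_def hyp_term_def using nz by (intro tendsto_intros p assms) auto
  qed
  define B where "B = Max (norm ` {a0,b0,c0,d0,e0,f0,g0}) + 1"
  obtain K n0 where K: "K \<ge> 0" "n0 > 0" "\<And>a b c d e f g k.
    \<lbrakk>e + f + g = 1 + a + b + c + d; \<forall>x\<in>{a,b,c,d,e,f,g}. norm x \<le> B\<rbrakk> \<Longrightarrow>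
      norm (hyp_term a b c d e f g (n0 + k)) \<le> K * norm (hyp_term a b c d e f g n0) / real (n0 + k) ^ 2"
    using hyp_term_bound[of B] by blast
  define M where "M k = K * (norm (h0 n0) + 1) / real (n0 + k) ^ 2" for k
  have bd: "eventually (\<lambda>t. norm (z t) \<le> B) F" if "(z \<longlongrightarrow> z0) F" "z0 \<in> {a0,b0,c0,d0,e0,f0,g0}" for z z0
  proof -
    have "norm z0 \<le> Max (norm ` {a0,b0,c0,d0,e0,f0,g0})" using that(2) by (intro Max_ge) auto
    hence "norm z0 < B" unfolding B_def by linarith
    from order_tendstoD(2)[OF tendsto_norm[OF that(1)] this] show ?thesis by eventually_elim simp
  qed
  have ev0: "eventually (\<lambda>t. norm (h n0 t) < norm (h0 n0) + 1) F"
    by (rule order_tendstoD(2)[OF tendsto_norm[OF lim[of n0]]]) simp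
  have bds: "eventually (\<lambda>t. norm (a t) \<le> B) F" "eventually (\<lambda>t. norm (b t) \<le> B) F"
    "eventually (\<lambda>t. norm (c t) \<le> B) F" "eventually (\<lambda>t. norm (d t) \<le> B) F"
    "eventually (\<lambda>t. norm (e t) \<le> B) F" "eventually (\<lambda>t. norm (f t) \<le> B) F"
    "eventually (\<lambda>t. norm (g t) \<le> B) F"
    by (rule bd[OF assms(1)] bd[OF assms(2)] bd[OF assms(3)] bd[OF assms(4)] bd[OF assms(5)] bd[OF assms(6)] bd[OF assms(7)], simp)+
  have ev: "eventually (\<lambda>t. \<forall>k. norm (h (n0 + k) t) \<le> M k) F"
    using bal bds ev0
  proof eventually_elim
    case (elim t)
    show ?case
    proof
      fix k
      have "norm (h (n0 + k) t) \<le> K * norm (h n0 t) / real (n0 + k) ^ 2"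
        unfolding h_def by (rule K(3)) (use elim in auto)
      also have "\<dots> \<le> M k" unfolding M_def
        using elim K(1) by (intro divide_right_mono mult_left_mono) auto
      finally show "norm (h (n0 + k) t) \<le> M k" .
    qed
  qed
  have "((\<lambda>t. \<Sum>k. h (n0 + k) t) \<longlongrightarrow> (\<Sum>k. h0 (n0 + k))) F"
  proof (rule tannerys_theorem[THEN conjunct2, THEN conjunct2])
    show "summable M" unfolding M_def by (rule summable_inverse_shifted_square)
    show "eventually (\<lambda>(k,t). norm (h (n0 + k) t) \<le> M k) (at_top \<times>\<^sub>F F)"
      using eventually_prodI[OF eventually_True ev, of at_top] by (auto elim!: eventually_mono)
  qed (use lim F in auto)
  hence L: "((\<lambda>t. (\<Sum>k. h (n0 + k) t) + (\<Sum>k<n0. h k t)) \<longlongrightarrow> (\<Sum>k. h0 (n0 + k)) + (\<Sum>k<n0. h0 k)) F"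
    by (intro tendsto_add tendsto_sum lim)
  have EV: "eventually (\<lambda>t. (\<Sum>k. h (n0 + k) t) + (\<Sum>k<n0. h k t) = hyp4F3 (a t) (b t) (c t) (d t) (e t) (f t) (g t)) F"
    using bal
  proof eventually_elim
    case (elim t)
    show ?case using suminf_split_initial_segment[OF summable_norm_cancel[OF summable_hyp_term[OF elim]], of n0]
      by (simp add: hyp4F3_eq_suminf h_def add.commute)
  qed
  have EQ: "(\<Sum>k. h0 (n0 + k)) + (\<Sum>k<n0. h0 k) = hyp4F3 a0 b0 c0 d0 e0 f0 g0"
  proof -
    \<comment> \<open>The balance passes to the limit parameters, which makes the limit series
      summable.\<close>
    have "((\<lambda>t. e t + f t + g t - (1 + a t + b t + c t + d t)) \<longlongrightarrow> e0 + f0 + g0 - (1 + a0 + b0 + c0 + d0)) F"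
      by (intro tendsto_intros assms)
    moreover have "((\<lambda>t. e t + f t + g t - (1 + a t + b t + c t + d t)) \<longlongrightarrow> 0) F"
      by (rule tendsto_eventually) (use bal in eventually_elim, simp)
    ultimately have "e0 + f0 + g0 = 1 + a0 + b0 + c0 + d0"
      using tendsto_unique[OF F] by fastforce
    from suminf_split_initial_segment[OF summable_norm_cancel[OF summable_hyp_term[OF this]], of n0]
    show ?thesis by (simp add: hyp4F3_eq_suminf h0_def add.commute)
  qed
  show ?thesis by (rule Lim_transform_eventually[OF L[unfolded EQ] EV])
qed

section \<open>The two-term transformation of L\<close>

text \<open>Each (x)_{N-k} reflects into 1/(1-x-N)_k, so upper and lower parameters trade places.
  Well-poisedness survives with the new base -2N - a, up to the value of the last term.\<close>

lemma bailey_term_reverse: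
  fixes a b c d e f g :: complex
  assumes Z: "a \<notin> \<int>" "b \<notin> \<int>" "c \<notin> \<int>" "d \<notin> \<int>" "e \<notin> \<int>" "f \<notin> \<int>" "g \<notin> \<int>"
    "b - a \<notin> \<int>" "c - a \<notin> \<int>" "d - a \<notin> \<int>" "e - a \<notin> \<int>" "f - a \<notin> \<int>" "g - a \<notin> \<int>"
    and k: "k \<le> N"
  defines "n \<equiv> of_nat N :: complex"
  shows "bailey_term a b c d e f g N (N - k) = bailey_term a b c d e f g N N *
    bailey_term (- 2 * n - a) (b - a - n) (c - a - n) (d - a - n) (e - a - n) (f - a - n) (g - a - n) N k"
proof -
  have num: "pochhammer x (N - k) = pochhammer x N * (-1) ^ k / pochhammer (1 - x - n) k" if "x \<notin> \<int>" for x :: complex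
  proof -
    have "1 - x - n \<notin> \<int>" using that by (simp add: n_def)
    thus ?thesis unfolding n_def using pochhammer_diff_reflect[OF k] pochhammer_not_Ints_neq_0 by blast
  qed
  have den: "pochhammer (1 + a - x) (N - k) = pochhammer (1 + a - x) N * (-1) ^ k / pochhammer (x - a - n) k"
    if "x - a \<notin> \<int>" for x :: complex
  proof -
    have "x - a - n \<notin> \<int>" using that by (simp add: n_def)
    moreover have "1 - (1 + a - x) - n = x - a - n" by simp
    ultimately show ?thesis unfolding n_def
      using pochhammer_diff_reflect[OF k, of "1 + a - x"] pochhammer_not_Ints_neq_0 by metis
  qed
  have N1: "pochhammer (- n) (N - k) = pochhammer (- n) N * (-1) ^ k / fact k"
    using pochhammer_diff_reflect[OF k, of "- n"] by (simp add: n_def pochhammer_fact[symmetric])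
  have N2: "pochhammer (1 + a + n) (N - k) = pochhammer (1 + a + n) N * (-1) ^ k / pochhammer (- 2 * n - a) k"
  proof -
    have "a + of_nat (2 * N) \<notin> \<int>" using Z by (simp only: Ints_shift not_False_eq_True)
    hence "- (a + of_nat (2 * N)) \<notin> \<int>" by (metis Ints_minus minus_minus)
    hence "- 2 * n - a \<notin> \<int>" by (simp add: n_def algebra_simps)
    moreover have "1 - (1 + a + n) - n = - 2 * n - a" by simp
    ultimately show ?thesis unfolding n_def
      using pochhammer_diff_reflect[OF k, of "1 + a + n"] pochhammer_not_Ints_neq_0 n_def by metis
  qed
  have F: "fact (N - k) = (fact N * (-1) ^ k / pochhammer (- n) k :: complex)"
  proof -
    have "pochhammer (- n) k \<noteq> 0" using k by (auto simp: n_def pochhammer_eq_0_iff)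
    thus ?thesis using pochhammer_diff_reflect[OF k, of 1] by (simp add: n_def pochhammer_fact)
  qed
  have a0: "a \<noteq> 0" using Z by auto
  have a2: "- 2 * n - a \<noteq> 0"
  proof
    assume "- 2 * n - a = 0"
    hence "a = - of_nat (2 * N)" by (simp add: n_def)
    thus False using Z(1) by (metis Ints_minus Ints_of_nat)
  qed
  have lin: "(a + 2 * of_nat (N - k)) / a = (a + 2 * n) / a * ((- 2 * n - a + 2 * of_nat k) / (- 2 * n - a))"
  proof -
    have "(a + 2 * n) / (- 2 * n - a) = -1" using a2 by (simp add: divide_eq_eq)
    moreover have "a + 2 * of_nat (N - k) = - (- 2 * n - a + 2 * of_nat k)" using k by (simp add: n_def of_nat_diff)
    ultimately show ?thesis
      by (metis (no_types, lifting) mult_minus1 times_divide_eq_left times_divide_eq_right minus_divide_left mult.commute)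
  qed
  have base: "1 + (- 2 * n - a) - (x - a - n) = 1 - x - n" "1 + (- 2 * n - a) + n = 1 - a - n" for x by simp_all
  have aux: "(q * r) * (A * s / A') * (b * s / b') * (c * s / c') * (d * s / d') * (e * s / e') * (f * s / f') * (g * s / g') * (m * s / h) /
      ((F * s / m') * (bb * s / bb') * (cc * s / cc') * (dd * s / dd') * (ee * s / ee') * (ff * s / ff') * (gg * s / gg') * (mm * s / mm'))
    = q * A * b * c * d * e * f * g * m / (F * bb * cc * dd * ee * ff * gg * mm) *
      (r * mm' * bb' * cc' * dd' * ee' * ff' * gg' * m' / (h * b' * c' * d' * e' * f' * g' * A'))" (is "?L = ?R")
    if "s \<noteq> 0"
    for q r A s A' b b' c c' d d' e e' f f' g g' m h F m' bb bb' cc cc' dd dd' ee ee' ff ff' gg gg' mm mm' :: complex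
  proof -
    have "?L = ?R * ((s / s) * (s / s) * (s / s) * (s / s) * (s / s) * (s / s) * (s / s) * (s / s))"
      by (simp only: divide_inverse inverse_mult_distrib inverse_inverse_eq mult_ac)
    thus ?thesis using that by simp
  qed
  show ?thesis
    unfolding bailey_term_def n_def[symmetric] lin base N1 N2 F num[OF Z(1)] num[OF Z(2)] num[OF Z(3)] num[OF Z(4)]
      num[OF Z(5)] num[OF Z(6)] num[OF Z(7)] den[OF Z(8)] den[OF Z(9)] den[OF Z(10)] den[OF Z(11)] den[OF Z(12)] den[OF Z(13)]
    by (rule aux) simp
qed

text \<open>In the first half, j < k \<le> N/2, the denominator factor has norm at least N/2 - N/4 =
  N/4. Each quotient is then at most exp(4|\<alpha>-\<beta>|/N), and there are at most N/2 of
  them.\<close>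

lemma pochhammer_ratio_bound:
  fixes \<alpha> \<beta> :: complex
  assumes "4 * norm \<beta> \<le> real N" "2 * k \<le> N" "N > 0"
  shows "norm (pochhammer (\<alpha> - of_nat N) k / pochhammer (\<beta> - of_nat N) k) \<le> exp (2 * norm (\<alpha> - \<beta>))"
proof -
  have f: "norm ((\<alpha> - of_nat N + of_nat j) / (\<beta> - of_nat N + of_nat j)) \<le> exp (4 * norm (\<alpha> - \<beta>) / N)" if "j < k" for j
  proof -
    define z where "z = \<beta> - of_nat N + of_nat j"
    have "norm (of_nat (N - j) :: complex) \<le> norm (- z) + norm \<beta>"
      using norm_triangle_ineq[of "- z" \<beta>] that assms by (simp add: z_def of_nat_diff)
    hence z: "norm z \<ge> N / 4" using assms that by (simp only: norm_of_nat norm_minus_cancel)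
    have z0: "z \<noteq> 0" using z assms(3) by auto
    have "(\<alpha> - of_nat N + of_nat j) / z = 1 + (\<alpha> - \<beta>) / z" using z0 by (simp add: z_def field_simps)
    hence "norm ((\<alpha> - of_nat N + of_nat j) / z) \<le> 1 + norm (\<alpha> - \<beta>) / norm z"
      by (metis norm_divide norm_one norm_triangle_ineq)
    also have "\<dots> \<le> 1 + norm (\<alpha> - \<beta>) / (N / 4)"
      using z z0 assms(3) by (intro add_left_mono divide_left_mono) auto
    also have "\<dots> = 1 + 4 * norm (\<alpha> - \<beta>) / N" by simp
    also have "\<dots> \<le> exp (4 * norm (\<alpha> - \<beta>) / N)" by (rule exp_ge_add_one_self)
    finally show ?thesis by (simp add: z_def)
  qed
  have "norm (pochhammer (\<alpha> - of_nat N) k / pochhammer (\<beta> - of_nat N) k) =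
     (\<Prod>j<k. norm ((\<alpha> - of_nat N + of_nat j) / (\<beta> - of_nat N + of_nat j)))"
    by (simp add: pochhammer_prod prod_dividef prod_norm atLeast0LessThan norm_divide)
  also have "\<dots> \<le> (\<Prod>j<k. exp (4 * norm (\<alpha> - \<beta>) / N))"
    using f by (intro prod_mono) auto
  also have "\<dots> = exp (real k * (4 * norm (\<alpha> - \<beta>) / N))" by (simp only: prod_constant card_lessThan exp_of_nat_mult)
  also have "\<dots> \<le> exp (2 * norm (\<alpha> - \<beta>))"
  proof -
    have "real (2 * k) * norm (\<alpha> - \<beta>) \<le> real N * norm (\<alpha> - \<beta>)" using assms(2) by (intro mult_right_mono) auto
    thus ?thesis using assms(3) by (simp add: field_simps)
  qed
  finally show ?thesis .
qed

lemma add_minus_nat_ratio_tendsto: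
  fixes \<alpha> \<beta> :: complex
  shows "(\<lambda>N. (\<alpha> - of_nat N) / (\<beta> - of_nat N)) \<longlonglongrightarrow> 1"
proof -
  have inf: "filterlim (\<lambda>N. \<beta> + (- of_nat N :: complex)) at_infinity sequentially"
    using tendsto_mult_filterlim_at_infinity[OF tendsto_const[of "-1 :: complex"] _ tendsto_of_nat]
    by (intro tendsto_add_filterlim_at_infinity[OF tendsto_const]) simp
  have "(\<lambda>N. 1 + (\<alpha> - \<beta>) / (\<beta> + (- of_nat N))) \<longlonglongrightarrow> 1 + 0"
    by (intro tendsto_add tendsto_const tendsto_divide_0[OF tendsto_const inf])
  moreover have "eventually (\<lambda>N. \<beta> + (- of_nat N :: complex) \<noteq> 0) sequentially"
    by (rule filterlim_at_infinity_imp_eventually_ne[OF inf])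
  hence "eventually (\<lambda>N. 1 + (\<alpha> - \<beta>) / (\<beta> + (- of_nat N)) = (\<alpha> - of_nat N) / (\<beta> - of_nat N)) sequentially"
    by eventually_elim (simp add: field_simps)
  ultimately show ?thesis by (simp add: Lim_transform_eventually)
qed

lemma pochhammer_ratio_tendsto:
  fixes \<alpha> \<beta> :: complex
  shows "(\<lambda>N. pochhammer (\<alpha> - of_nat N) k / pochhammer (\<beta> - of_nat N) k) \<longlonglongrightarrow> 1"
proof -
  have "(\<lambda>N. \<Prod>j<k. (\<alpha> + of_nat j - of_nat N) / (\<beta> + of_nat j - of_nat N)) \<longlonglongrightarrow> (\<Prod>j<k. 1)"
    by (intro tendsto_prod add_minus_nat_ratio_tendsto)
  thus ?thesis by (simp add: pochhammer_prod prod_dividef atLeast0LessThan algebra_simps)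
qed

text \<open>Gauss's limit for 1/Gamma: (x)_{n+1} is the n-th approximant times n! n^x, and equal
  lengths and equal sums cancel these extra factors.\<close>

lemma pochhammer_prod_ratio_tendsto:
  fixes xs ys :: "complex list"
  assumes len: "length xs = length ys" and sum: "sum_list xs = sum_list ys"
    and nz: "\<And>y. y \<in> set ys \<Longrightarrow> rGamma y \<noteq> 0"
  shows "(\<lambda>n. prod_list (map (\<lambda>x. pochhammer x (Suc n)) xs) / prod_list (map (\<lambda>y. pochhammer y (Suc n)) ys))
    \<longlonglongrightarrow> prod_list (map rGamma xs) / prod_list (map rGamma ys)"
proof -
  have lim: "(\<lambda>n. prod_list (map (\<lambda>x. rGamma_series x n) zs)) \<longlonglongrightarrow> prod_list (map rGamma zs)" for zs :: "complex list"
    by (induction zs) (auto intro!: tendsto_intros)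
  have eq: "prod_list (map (\<lambda>x. pochhammer x (Suc n)) zs) =
     prod_list (map (\<lambda>x. rGamma_series x n) zs) * (fact n ^ length zs * exp (sum_list zs * of_real (ln (of_nat n))))"
    for zs :: "complex list" and n
    by (induction zs) (auto simp: rGamma_series_def exp_add distrib_right field_simps)
  have "prod_list (map rGamma ys) \<noteq> 0" using nz by (induction ys) auto
  hence "(\<lambda>n. prod_list (map (\<lambda>x. rGamma_series x n) xs) / prod_list (map (\<lambda>x. rGamma_series x n) ys))
     \<longlonglongrightarrow> prod_list (map rGamma xs) / prod_list (map rGamma ys)"
    by (intro tendsto_divide lim)
  thus ?thesis unfolding eq len sum by simp
qed

text \<open>
  The base \<open>h - 1 - N\<close> and the two parameters near \<open>-N\<close> are chosen such that, as \<open>N\<close> grows, the terms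
  concentrate at both ends of the summation range: the front half tends to one series of \<open>Lfun\<close>, the reversed rear half
  to a multiple of the other.
\<close>
definition split_term where
  "split_term (p :: complex) q u v h b c N k =
     bailey_term (h - 1 - of_nat N) (h - b - of_nat N) p q u v (h - c - of_nat N) N k"

text \<open>The quotient of the finite term by the 4F3 term. Every upper parameter that depends on
  \<open>N\<close> is paired with a lower one, so that each factor tends to 1; the 0 belongs to the
  terminating parameter -N.\<close>

definition split_correction where
  "split_correction (p :: complex) q u v h b c N k =
     (h - 1 + 2 * of_nat k - of_nat N) / (h - 1 - of_nat N)
     * (pochhammer (h - 1 - of_nat N) k / pochhammer (h - p - of_nat N) k)
     * (pochhammer (h - b - of_nat N) k / pochhammer (h - q - of_nat N) k)
     * (pochhammer (h - c - of_nat N) k / pochhammer (h - u - of_nat N) k)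
     * (pochhammer (0 - of_nat N) k / pochhammer (h - v - of_nat N) k)"

lemma split_term_eq: "split_term p q u v h b c N k = hyp_term p q u v h b c k * split_correction p q u v h b c N k"
proof -
  have 1: "1 + (h - 1 - of_nat N) - (x - of_nat N) = h - x"
    "1 + (h - 1 - of_nat N) - y = h - y - of_nat N"
    "1 + (h - 1 - of_nat N) + of_nat N = h"
    "h - (h - y) = y" "- of_nat N = 0 - (of_nat N :: complex)"
    "h - 1 - of_nat N + 2 * of_nat k = h - 1 + 2 * of_nat k - of_nat N" for x y by simp_all
  show ?thesis
    unfolding split_term_def bailey_term_def 1(6) 1(3) 1(1) unfolding 1(4) 1(2) unfolding 1(5)
      hyp_term_def split_correction_def
    by (simp only: divide_inverse inverse_mult_distrib mult_ac)
qed

lemma split_correction_tendsto: "(\<lambda>N. split_correction p q u v h b c N k) \<longlonglongrightarrow> 1"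
proof -
  have "(\<lambda>N. split_correction p q u v h b c N k) \<longlonglongrightarrow> 1 * 1 * 1 * 1 * 1"
    unfolding split_correction_def
    by (intro tendsto_mult add_minus_nat_ratio_tendsto pochhammer_ratio_tendsto)
  thus ?thesis by simp
qed

text \<open>The bound is confined to the first half of the range: for k near N the individual
  quotients behave like powers of N. The factor 3 bounds the very-well-poised factor as soon as N
  \<ge> 2|h-1|.\<close>

lemma split_correction_bound:
  obtains K where "K \<ge> 0" "eventually (\<lambda>N. \<forall>k. 2 * k \<le> N \<longrightarrow> norm (split_correction p q u v h b c N k) \<le> K) sequentially"
proof -
  define E where "E x y = exp (2 * norm (x - y :: complex))" for x y
  define K where "K = 3 * E (h - 1) (h - p) * E (h - b) (h - q) * E (h - c) (h - u) * E 0 (h - v)"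
  have ev: "eventually (\<lambda>N. C \<le> real N) sequentially" for C
    by (rule eventually_sequentiallyI[of "nat \<lceil>C\<rceil>"]) linarith
  have "eventually (\<lambda>N. \<forall>k. 2 * k \<le> N \<longrightarrow> norm (split_correction p q u v h b c N k) \<le> K) sequentially"
    using eventually_gt_at_top[of 0] ev[of "4 * norm (h - p)"] ev[of "4 * norm (h - q)"]
      ev[of "4 * norm (h - u)"] ev[of "4 * norm (h - v)"] ev[of "2 * norm (h - 1)"]
  proof eventually_elim
    case (elim N)
    show ?case
    proof (intro allI impI)
      fix k assume k: "2 * k \<le> N"
      have "norm ((h - 1 + 2 * of_nat k - of_nat N) / (h - 1 - of_nat N)) \<le> 3"
      proof -
        have *: "2 * of_nat k - of_nat N = - (of_nat (N - 2 * k) :: complex)" using k by (simp add: of_nat_diff)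
        have "norm (h - 1 + (2 * of_nat k - of_nat N)) \<le> norm (h - 1) + norm (2 * of_nat k - of_nat N :: complex)"
          by (rule norm_triangle_ineq)
        also have "norm (2 * of_nat k - of_nat N :: complex) \<le> real N"
          unfolding * norm_minus_cancel norm_of_nat by simp
        finally have 1: "norm (h - 1 + 2 * of_nat k - of_nat N) \<le> norm (h - 1) + real N" by (simp add: add_diff_eq)
        have "norm (of_nat N :: complex) \<le> norm (h - 1) + norm (h - 1 - of_nat N)"
          using norm_triangle_ineq4[of "h - 1" "h - 1 - of_nat N"] by simp
        hence 2: "norm (h - 1 - of_nat N) \<ge> real N - norm (h - 1)" by simp
        have "norm (h - 1 + 2 * of_nat k - of_nat N) \<le> 3 * norm (h - 1 - of_nat N)"
          using 1 2 elim by linarith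
        moreover have "norm (h - 1 - of_nat N) > 0" using 2 elim(1) elim(6) by linarith
        ultimately show ?thesis by (simp add: norm_divide divide_le_eq)
      qed
      thus "norm (split_correction p q u v h b c N k) \<le> K"
        unfolding split_correction_def K_def norm_mult E_def
        by (intro mult_mono pochhammer_ratio_bound mult_nonneg_nonneg norm_ge_zero) (use elim k in auto)
    qed
  qed
  moreover have "K \<ge> 0" by (simp add: K_def E_def)
  ultimately show ?thesis using that by blast
qed

text \<open>Odd lengths N = 2m + 1 give 2m + 2 terms, so the front half and the reversed rear half
  both run over k \<le> m.\<close>

lemma filterlim_odd: "filterlim (\<lambda>m. Suc (2 * m)) sequentially sequentially"
  by (rule filterlim_at_top_mono[OF filterlim_ident]) (auto intro!: always_eventually)

lemma split_front_tendsto: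
  assumes "h + b + c = 1 + p + q + u + v"
  shows "(\<lambda>m. \<Sum>k\<le>m. split_term p q u v h b c (Suc (2 * m)) k) \<longlonglongrightarrow> hyp4F3 p q u v h b c"
proof -
  obtain K where K: "K \<ge> 0"
    "eventually (\<lambda>N. \<forall>k. 2 * k \<le> N \<longrightarrow> norm (split_correction p q u v h b c N k) \<le> K) sequentially"
    by (rule split_correction_bound)
  define T where "T k m = (if k \<le> m then split_term p q u v h b c (Suc (2 * m)) k else 0)" for k m
  have "(\<lambda>m. \<Sum>k. T k m) \<longlonglongrightarrow> (\<Sum>k. hyp_term p q u v h b c k)"
  proof (rule tannerys_theorem[THEN conjunct2, THEN conjunct2])
    fix k
    have "(\<lambda>m. hyp_term p q u v h b c k * split_correction p q u v h b c (Suc (2 * m)) k) \<longlonglongrightarrow> hyp_term p q u v h b c k * 1"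
      by (intro tendsto_mult tendsto_const filterlim_compose[OF split_correction_tendsto filterlim_odd])
    moreover have "eventually (\<lambda>m. hyp_term p q u v h b c k * split_correction p q u v h b c (Suc (2 * m)) k = T k m) sequentially"
      using eventually_ge_at_top[of k] by eventually_elim (simp add: T_def split_term_eq)
    ultimately show "(\<lambda>m. T k m) \<longlonglongrightarrow> hyp_term p q u v h b c k"
      by (simp add: Lim_transform_eventually)
  next
    show "summable (\<lambda>k. norm (hyp_term p q u v h b c k) * K)"
      by (intro summable_mult2 summable_hyp_term assms)
    have "eventually (\<lambda>m. \<forall>k. norm (T k m) \<le> norm (hyp_term p q u v h b c k) * K) sequentially"
      using eventually_compose_filterlim[OF K(2) filterlim_odd]
    proof eventually_elim
      case (elim m)
      show ?case
      proof
        fix k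
        show "norm (T k m) \<le> norm (hyp_term p q u v h b c k) * K"
        proof (cases "k \<le> m")
          case True
          thus ?thesis using elim by (auto simp: T_def split_term_eq norm_mult intro!: mult_left_mono)
        qed (use K(1) in \<open>simp add: T_def\<close>)
      qed
    qed
    from eventually_prodI[OF eventually_True this, of at_top]
    show "eventually (\<lambda>(k,m). norm (T k m) \<le> norm (hyp_term p q u v h b c k) * K) (at_top \<times>\<^sub>F sequentially)"
      by eventually_elim auto
  qed simp
  moreover have "(\<Sum>k. T k m) = (\<Sum>k\<le>m. split_term p q u v h b c (Suc (2 * m)) k)" for m
  proof -
    have "(\<Sum>k. T k m) = (\<Sum>k\<le>m. T k m)" by (rule suminf_finite) (auto simp: T_def)
    thus ?thesis by (simp add: T_def)
  qed
  ultimately show ?thesis by (simp add: hyp4F3_eq_suminf)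
qed

lemma pochhammer_minus_nat: "pochhammer (x - of_nat N) N = (-1) ^ N * pochhammer (1 - x :: complex) N"
  by (subst pochhammer_reflect) simp

text \<open>Minus the limit of the last term. It is also the quotient of the Gamma prefactors of the
  second and the first series in \<open>Lfun\<close>, which is why the limit of the finite sum is an
  L function.\<close>

definition split_ratio where
  "split_ratio (p :: complex) q u v h b c =
     rGamma p * rGamma q * rGamma u * rGamma v * rGamma (2 - h) * rGamma (1 + b - h) * rGamma (1 + c - h) /
     (rGamma (1 + p - h) * rGamma (1 + q - h) * rGamma (1 + u - h) * rGamma (1 + v - h)
       * rGamma h * rGamma b * rGamma c)"

lemma rGamma_not_Ints_neq_0: "x \<notin> \<int> \<Longrightarrow> rGamma (x::complex) \<noteq> 0"
  by (auto simp: rGamma_eq_zero_iff elim!: nonpos_Ints_cases)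

lemma split_term_last_tendsto:
  assumes Z: "h \<notin> \<int>" "b \<notin> \<int>" "c \<notin> \<int>" "p - h \<notin> \<int>" "q - h \<notin> \<int>" "u - h \<notin> \<int>" "v - h \<notin> \<int>"
  shows "(\<lambda>m. split_term p q u v h b c (Suc (2 * m)) (Suc (2 * m))) \<longlonglongrightarrow> - split_ratio p q u v h b c"
proof -
  define xs where "xs = [p, q, u, v, 2 - h, 1 + b - h, 1 + c - h]"
  define ys where "ys = [1 + p - h, 1 + q - h, 1 + u - h, 1 + v - h, h, b, c]"
  have eq: "split_term p q u v h b c N N =
     (h - 1 + 2 * of_nat N - of_nat N) / (h - 1 - of_nat N) *
     (prod_list (map (\<lambda>x. pochhammer x N) xs) / prod_list (map (\<lambda>y. pochhammer y N) ys))" for N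
  proof -
    have aux: "p * q * u * v / (F * d * b * c) * (R * (s * d2 / (s * p1)) * (s * b1 / (s * q1)) * (s * c1 / (s * u1)) * (s * F / (s * v1)))
      = R * (p * (q * (u * (v * (d2 * (b1 * c1))))) / (p1 * (q1 * (u1 * (v1 * (d * (b * c)))))))" (is "?L = ?R")
      if "s \<noteq> 0" "F \<noteq> 0" for p q u v F d b c R s d2 p1 b1 q1 c1 u1 v1 :: complex
    proof -
      have "?L = ?R * ((s / s) * (s / s) * (s / s) * (s / s) * (F / F))"
        by (simp only: divide_inverse inverse_mult_distrib mult_ac)
      thus ?thesis using that by simp
    qed
    have 1: "1 + 1 - h = 2 - h" "1 - (h - x) = 1 + x - h" for x by simp_all
    have 2: "pochhammer (1 - 0) N = (fact N :: complex)" by (simp add: pochhammer_fact)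
    show ?thesis
      unfolding split_term_eq hyp_term_def split_correction_def pochhammer_minus_nat xs_def ys_def list.map prod_list.Cons prod_list.Nil mult_1_right
      unfolding 1(2) 2 unfolding 1(1) by (rule aux) auto
  qed
  have "(\<lambda>n. prod_list (map (\<lambda>x. pochhammer x (Suc n)) xs) / prod_list (map (\<lambda>y. pochhammer y (Suc n)) ys))
     \<longlonglongrightarrow> prod_list (map rGamma xs) / prod_list (map rGamma ys)"
    by (rule pochhammer_prod_ratio_tendsto)
       (use Z in \<open>auto simp: xs_def ys_def intro!: rGamma_not_Ints_neq_0\<close>)
  hence 1: "(\<lambda>m. prod_list (map (\<lambda>x. pochhammer x (Suc (2 * m))) xs) / prod_list (map (\<lambda>y. pochhammer y (Suc (2 * m))) ys))
     \<longlonglongrightarrow> prod_list (map rGamma xs) / prod_list (map rGamma ys)"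
    by (rule filterlim_compose) (rule filterlim_subseq, simp add: strict_mono_def)
  have 2: "prod_list (map rGamma xs) / prod_list (map rGamma ys) = split_ratio p q u v h b c"
    by (simp add: xs_def ys_def split_ratio_def mult_ac)
  \<comment> \<open>At the last index the very-well-poised factor is (h - 1 + N)/(h - 1 - N). Its
    limit -1 is the origin of the minus sign between the two series of L.\<close>
  have "(\<lambda>N. - (((1 - h) - of_nat N) / ((h - 1) - of_nat N))) \<longlonglongrightarrow> - 1"
    by (intro tendsto_minus add_minus_nat_ratio_tendsto)
  also have "(\<lambda>N. - (((1 - h) - of_nat N) / ((h - 1) - of_nat N))) = (\<lambda>N. (h - 1 + 2 * of_nat N - of_nat N) / (h - 1 - of_nat N))"
  proof
    fix N
    have "- ((1 - h) - of_nat N) = h - 1 + 2 * of_nat N - of_nat N" by simp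
    thus "- (((1 - h) - of_nat N) / ((h - 1) - of_nat N)) = (h - 1 + 2 * of_nat N - of_nat N) / (h - 1 - of_nat N)"
      by (metis minus_divide_left)
  qed
  finally have 3: "(\<lambda>m. (h - 1 + 2 * of_nat (Suc (2 * m)) - of_nat (Suc (2 * m))) / (h - 1 - of_nat (Suc (2 * m)))) \<longlonglongrightarrow> - 1"
    by (rule filterlim_compose) (rule filterlim_odd)
  show ?thesis unfolding eq using tendsto_mult[OF 3 1] unfolding 2 by simp
qed

definition split_limit where
  "split_limit (p :: complex) q u v h b c = hyp4F3 p q u v h b c - split_ratio p q u v h b c
     * hyp4F3 (1 + p - h) (1 + q - h) (1 + u - h) (1 + v - h) (2 - h) (1 + b - h) (1 + c - h)"

lemma split_sum_tendsto:
  assumes bal: "h + b + c = 1 + p + q + u + v"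
    and Z: "h \<notin> \<int>" "b \<notin> \<int>" "c \<notin> \<int>" "p \<notin> \<int>" "q \<notin> \<int>" "u \<notin> \<int>" "v \<notin> \<int>" "h - b \<notin> \<int>" "h - c \<notin> \<int>"
      "p - h \<notin> \<int>" "q - h \<notin> \<int>" "u - h \<notin> \<int>" "v - h \<notin> \<int>"
  shows "(\<lambda>m. \<Sum>k\<le>Suc (2 * m). split_term p q u v h b c (Suc (2 * m)) k) \<longlonglongrightarrow>
    split_limit p q u v h b c"
proof -
  define r where "r N k = split_term (1 + p - h) (1 + q - h) (1 + u - h) (1 + v - h) (2 - h) (1 + b - h) (1 + c - h) N k" for N k
  have rev: "split_term p q u v h b c N (N - k) = split_term p q u v h b c N N * r N k" if "k \<le> N" for N k
  proof -
    define n where "n = (of_nat N :: complex)"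
    have mn: "x \<notin> \<int> \<Longrightarrow> - x \<notin> \<int>" for x :: complex by (metis Ints_minus minus_minus)
    \<comment> \<open>Reversal sends the base h - 1 - N to (2 - h) - 1 - N, so the rear half is
      again of the split form, with the parameters of the second series of
      \<open>Lfun\<close>.\<close>
    have e: "- 2 * n - (h - 1 - n) = 2 - h - 1 - n" "h - b - n - (h - 1 - n) - n = 2 - h - (1 + b - h) - n"
      "h - c - n - (h - 1 - n) - n = 2 - h - (1 + c - h) - n"
      "x - (h - 1 - n) - n = 1 + x - h" for x by (simp_all add: algebra_simps)
    have sh: "x - (h - 1 - n) \<notin> \<int>" if "x - h \<notin> \<int>" for x
    proof -
      have eq: "x - (h - 1 - n) = x - h + 1 + n" by simp
      show ?thesis unfolding eq unfolding n_def using that by (simp only: Ints_shift not_False_eq_True)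
    qed
    have "h - b - n - (h - 1 - n) = - b + 1" "h - c - n - (h - 1 - n) = - c + 1" by simp_all
    hence sh2: "h - b - n - (h - 1 - n) \<notin> \<int>" "h - c - n - (h - 1 - n) \<notin> \<int>"
      using mn[OF Z(2)] mn[OF Z(3)] by (simp_all only: Ints_shift not_False_eq_True)
    have "bailey_term (h - 1 - n) (h - b - n) p q u v (h - c - n) N (N - k) =
       bailey_term (h - 1 - n) (h - b - n) p q u v (h - c - n) N N *
       bailey_term (- 2 * n - (h - 1 - n)) (h - b - n - (h - 1 - n) - n) (p - (h - 1 - n) - n) (q - (h - 1 - n) - n)
         (u - (h - 1 - n) - n) (v - (h - 1 - n) - n) (h - c - n - (h - 1 - n) - n) N k"
      unfolding n_def
      by (rule bailey_term_reverse) (use Z that sh sh2 in \<open>simp_all add: n_def\<close>)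
    thus ?thesis unfolding r_def split_term_def n_def[symmetric] unfolding e(2,3) unfolding e(1,4) .
  qed
  have "(\<Sum>k\<le>Suc (2 * m). split_term p q u v h b c (Suc (2 * m)) k) =
    (\<Sum>k\<le>m. split_term p q u v h b c (Suc (2 * m)) k) +
    split_term p q u v h b c (Suc (2 * m)) (Suc (2 * m)) * (\<Sum>k\<le>m. r (Suc (2 * m)) k)" for m
  proof -
    define N where "N = Suc (2 * m)"
    have "{..N} = {..m} \<union> (\<lambda>k. N - k) ` {..m}" (is "_ = _ \<union> ?I")
    proof -
      have "k \<in> ?I" if "k \<le> N" "k > m" for k
        using that by (intro image_eqI[of _ _ "N - k"]) (auto simp: N_def)
      hence "{..N} \<subseteq> {..m} \<union> ?I" by (meson UnI1 UnI2 atMost_iff not_le_imp_less subsetI)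
      thus ?thesis by (intro equalityI) (auto simp: N_def)
    qed
    hence "(\<Sum>k\<le>N. split_term p q u v h b c N k) = (\<Sum>k\<le>m. split_term p q u v h b c N k)
      + (\<Sum>k\<in>(\<lambda>k. N - k) ` {..m}. split_term p q u v h b c N k)"
      by (simp only:) (rule sum.union_disjoint, auto simp: N_def)
    also have "(\<Sum>k\<in>(\<lambda>k. N - k) ` {..m}. split_term p q u v h b c N k) = (\<Sum>k\<le>m. split_term p q u v h b c N (N - k))"
      by (subst sum.reindex) (auto simp: inj_on_def N_def)
    also have "\<dots> = split_term p q u v h b c N N * (\<Sum>k\<le>m. r N k)"
      by (subst sum_distrib_left, intro sum.cong refl rev) (auto simp: N_def)
    finally show ?thesis unfolding N_def .
  qed
  moreover have "(\<lambda>m. (\<Sum>k\<le>m. split_term p q u v h b c (Suc (2 * m)) k) +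
    split_term p q u v h b c (Suc (2 * m)) (Suc (2 * m)) * (\<Sum>k\<le>m. r (Suc (2 * m)) k)) \<longlonglongrightarrow>
    hyp4F3 p q u v h b c + (- split_ratio p q u v h b c)
      * hyp4F3 (1 + p - h) (1 + q - h) (1 + u - h) (1 + v - h) (2 - h) (1 + b - h) (1 + c - h)"
    unfolding r_def
  proof (intro tendsto_add tendsto_mult split_front_tendsto split_term_last_tendsto bal)
    show "2 - h + (1 + b - h) + (1 + c - h) = 1 + (1 + p - h) + (1 + q - h) + (1 + u - h) + (1 + v - h)"
      using arg_cong[OF bal, of "\<lambda>z. z + 4 - 4 * h"] by (simp add: algebra_simps)
  qed (use Z in auto)
  ultimately show ?thesis by (simp add: split_limit_def)
qed

section \<open>The limit of Bailey's transformation\<close>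

lemma bailey_factor_tendsto:
  assumes Z: "h' \<notin> \<int>" "u - h \<notin> \<int>" "v - h \<notin> \<int>" "h' - u - v \<notin> \<int>"
  shows "(\<lambda>m. bailey_factor (h - 1 - of_nat (Suc (2 * m))) (h' - 1 - of_nat (Suc (2 * m))) u v (Suc (2 * m))) \<longlonglongrightarrow>
    rGamma (1 - h) * rGamma (1 + u + v - h) * rGamma (1 + u - h') * rGamma (1 + v - h') /
    (rGamma (1 + u - h) * rGamma (1 + v - h) * rGamma (1 - h') * rGamma (1 + u + v - h'))"
proof -
  define xs where "xs = [1 - h, 1 + u + v - h, 1 + u - h', 1 + v - h']"
  define ys where "ys = [1 + u - h, 1 + v - h, 1 - h', 1 + u + v - h']"
  have eq: "bailey_factor (h - 1 - of_nat N) (h' - 1 - of_nat N) u v N =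
    prod_list (map (\<lambda>x. pochhammer x N) xs) / prod_list (map (\<lambda>y. pochhammer y N) ys)" for N
  proof -
    have 1: "1 + (x - 1 - of_nat N) - u - v = x - u - v - of_nat N" 
       "1 + (x - 1 - of_nat N) - y = x - y - of_nat N" "1 + (x - 1 - of_nat N) = x - of_nat N" for x y :: complex
      by simp_all
    have 2: "1 - (x - u - v) = 1 + u + v - x" "1 - (x - y) = 1 + y - x" for x y :: complex by simp_all
    have aux: "s * a * (s * b) * (s * c) * (s * d) / (s * e * (s * f) * (s * g) * (s * h)) =
       a * (b * (c * d)) / (e * (f * (g * h)))" (is "?L = ?R") if "s \<noteq> 0" for a b c d e f g h s :: complex
    proof -
      have "?L = ?R * ((s / s) * (s / s) * (s / s) * (s / s))"
        by (simp only: divide_inverse inverse_mult_distrib mult_ac)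
      thus ?thesis using that by simp
    qed
    show ?thesis unfolding bailey_factor_def 1(1) unfolding 1(2) unfolding 1(3) pochhammer_minus_nat xs_def ys_def list.map prod_list.Cons prod_list.Nil mult_1_right
      unfolding 2(1) unfolding 2(2) by (rule aux) simp
  qed
  have "1 + u + v - h' = - (h' - u - v) + 1" "1 - h' = - h' + 1" by simp_all
  hence Z': "1 + u + v - h' \<notin> \<int>" "1 - h' \<notin> \<int>"
    using Z by (metis Ints_minus Ints_shift(1) minus_minus)+
  have "(\<lambda>n. prod_list (map (\<lambda>x. pochhammer x (Suc n)) xs) / prod_list (map (\<lambda>y. pochhammer y (Suc n)) ys))
     \<longlonglongrightarrow> prod_list (map rGamma xs) / prod_list (map rGamma ys)"
  proof (rule pochhammer_prod_ratio_tendsto)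
    show "rGamma y \<noteq> 0" if "y \<in> set ys" for y
      using that Z Z' rGamma_not_Ints_neq_0 by (auto simp: ys_def)
  qed (auto simp: xs_def ys_def)
  hence "(\<lambda>m. prod_list (map (\<lambda>x. pochhammer x (Suc (2 * m))) xs) / prod_list (map (\<lambda>y. pochhammer y (Suc (2 * m))) ys))
     \<longlonglongrightarrow> prod_list (map rGamma xs) / prod_list (map rGamma ys)"
    by (rule filterlim_compose) (rule filterlim_subseq, simp add: strict_mono_def)
  thus ?thesis unfolding eq by (simp add: xs_def ys_def mult_ac)
qed

text \<open>The prefactor of the first series is pulled out; reflection replaces the sine and
  1/Gamma(h) by pi/Gamma(1-h).\<close>

lemma Lfun_eq_split:
  fixes h b c p q u v :: complex
  assumes Z: "h \<notin> \<int>" "b \<notin> \<int>" "c \<notin> \<int>" "p - h \<notin> \<int>" "q - h \<notin> \<int>" "u - h \<notin> \<int>" "v - h \<notin> \<int>"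
  shows "Lfun p q u v h b c =
    split_limit p q u v h b c *
    (rGamma (1 + p - h) * rGamma (1 + q - h) * rGamma (1 + u - h) * rGamma (1 + v - h)
       * rGamma b * rGamma c) / (pi * rGamma (1 - h))"
proof -
  define G where "G = rGamma (1 + p - h) * rGamma (1 + q - h) * rGamma (1 + u - h) * rGamma (1 + v - h)
       * rGamma h * rGamma b * rGamma c"
  define H where "H = rGamma p * rGamma q * rGamma u * rGamma v * rGamma (2 - h) * rGamma (1 + b - h) * rGamma (1 + c - h)"
  have G0: "G \<noteq> 0" "rGamma h \<noteq> 0" using Z by (auto simp: G_def intro!: rGamma_not_Ints_neq_0)
  have d: "rGamma (1 - h) \<noteq> 0"
    by (rule rGamma_not_Ints_neq_0) (use Z one_minus_not_Ints in blast)
  have s: "sin (of_real pi * h) = of_real pi * (rGamma h * rGamma (1 - h))"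
    by (simp add: rGamma_reflection_complex)
  have aux: "F1 / (w * (x * y)) * (A * x * B * C) - F2 / (w * (x * y)) * H =
     (F1 - H / (A * x * B * C) * F2) * (A * B * C) / (w * y)"
    if "x \<noteq> 0" "y \<noteq> 0" "w \<noteq> 0" "A * x * B * C \<noteq> 0" for F1 w x y A B C F2 H :: complex
    using that by (simp add: divide_simps)
  show ?thesis
    unfolding Lfun_def s split_limit_def split_ratio_def H_def[symmetric]
    by (rule aux) (use G0 d in \<open>auto simp: G_def\<close>)
qed

text \<open>Bailey's transformation is applied with bases h - 1 - N and h' - 1 - N. The limit of its
  prefactor is exactly the quotient of the normalising factors in \<open>Lfun_eq_split\<close>, so
  the two L functions agree without any factor.\<close>

theorem Lfun_whipple:
  fixes h b c p q u v :: complex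
  assumes bal: "h + b + c = 1 + p + q + u + v"
    and h': "h' = h + b - p - q" and c': "c' = c + b - p - q"
    and Z: "h \<notin> \<int>" "b \<notin> \<int>" "c \<notin> \<int>" "p \<notin> \<int>" "q \<notin> \<int>" "u \<notin> \<int>" "v \<notin> \<int>" "h - b \<notin> \<int>" "h - c \<notin> \<int>"
      "p - h \<notin> \<int>" "q - h \<notin> \<int>" "u - h \<notin> \<int>" "v - h \<notin> \<int>"
      "h' \<notin> \<int>" "c' \<notin> \<int>" "b - p \<notin> \<int>" "b - q \<notin> \<int>" "h' - b \<notin> \<int>" "u - h' \<notin> \<int>" "v - h' \<notin> \<int>"
      "h' - h \<notin> \<int>"
  shows "Lfun p q u v h b c = Lfun (b - q) (b - p) u v h' b c'"
proof -
  have mn: "x - y \<notin> \<int> \<Longrightarrow> y - x \<notin> \<int>" for x y :: complex by (metis Ints_minus minus_diff_eq)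
  \<comment> \<open>In this form the balance says that h - c - N is the last parameter which
    Bailey's transformation prescribes, and that two Gamma factors of the limit prefactor are those
    of \<open>c\<close> and \<open>c'\<close>.\<close>
  have c1: "c = 1 + u + v - h'" and c1': "c' = 1 + u + v - h"
    using arg_cong[OF bal, of "\<lambda>z. z - h - b"] by (simp_all add: h' c' algebra_simps)
  have bal': "h' + b + c' = 1 + (b - q) + (b - p) + u + v"
    by (simp add: c1' h')
  have e1: "1 + (b - q) - h' = 1 + p - h" "1 + (b - p) - h' = 1 + q - h" "h' - c' = h - c"
    "b - q - h' = p - h" "b - p - h' = q - h"
    by (simp_all add: h' c')
  define W where "W = split_limit p q u v h b c"
  define W' where "W' = split_limit (b - q) (b - p) u v h' b c'"
  define \<phi> where "\<phi> = rGamma (1 - h) * rGamma (1 + u + v - h) * rGamma (1 + u - h') * rGamma (1 + v - h') /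
    (rGamma (1 + u - h) * rGamma (1 + v - h) * rGamma (1 - h') * rGamma (1 + u + v - h'))"
  have fin: "(\<Sum>k\<le>N. split_term p q u v h b c N k) =
     bailey_factor (h - 1 - of_nat N) (h' - 1 - of_nat N) u v N * (\<Sum>k\<le>N. split_term (b - q) (b - p) u v h' b c' N k)" for N
  proof -
    define n where "n = (of_nat N :: complex)"
    have e2: "h' - 1 - n + (h - b - n) - (h - 1 - n) = h' - b - n" "h' - 1 - n + p - (h - 1 - n) = b - q"
      "h' - 1 - n + q - (h - 1 - n) = b - p" "h - c - n = h' - c' - n"
      by (simp_all add: h' c' algebra_simps)
    have e3: "h - 1 - n - (h - b - n) = b - 1" "h - 1 - n - (h - c - n) = c - 1" "h' - 1 - n - (h - 1 - n) = h' - h"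
      "h' - 1 - n - (h - c - n) = c' - 1" "x - 1 - n - y = x - y - 1 - n" for x y
      by (simp_all add: h' c')
    have "(\<Sum>k\<le>N. bailey_term (h - 1 - n) (h - b - n) p q u v (h - c - n) N k) =
      bailey_factor (h - 1 - n) (h' - 1 - n) u v N * (\<Sum>k\<le>N. bailey_term (h' - 1 - n) (h' - 1 - n + (h - b - n) - (h - 1 - n))
         (h' - 1 - n + p - (h - 1 - n)) (h' - 1 - n + q - (h - 1 - n)) u v (h - c - n) N k)"
    proof (rule bailey_9F8)
      show "h' - 1 - n = 1 + 2 * (h - 1 - n) - (h - b - n) - p - q" by (simp add: h')
      show "h - c - n = 1 + (h - 1 - n) + (h' - 1 - n) + of_nat N - u - v" by (simp add: n_def c1)
    qed (unfold e3(1,2,3,4), unfold e3(5), use Z mn[OF Z(10)] mn[OF Z(11)] mn[OF Z(12)] mn[OF Z(13)] mn[OF Z(19)] mn[OF Z(20)]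
       in \<open>simp_all only: n_def Ints_shift not_False_eq_True\<close>)
    thus ?thesis unfolding e2(1,2,3) unfolding split_term_def n_def[symmetric] e2(4)[symmetric] .
  qed
  have l1: "(\<lambda>m. \<Sum>k\<le>Suc (2 * m). split_term p q u v h b c (Suc (2 * m)) k) \<longlonglongrightarrow> W"
    unfolding W_def by (rule split_sum_tendsto) (use bal Z in auto)
  have l2: "(\<lambda>m. \<Sum>k\<le>Suc (2 * m). split_term (b - q) (b - p) u v h' b c' (Suc (2 * m)) k) \<longlonglongrightarrow> W'"
    unfolding W'_def by (rule split_sum_tendsto) (use bal' Z e1 in auto)
  have "h' - u - v = 1 - c" by (simp add: c1)
  hence "h' - u - v \<notin> \<int>" using Z(3) one_minus_not_Ints by simp
  hence l3: "(\<lambda>m. bailey_factor (h - 1 - of_nat (Suc (2 * m))) (h' - 1 - of_nat (Suc (2 * m))) u v (Suc (2 * m))) \<longlonglongrightarrow> \<phi>"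
    unfolding \<phi>_def using Z by (intro bailey_factor_tendsto) auto
  have W: "W = \<phi> * W'"
    by (rule LIMSEQ_unique[OF l1]) (unfold fin, rule tendsto_mult[OF l3 l2])
  have nz: "rGamma (1 + u - h) \<noteq> 0" "rGamma (1 + v - h) \<noteq> 0" "rGamma (1 + u + v - h') \<noteq> 0" "rGamma (1 - h') \<noteq> 0" "rGamma (1 - h) \<noteq> 0"
    using Z c1 by (auto intro!: rGamma_not_Ints_neq_0 one_minus_not_Ints)
  have "Lfun p q u v h b c = \<phi> * W' * (rGamma (1 + p - h) * rGamma (1 + q - h) * rGamma (1 + u - h) * rGamma (1 + v - h)
       * rGamma b * rGamma c) / (pi * rGamma (1 - h))"
    by (subst Lfun_eq_split) (use Z in \<open>auto simp: W_def[symmetric] W\<close>)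
  also have "\<dots> = W' * (rGamma (1 + p - h) * rGamma (1 + q - h) * rGamma (1 + u - h') * rGamma (1 + v - h')
       * rGamma b * rGamma c') / (pi * rGamma (1 - h'))"
    unfolding \<phi>_def c1 c1' using nz by (simp add: divide_simps)
  also have "\<dots> = Lfun (b - q) (b - p) u v h' b c'"
  proof -
    have "Lfun (b - q) (b - p) u v h' b c' = W' * (rGamma (1 + (b - q) - h') * rGamma (1 + (b - p) - h')
       * rGamma (1 + u - h') * rGamma (1 + v - h') * rGamma b * rGamma c') / (pi * rGamma (1 - h'))"
      unfolding W'_def by (rule Lfun_eq_split) (use Z e1 in auto)
    thus ?thesis unfolding e1(1,2) by simp
  qed
  finally show ?thesis .
qed

section \<open>Bilateral sums\<close>

text \<open>The entire extension in n of a bilateral 4H4 term: up to sign and constants (u)_n is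
  1/Gamma(1-u-n) by reflection, and 1/(v)_n is 1/Gamma(v+n).\<close>

definition recip_prod :: "complex list \<Rightarrow> complex list \<Rightarrow> complex \<Rightarrow> complex" where
  "recip_prod us vs s =
     prod_list (map (\<lambda>u. rGamma (1 - u - s)) us) * prod_list (map (\<lambda>v. rGamma (v + s)) vs)"

text \<open>With the lower parameter 1 standing for n!, this is the condition e + f + g = 1 + a + b
  + c + d. Shifts and the reflection s -> -s preserve it.\<close>

definition balanced :: "complex list \<Rightarrow> complex list \<Rightarrow> bool" where
  "balanced us vs \<longleftrightarrow> length us = 4 \<and> length vs = 4 \<and> sum_list vs = sum_list us + 2"

lemma recip_prod_shift: "recip_prod us vs (s + t) = recip_prod (map (\<lambda>x. x + t) us) (map (\<lambda>x. x + t) vs) s"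
  by (simp add: recip_prod_def o_def algebra_simps)

lemma recip_prod_minus: "recip_prod us vs (- s) = recip_prod (map (\<lambda>x. 1 - x) vs) (map (\<lambda>x. 1 - x) us) s"
  by (simp add: recip_prod_def o_def algebra_simps)

lemma recip_prod_step:
  assumes "length us = 4"
  shows "recip_prod us vs (s + 1) * prod_list (map (\<lambda>v. s + v) vs) = recip_prod us vs s * prod_list (map (\<lambda>u. s + u) us)"
proof -
  have u: "rGamma (1 - u - (s + 1)) = - ((s + u) * rGamma (1 - u - s))" for u
  proof -
    have a: "1 - u - (s + 1) = - (s + u)" and b: "1 - u - s = - (s + u) + 1" by simp_all
    show ?thesis unfolding a b using rGamma_plus1[of "- (s + u)"] by (metis mult_minus_left)
  qed
  have v: "rGamma (v + (s + 1)) * (s + v) = rGamma (v + s)" for v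
    using rGamma_plus1[of "v + s"] by (simp add: algebra_simps)
  have "prod_list (map (\<lambda>v. rGamma (v + (s + 1))) vs) * prod_list (map (\<lambda>v. s + v) vs) = prod_list (map (\<lambda>v. rGamma (v + s)) vs)"
    by (induction vs) (simp_all add: v[symmetric] mult_ac)
  moreover have "prod_list (map (\<lambda>u. rGamma (1 - u - (s + 1))) us) =
      (-1) ^ length us * (prod_list (map (\<lambda>u. s + u) us) * prod_list (map (\<lambda>u. rGamma (1 - u - s)) us))"
    unfolding u by (induction us) (simp_all add: mult_ac)
  ultimately show ?thesis using assms by (simp add: recip_prod_def mult_ac)
qed

lemma norm_sin_le_exp: "norm (sin z) \<le> exp (abs (Im z))" for z :: complex
proof -
  have "sin z = (exp (\<i> * z) - exp (- (\<i> * z))) / (2 * \<i>)" by (rule sin_exp_eq)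
  also have "norm \<dots> \<le> (norm (exp (\<i> * z)) + norm (exp (- (\<i> * z)))) / 2"
  proof -
    have n: "norm (2 * \<i>) = 2" by (simp add: norm_mult)
    show ?thesis unfolding norm_divide n by (intro divide_right_mono norm_triangle_ineq4) simp
  qed
  also have "\<dots> \<le> (exp (abs (Im z)) + exp (abs (Im z))) / 2"
    by (intro divide_right_mono add_mono) auto
  finally show ?thesis by simp
qed

text \<open>Let q k be the value at s + k, times (s+k)(s+k+1). Then q 0 is at most a constant times
  q k for all k. As k grows, Gauss's limit and the reflection formula turn q k into the product of
  the sines of pi(u+s) over pi; four sines give the exponential, the factor s(s+1) gives the
  decay.\<close>

lemma recip_prod_bound_right:
  assumes bal: "balanced us vs"
  obtains C R where "C \<ge> 0" "R \<ge> 1"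
    "\<And>s. Re s \<ge> 0 \<Longrightarrow> norm s \<ge> R \<Longrightarrow> norm (recip_prod us vs s) \<le> C * exp (4 * pi * abs (Im s)) / norm s ^ 2"
proof -
  \<comment> \<open>The shifts 2 and 0 come from the factor (s+k)(s+k+1) and equalise the two
    sums.\<close>
  define us' where "us' = us @ [2]"
  define vs' where "vs' = vs @ [0]"
  have len: "length us' = 5" "length vs' = 5" and sum: "sum_list us' = sum_list vs'"
    using bal by (simp_all add: balanced_def us'_def vs'_def)
  define B where "B = Max (norm ` (set us' \<union> set vs'))"
  have fin: "finite (norm ` (set us' \<union> set vs'))" by simp
  have B: "norm x \<le> B" if "x \<in> set us' \<union> set vs'" for x
    unfolding B_def by (intro Max_ge fin imageI that)
  have B0: "B \<ge> 0" using order_trans[OF norm_ge_zero B[of 2]] by (simp add: us'_def)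
  define R where "R = max 1 (4 * real 5 * B)"
  define K where "K = exp (16 * (5 * B)\<^sup>2 * (\<Sum>k. 1 / (1 + real k ^ 2)))"
  define C where "C = K * (\<Prod>u\<leftarrow>us. exp (pi * norm u) / pi)"
  show ?thesis
  proof (rule that[of C R])
    show "C \<ge> 0" unfolding C_def K_def
      by (intro mult_nonneg_nonneg) (auto intro!: prod_list_nonneg)
    show "R \<ge> 1" by (simp add: R_def)
  next
    fix s :: complex
    assume Re: "Re s \<ge> 0" and R: "norm s \<ge> R"
    have s1: "norm s \<ge> 1" "norm s \<ge> 4 * real 5 * B" using R by (auto simp: R_def)
    have s0: "s \<noteq> 0" using s1 by auto
    define q where "q k = recip_prod us vs (s + of_nat k) * ((s + of_nat k) * (s + of_nat k + 1))" for k
    have rec: "q (Suc k) * prod_list (map (\<lambda>v. s + of_nat k + v) vs') = q k * prod_list (map (\<lambda>u. s + of_nat k + u) us')" for k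
    proof -
      have st: "recip_prod us vs (s + of_nat k + 1) * prod_list (map (\<lambda>v. s + of_nat k + v) vs)
        = recip_prod us vs (s + of_nat k) * prod_list (map (\<lambda>u. s + of_nat k + u) us)"
        by (rule recip_prod_step) (use bal in \<open>simp add: balanced_def\<close>)
      have e: "s + of_nat (Suc k) = s + of_nat k + 1" by simp
      show ?thesis
        using arg_cong[OF st, of "\<lambda>z. z * ((s + of_nat k) * (s + of_nat k + 1) * (s + of_nat k + 2))"]
        unfolding q_def e us'_def vs'_def by (simp add: mult_ac add_ac)
    qed
    have qK: "norm (q 0) \<le> K * norm (q k)" for k
    proof -
      have "norm (q 0) \<le> exp (16 * (real 5 * B)\<^sup>2 * (\<Sum>k. 1 / (1 + real k ^ 2))) * norm (q k)"
        by (rule telescoping_bound(2)[OF len sum B B0 s1(2,1) Re rec])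
      thus ?thesis by (simp add: K_def)
    qed
    have vnz: "prod_list (map (\<lambda>v. s + of_nat k + v) vs') \<noteq> 0" for k
    proof (rule norm_prod_list_ratio(1)[OF len sum B])
      have "(norm s)\<^sup>2 \<le> (norm (s + of_nat k))\<^sup>2"
        using norm_add_nat_ge[OF Re, of k] by (meson add_increasing2 order_trans le_add_same_cancel1 zero_le_power2)
      hence "norm s \<le> norm (s + of_nat k)" by (rule power2_le_imp_le) simp
      thus "2 * real 5 * B \<le> norm (s + of_nat k)" "s + of_nat k \<noteq> 0" using s1 B0 by auto
    qed
    have vnz': "v + s + of_nat k \<noteq> 0" if "v \<in> set vs'" for v k
    proof
      assume "v + s + of_nat k = 0"
      hence "s + of_nat k + v = 0" by (simp add: add_ac)
      hence "0 \<in> set (map (\<lambda>v. s + of_nat k + v) vs')" using that by force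
      thus False using vnz[of k] by (simp add: prod_list_zero_iff)
    qed
    have pnz: "pochhammer (v + s) k \<noteq> 0" if "v \<in> set vs'" for v k
      using vnz'[OF that] by (auto simp: pochhammer_eq_0_iff add_eq_0_iff2)
    have gnz: "rGamma (v + s) \<noteq> 0" if "v \<in> set vs'" for v
      using vnz'[OF that] by (auto simp: rGamma_eq_zero_iff add_eq_0_iff2 elim!: nonpos_Ints_cases')
    define P where "P k = prod_list (map (\<lambda>x. pochhammer x k) (map (\<lambda>u. u + s) us')) / prod_list (map (\<lambda>x. pochhammer x k) (map (\<lambda>u. u + s) vs'))" for k
    have qP: "q k = q 0 * P k" for k
    proof (induction k)
      case (Suc k)
      have p: "prod_list (map (\<lambda>x. pochhammer x (Suc k)) (map (\<lambda>u. u + s) ws)) =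
        prod_list (map (\<lambda>x. pochhammer x k) (map (\<lambda>u. u + s) ws)) * prod_list (map (\<lambda>v. s + of_nat k + v) ws)" for ws
        by (induction ws) (simp_all add: pochhammer_Suc mult_ac add_ac)
      have "q (Suc k) = q k * (prod_list (map (\<lambda>u. s + of_nat k + u) us') / prod_list (map (\<lambda>v. s + of_nat k + v) vs'))"
        using rec[of k] vnz[of k] by (simp add: field_simps)
      also have "\<dots> = q 0 * P (Suc k)" unfolding Suc.IH P_def p by simp
      finally show ?case .
    next
      case 0
      have "prod_list (map (\<lambda>x. pochhammer x 0) ws) = 1" for ws :: "complex list" by (induction ws) auto
      thus ?case by (simp only: P_def) simp
    qed
    define A where "A = prod_list (map rGamma (map (\<lambda>u. u + s) us')) / prod_list (map rGamma (map (\<lambda>u. u + s) vs'))"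
    have "(\<lambda>k. P (Suc k)) \<longlonglongrightarrow> A"
      unfolding P_def A_def
    proof (rule pochhammer_prod_ratio_tendsto)
      have "sum_list (map (\<lambda>u. u + s) ws) = sum_list ws + of_nat (length ws) * s" for ws
        by (induction ws) (auto simp: algebra_simps)
      thus "sum_list (map (\<lambda>u. u + s) us') = sum_list (map (\<lambda>u. u + s) vs')" using sum len by simp
    qed (use len gnz in auto)
    hence lim: "(\<lambda>k. K * norm (q 0 * P (Suc k))) \<longlonglongrightarrow> K * norm (q 0 * A)" by (intro tendsto_intros)
    have le: "norm (q 0) \<le> K * norm (q 0 * A)"
      by (rule LIMSEQ_le_const[OF lim]) (use qK qP in \<open>metis order_refl\<close>)
    have qA: "q 0 * A = (\<Prod>u\<leftarrow>us. sin (pi * (u + s)) / pi)"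
    proof -
      have g: "s * (s + 1) * rGamma (2 + s) = rGamma s"
      proof -
        have e: "s + 1 + 1 = 2 + s" by simp
        show ?thesis using rGamma_plus1[of s] rGamma_plus1[of "s + 1"] unfolding e by (metis mult.assoc)
      qed
      have "rGamma s \<noteq> 0" using gnz[of 0] by (simp add: vs'_def)
      moreover have "prod_list (map rGamma (map (\<lambda>u. u + s) vs)) \<noteq> 0"
        using gnz by (auto simp: prod_list_zero_iff vs'_def)
      ultimately have "q 0 * A = prod_list (map (\<lambda>u. rGamma (1 - u - s)) us) * prod_list (map (\<lambda>u. rGamma (u + s)) us) * (s * (s + 1) * rGamma (2 + s) / rGamma s)"
        by (simp add: q_def A_def recip_prod_def us'_def vs'_def o_def)
      also have "\<dots> = prod_list (map (\<lambda>u. rGamma (1 - u - s)) us) * prod_list (map (\<lambda>u. rGamma (u + s)) us)"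
        unfolding g using \<open>rGamma s \<noteq> 0\<close> by simp
      also have "\<dots> = (\<Prod>u\<leftarrow>us. rGamma (u + s) * rGamma (1 - (u + s)))"
        by (induction us) (simp_all add: mult_ac diff_diff_add)
      finally show ?thesis by (simp add: rGamma_reflection_complex)
    qed
    have "norm (q 0 * A) \<le> (\<Prod>u\<leftarrow>us. exp (pi * norm u) / pi) * exp (real (length us) * pi * abs (Im s))"
      unfolding qA
    proof (induction us)
      case (Cons u us)
      have "\<bar>Im (of_real pi * (u + s))\<bar> \<le> pi * norm u + pi * abs (Im s)"
      proof -
        have "\<bar>Im (of_real pi * (u + s))\<bar> = pi * \<bar>Im u + Im s\<bar>" by (simp add: abs_mult)
        also have "\<dots> \<le> pi * (norm u + abs (Im s))"
          using abs_Im_le_cmod[of u] by (intro mult_left_mono) auto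
        finally show ?thesis by (simp add: algebra_simps)
      qed
      hence "norm (sin (of_real pi * (u + s))) \<le> exp (pi * norm u) * exp (pi * abs (Im s))"
        using norm_sin_le_exp[of "of_real pi * (u + s)"] by (metis exp_add exp_le_cancel_iff order_trans)
      hence 1: "norm (sin (of_real pi * (u + s)) / pi) \<le> (exp (pi * norm u) / pi) * exp (pi * abs (Im s))"
        by (simp add: norm_divide divide_right_mono)
      have "norm (\<Prod>u\<leftarrow>u # us. sin (of_real pi * (u + s)) / pi) = norm (sin (of_real pi * (u + s)) / pi) * norm (\<Prod>u\<leftarrow>us. sin (of_real pi * (u + s)) / pi)"
        by (simp add: norm_mult norm_divide)
      also have "\<dots> \<le> ((exp (pi * norm u) / pi) * exp (pi * abs (Im s))) * ((\<Prod>u\<leftarrow>us. exp (pi * norm u) / pi) * exp (real (length us) * pi * abs (Im s)))"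
        by (intro mult_mono 1 Cons.IH) auto
      also have "\<dots> = (\<Prod>u\<leftarrow>u # us. exp (pi * norm u) / pi) * exp (real (length (u # us)) * pi * abs (Im s))"
      proof -
        have "exp (real (length (u # us)) * pi * abs (Im s)) = exp (pi * abs (Im s)) * exp (real (length us) * pi * abs (Im s))"
          by (simp add: algebra_simps flip: exp_add)
        thus ?thesis by (simp only: list.map prod_list.Cons mult_ac)
      qed
      finally show ?case .
    qed simp
    hence "norm (q 0) \<le> K * ((\<Prod>u\<leftarrow>us. exp (pi * norm u) / pi) * exp (4 * pi * abs (Im s)))"
      using le bal by (intro order_trans[OF le] mult_left_mono) (auto simp: K_def balanced_def)
    hence "norm (q 0) \<le> C * exp (4 * pi * abs (Im s))" by (simp add: C_def mult_ac)
    moreover have "norm (recip_prod us vs s) * norm s ^ 2 \<le> norm (q 0)"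
    proof -
      have "(norm s)\<^sup>2 \<le> (norm (s + 1))\<^sup>2"
        using norm_add_nat_ge[OF Re, of 1] zero_le_power2[of "real 1"] unfolding of_nat_1 by linarith
      hence "norm s \<le> norm (s + 1)" by (rule power2_le_imp_le) simp
      thus ?thesis by (simp add: q_def norm_mult power2_eq_square mult_left_mono)
    qed
    ultimately show "norm (recip_prod us vs s) \<le> C * exp (4 * pi * abs (Im s)) / norm s ^ 2"
      using s0 by (simp add: pos_le_divide_eq)
  qed
qed

lemma holomorphic_recip_prod: "recip_prod us vs holomorphic_on S"
proof -
  have "(\<lambda>s. prod_list (map (\<lambda>u. rGamma (1 - u - s)) us)) holomorphic_on S"
    by (induction us) (auto intro!: holomorphic_intros)
  moreover have "(\<lambda>s. prod_list (map (\<lambda>v. rGamma (v + s)) vs)) holomorphic_on S"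
    by (induction vs) (auto intro!: holomorphic_intros)
  ultimately show ?thesis unfolding recip_prod_def by (intro holomorphic_on_mult)
qed

text \<open>The reflection s -> -s exchanges the two lists via x -> 1 - x and keeps the balance,
  which reduces the left half-plane to the right one. On the remaining disc compactness
  suffices.\<close>

lemma recip_prod_bound:
  assumes bal: "balanced us vs"
  obtains C where "C \<ge> 0" "\<And>s. norm (recip_prod us vs s) \<le> C * exp (4 * pi * abs (Im s)) / (1 + norm s ^ 2)"
proof -
  obtain C1 R1 where 1: "C1 \<ge> 0" "R1 \<ge> 1"
    "\<And>s. Re s \<ge> 0 \<Longrightarrow> norm s \<ge> R1 \<Longrightarrow> norm (recip_prod us vs s) \<le> C1 * exp (4 * pi * abs (Im s)) / norm s ^ 2"
    using recip_prod_bound_right[OF bal] by blast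
  have bal': "balanced (map (\<lambda>x. 1 - x) vs) (map (\<lambda>x. 1 - x) us)"
  proof -
    have "sum_list (map (\<lambda>x. 1 - x) ws) = of_nat (length ws) - sum_list ws" for ws :: "complex list"
      by (induction ws) auto
    thus ?thesis using bal by (simp add: balanced_def)
  qed
  obtain C2 R2 where 2: "C2 \<ge> 0" "R2 \<ge> 1"
    "\<And>s. Re s \<ge> 0 \<Longrightarrow> norm s \<ge> R2 \<Longrightarrow> norm (recip_prod (map (\<lambda>x. 1 - x) vs) (map (\<lambda>x. 1 - x) us) s) \<le> C2 * exp (4 * pi * abs (Im s)) / norm s ^ 2"
    using recip_prod_bound_right[OF bal'] by blast
  define R where "R = max R1 R2"
  have "compact (recip_prod us vs ` cball 0 R)"
    by (intro compact_continuous_image holomorphic_on_imp_continuous_on holomorphic_recip_prod) auto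
  then obtain M where M: "\<And>s. norm s \<le> R \<Longrightarrow> norm (recip_prod us vs s) \<le> M" "M > 0"
    using compact_imp_bounded bounded_pos by (metis (no_types, lifting) dist_0_norm image_eqI mem_cball)
  define C where "C = max (M * (1 + R ^ 2)) (2 * max C1 C2)"
  have C0: "C \<ge> 0" using 1 by (simp add: C_def)
  show ?thesis
  proof (rule that[OF C0])
    fix s :: complex
    have p: "1 + norm s ^ 2 > 0" by (simp add: add_pos_nonneg)
    show "norm (recip_prod us vs s) \<le> C * exp (4 * pi * abs (Im s)) / (1 + norm s ^ 2)"
    proof (cases "norm s \<le> R")
      case True
      have "norm (recip_prod us vs s) * (1 + norm s ^ 2) \<le> M * (1 + R ^ 2)"
        using M(1)[OF True] M(2) True by (intro mult_mono add_left_mono power_mono) auto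
      also have "\<dots> \<le> C" by (simp add: C_def)
      also have "\<dots> \<le> C * exp (4 * pi * abs (Im s))" using C0 by (simp add: mult_le_cancel_left1)
      finally show ?thesis using p by (simp add: pos_le_divide_eq)
    next
      case False
      hence R: "norm s \<ge> R1" "norm s \<ge> R2" by (auto simp: R_def)
      hence n1: "norm s \<ge> 1" using 1 by linarith
      have "norm (recip_prod us vs s) \<le> max C1 C2 * exp (4 * pi * abs (Im s)) / norm s ^ 2"
      proof (cases "Re s \<ge> 0")
        case True
        have "norm (recip_prod us vs s) \<le> C1 * exp (4 * pi * abs (Im s)) / norm s ^ 2" by (rule 1(3)[OF True R(1)])
        also have "\<dots> \<le> max C1 C2 * exp (4 * pi * abs (Im s)) / norm s ^ 2"
          by (intro divide_right_mono mult_right_mono) auto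
        finally show ?thesis .
      next
        case False
        have "recip_prod us vs s = recip_prod us vs (- (- s))" by simp
        also have "norm \<dots> \<le> C2 * exp (4 * pi * abs (Im (-s))) / norm (-s) ^ 2"
          by (subst recip_prod_minus[of us vs "- s"], rule 2(3)) (use False R in auto)
        also have "\<dots> \<le> max C1 C2 * exp (4 * pi * abs (Im s)) / norm s ^ 2"
          unfolding uminus_complex.sel abs_minus_cancel norm_minus_cancel
          by (intro divide_right_mono mult_right_mono) auto
        finally show ?thesis .
      qed
      also have "\<dots> \<le> 2 * max C1 C2 * exp (4 * pi * abs (Im s)) / (1 + norm s ^ 2)"
      proof -
        have "1 \<le> norm s ^ 2" using n1 by simp
        hence "1 / norm s ^ 2 \<le> 2 / (1 + norm s ^ 2)" using p by (simp add: divide_simps)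
        hence "(max C1 C2 * exp (4 * pi * abs (Im s))) * (1 / norm s ^ 2) \<le> (max C1 C2 * exp (4 * pi * abs (Im s))) * (2 / (1 + norm s ^ 2))"
          using 1(1) by (intro mult_left_mono) auto
        thus ?thesis by (simp add: mult_ac)
      qed
      also have "\<dots> \<le> C * exp (4 * pi * abs (Im s)) / (1 + norm s ^ 2)"
        using p by (intro divide_right_mono mult_right_mono) (auto simp: C_def)
      finally show ?thesis .
    qed
  qed
qed

section \<open>The sum over all integers as a periodic entire function\<close>

definition bilateral_sum :: "complex list \<Rightarrow> complex list \<Rightarrow> complex \<Rightarrow> complex" where
  "bilateral_sum us vs z =
     (\<Sum>n. recip_prod us vs (z + of_nat n)) + (\<Sum>n. recip_prod us vs (z - 1 - of_nat n))"

text \<open>The decay that the factor 1/(1+|s|^2) leaves after summation along the line with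
  imaginary part \<open>y\<close>. Its limit 0 is what lowers the degree of the bilateral sum from 2
  to 1.\<close>

definition square_tail :: "real \<Rightarrow> real" where
  "square_tail y = (\<Sum>n. 1 / (1 + real n ^ 2 + y ^ 2))"

lemma summable_square_tail: "summable (\<lambda>n. 1 / (1 + real n ^ 2 + y ^ 2))"
proof (rule summable_comparison_test'[OF summable_inverse_one_plus_square])
  show "norm (1 / (1 + real n ^ 2 + y ^ 2)) \<le> 1 / (1 + real n ^ 2)" for n
    by (auto intro!: divide_left_mono mult_pos_pos simp: add_pos_nonneg abs_of_nonneg add_nonneg_nonneg)
qed

lemma square_tail_tendsto: "(square_tail \<longlongrightarrow> 0) at_top"
proof -
  have "((\<lambda>y. \<Sum>n. 1 / (1 + real n ^ 2 + y ^ 2)) \<longlongrightarrow> (\<Sum>n::nat. 0)) at_top"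
  proof (rule tannerys_theorem[THEN conjunct2, THEN conjunct2])
    show "((\<lambda>y. 1 / (1 + real n ^ 2 + y ^ 2)) \<longlongrightarrow> 0) at_top" for n
      by real_asymp
    show "eventually (\<lambda>(n, y). norm (1 / (1 + real n ^ 2 + y ^ 2)) \<le> 1 / (1 + real n ^ 2)) (at_top \<times>\<^sub>F at_top)"
      by (intro always_eventually)
         (auto intro!: divide_left_mono mult_pos_pos simp: add_pos_nonneg abs_of_nonneg add_nonneg_nonneg)
  qed (use summable_inverse_one_plus_square in auto)
  thus ?thesis by (simp add: square_tail_def[abs_def])
qed

text \<open>A majorant uniform on discs, for the Weierstrass test. It rests on 1 + n^2 \<le> (2 +
  2R^2)(1 + |w|^2) whenever n \<le> |w| + R; the left half starts at z - 1, hence R + 1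
  there.\<close>

lemma bilateral_sum_summable_strip:
  assumes C: "\<And>s. norm (recip_prod us vs s) \<le> C * exp (4 * pi * abs (Im s)) / (1 + norm s ^ 2)" "C \<ge> 0"
    and z: "norm z \<le> R"
  shows "norm (recip_prod us vs (z + of_nat n)) \<le> C * exp (4 * pi * R) * (2 + 2 * R ^ 2) / (1 + real n ^ 2)"
    and "norm (recip_prod us vs (z - 1 - of_nat n)) \<le> C * exp (4 * pi * (R + 1)) * (2 + 2 * (R + 1) ^ 2) / (1 + real n ^ 2)"
proof -
  have *: "norm (recip_prod us vs w) \<le> C * exp (4 * pi * R) * (2 + 2 * R ^ 2) / (1 + real n ^ 2)"
    if w: "abs (Im w) \<le> R" "real n \<le> norm w + R" for w R
  proof -
    have p: "1 + norm w ^ 2 > 0" by (simp add: add_pos_nonneg)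
    have R0: "R \<ge> 0" using w(1) by linarith
    have "real n ^ 2 \<le> (norm w + R) ^ 2" using w by (intro power_mono) auto
    also have "\<dots> \<le> 2 * norm w ^ 2 + 2 * R ^ 2"
      using zero_le_power2[of "norm w - R"] by (simp add: power2_eq_square algebra_simps)
    finally have "1 + real n ^ 2 \<le> 1 + 2 * norm w ^ 2 + 2 * R ^ 2" by simp
    also have "\<dots> \<le> (2 + 2 * R ^ 2) * (1 + norm w ^ 2)"
    proof -
      have "0 \<le> 1 + 2 * (R ^ 2 * norm w ^ 2)" by (simp add: add_nonneg_nonneg)
      thus ?thesis by (simp add: algebra_simps)
    qed
    finally have "1 / (1 + norm w ^ 2) \<le> (2 + 2 * R ^ 2) / (1 + real n ^ 2)"
      using p by (simp add: divide_simps add_pos_nonneg mult.commute)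
    moreover have "C * exp (4 * pi * abs (Im w)) \<le> C * exp (4 * pi * R)"
      using w C(2) by (intro mult_left_mono) auto
    ultimately have "(C * exp (4 * pi * abs (Im w))) * (1 / (1 + norm w ^ 2)) \<le> (C * exp (4 * pi * R)) * ((2 + 2 * R ^ 2) / (1 + real n ^ 2))"
      using C(2) p w by (intro mult_mono) auto
    thus ?thesis using C(1)[of w] by simp
  qed
  show "norm (recip_prod us vs (z + of_nat n)) \<le> C * exp (4 * pi * R) * (2 + 2 * R ^ 2) / (1 + real n ^ 2)"
  proof (rule *)
    show "abs (Im (z + of_nat n)) \<le> R" using abs_Im_le_cmod[of z] z by simp
    have "norm (of_nat n :: complex) \<le> norm (z + of_nat n) + norm z"
      using norm_triangle_ineq4[of "z + of_nat n" z] by simp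
    thus "real n \<le> norm (z + of_nat n) + R" using z by simp
  qed
  show "norm (recip_prod us vs (z - 1 - of_nat n)) \<le> C * exp (4 * pi * (R + 1)) * (2 + 2 * (R + 1) ^ 2) / (1 + real n ^ 2)"
  proof (rule *)
    show "abs (Im (z - 1 - of_nat n)) \<le> R + 1" using abs_Im_le_cmod[of z] z by simp
    have "norm (of_nat n :: complex) \<le> norm (z - 1 - of_nat n) + norm (z - 1)"
      using norm_triangle_ineq4[of "z - 1" "z - 1 - of_nat n"] by (simp add: add.commute)
    moreover have "norm (z - 1) \<le> R + 1" using norm_triangle_ineq4[of z 1] z by simp
    ultimately show "real n \<le> norm (z - 1 - of_nat n) + (R + 1)" by simp
  qed
qed

lemma summable_scaled_inverse_square: "summable (\<lambda>n. K / (1 + real n ^ 2))"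
  using summable_mult[OF summable_inverse_one_plus_square, of K] by simp

lemma
  assumes bal: "balanced us vs"
  shows summable_bilateral_right: "summable (\<lambda>n. recip_prod us vs (z + of_nat n))"
    and summable_bilateral_left: "summable (\<lambda>n. recip_prod us vs (z - 1 - of_nat n))"
proof -
  obtain C where C: "C \<ge> 0" "\<And>s. norm (recip_prod us vs s) \<le> C * exp (4 * pi * abs (Im s)) / (1 + norm s ^ 2)"
    using recip_prod_bound[OF bal] by blast
  show "summable (\<lambda>n. recip_prod us vs (z + of_nat n))"
    by (rule summable_comparison_test'[OF summable_scaled_inverse_square])
       (rule bilateral_sum_summable_strip(1)[OF C(2,1) order_refl])
  show "summable (\<lambda>n. recip_prod us vs (z - 1 - of_nat n))"
    by (rule summable_comparison_test'[OF summable_scaled_inverse_square])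
       (rule bilateral_sum_summable_strip(2)[OF C(2,1) order_refl])
qed

lemma holomorphic_bilateral_sum:
  assumes bal: "balanced us vs"
  shows "bilateral_sum us vs holomorphic_on UNIV"
proof -
  obtain C where C: "C \<ge> 0" "\<And>s. norm (recip_prod us vs s) \<le> C * exp (4 * pi * abs (Im s)) / (1 + norm s ^ 2)"
    using recip_prod_bound[OF bal] by blast
  have hol: "(\<lambda>z. recip_prod us vs (h z)) holomorphic_on UNIV" if "h holomorphic_on UNIV" for h
    using holomorphic_on_compose[OF that holomorphic_recip_prod] by (simp add: o_def)
  have *: "(\<lambda>z. \<Sum>n. f n z) holomorphic_on UNIV"
    if f: "\<And>n. f n holomorphic_on UNIV"
      "\<And>R. \<exists>K. \<forall>n z. norm z \<le> R \<longrightarrow> norm (f n z) \<le> K / (1 + real n ^ 2)"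
    for f :: "nat \<Rightarrow> complex \<Rightarrow> complex"
  proof (rule holomorphic_uniform_sequence)
    show "(\<lambda>z. \<Sum>i<n. f i z) holomorphic_on UNIV" for n by (intro holomorphic_intros f)
    fix x :: complex
    obtain K where K: "\<And>n z. norm z \<le> norm x + 1 \<Longrightarrow> norm (f n z) \<le> K / (1 + real n ^ 2)"
      using f(2)[of "norm x + 1"] by blast
    have "uniform_limit (cball x 1) (\<lambda>n z. \<Sum>i<n. f i z) (\<lambda>z. \<Sum>n. f n z) sequentially"
    proof (rule Weierstrass_m_test[OF _ summable_scaled_inverse_square])
      fix n z assume "z \<in> cball x 1"
      hence "norm z \<le> norm x + 1" using norm_triangle_ineq2[of z x] by (simp add: dist_norm norm_minus_commute)
      thus "norm (f n z) \<le> K / (1 + real n ^ 2)" by (rule K)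
    qed
    thus "\<exists>d>0. cball x d \<subseteq> UNIV \<and> uniform_limit (cball x d) (\<lambda>n z. \<Sum>i<n. f i z) (\<lambda>z. \<Sum>n. f n z) sequentially"
      by (intro exI[of _ 1]) auto
  qed auto
  have "(\<lambda>z. \<Sum>n. recip_prod us vs (z + of_nat n)) holomorphic_on UNIV"
    by (rule *) (use bilateral_sum_summable_strip(1)[OF C(2,1)] in \<open>auto intro!: hol holomorphic_intros\<close>)
  moreover have "(\<lambda>z. \<Sum>n. recip_prod us vs (z - 1 - of_nat n)) holomorphic_on UNIV"
    by (rule *) (use bilateral_sum_summable_strip(2)[OF C(2,1)] in \<open>auto intro!: hol holomorphic_intros\<close>)
  ultimately show ?thesis unfolding bilateral_sum_def by (intro holomorphic_on_add)
qed

lemma bilateral_sum_plus1: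
  assumes bal: "balanced us vs"
  shows "bilateral_sum us vs (z + 1) = bilateral_sum us vs z"
proof -
  have 1: "(\<Sum>n. recip_prod us vs (z + of_nat n)) = recip_prod us vs z + (\<Sum>n. recip_prod us vs (z + 1 + of_nat n))"
    using suminf_split_head[OF summable_bilateral_right[OF bal, of z]] by (simp add: add_ac)
  have 2: "(\<Sum>n. recip_prod us vs (z + 1 - 1 - of_nat n)) = recip_prod us vs z + (\<Sum>n. recip_prod us vs (z - 1 - of_nat n))"
    using suminf_split_head[OF summable_bilateral_left[OF bal, of "z + 1"]] by (simp add: diff_diff_add)
  show ?thesis unfolding bilateral_sum_def 2 using 1 by simp
qed

lemma bilateral_sum_minus:
  assumes bal: "balanced us vs"
  shows "bilateral_sum us vs (- z) = bilateral_sum (map (\<lambda>x. 1 - x) vs) (map (\<lambda>x. 1 - x) us) z"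
proof -
  define r where "r = recip_prod us vs"
  have r: "recip_prod (map (\<lambda>x. 1 - x) vs) (map (\<lambda>x. 1 - x) us) s = r (- s)" for s
    by (simp add: r_def recip_prod_minus)
  have 1: "(\<Sum>n. r (- z + of_nat n)) = r (- z) + (\<Sum>n. r (- (z - 1 - of_nat n)))"
    using suminf_split_head[OF summable_bilateral_right[OF bal, of "- z"]] by (simp add: r_def algebra_simps)
  have 2: "(\<Sum>n. r (- (z + of_nat n))) = r (- z) + (\<Sum>n. r (- z - 1 - of_nat n))"
    using suminf_split_head[OF summable_bilateral_left[OF bal, of "- z + 1"]] by (simp add: r_def algebra_simps)
  show ?thesis unfolding bilateral_sum_def r r_def[symmetric] 1 2 by simp
qed

lemma bilateral_sum_shift:
  "bilateral_sum us vs (z + t) = bilateral_sum (map (\<lambda>x. x + t) us) (map (\<lambda>x. x + t) vs) z"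
proof -
  have "z + t + of_nat n = (z + of_nat n) + t" "z + t - 1 - of_nat n = (z - 1 - of_nat n) + t" for n by simp_all
  thus ?thesis unfolding bilateral_sum_def by (simp only: recip_prod_shift)
qed

lemma periodic_of_int:
  fixes E :: "complex \<Rightarrow> complex"
  assumes "\<And>z. E (z + 1) = E z" shows "E (z + of_int k) = E z"
proof (induction k rule: int_induct[of _ 0])
  case (step1 i)
  thus ?case using assms[of "z + of_int i"] by (simp add: add_ac)
next
  case (step2 i)
  thus ?case using assms[of "z + of_int (i - 1)"] by (simp add: add_ac)
qed simp

text \<open>For 0 \<le> Re z \<le> 1 the real parts of z + n and z - 1 - n are at least n in
  absolute value. Periodicity moves every z into this strip without changing Im z.\<close>

lemma bilateral_sum_decay:
  assumes bal: "balanced us vs"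
  obtains C where "C \<ge> 0" "\<And>z. norm (bilateral_sum us vs z) \<le> C * exp (4 * pi * abs (Im z)) * square_tail (abs (Im z))"
proof -
  obtain C where C: "C \<ge> 0" "\<And>s. norm (recip_prod us vs s) \<le> C * exp (4 * pi * abs (Im s)) / (1 + norm s ^ 2)"
    using recip_prod_bound[OF bal] by blast
  have strip: "norm (bilateral_sum us vs z) \<le> 2 * C * exp (4 * pi * abs (Im z)) * square_tail (abs (Im z))"
    if z: "0 \<le> Re z" "Re z \<le> 1" for z
  proof -
    define K where "K = C * exp (4 * pi * abs (Im z))"
    have K: "K \<ge> 0" using C by (simp add: K_def)
    have b: "norm (recip_prod us vs w) \<le> K * (1 / (1 + real n ^ 2 + abs (Im z) ^ 2))"
      if "Im w = Im z" "real n ^ 2 \<le> Re w ^ 2" for w n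
    proof -
      have "norm (recip_prod us vs w) \<le> K / (1 + norm w ^ 2)" using C(2)[of w] that by (simp add: K_def)
      also have "\<dots> \<le> K / (1 + real n ^ 2 + abs (Im z) ^ 2)"
        using that K by (intro divide_left_mono mult_pos_pos) (auto simp: cmod_power2 add_pos_nonneg)
      finally show ?thesis by simp
    qed
    have s: "summable (\<lambda>n. K * (1 / (1 + real n ^ 2 + abs (Im z) ^ 2)))"
      by (intro summable_mult summable_square_tail)
    have sm: "(\<Sum>n. K * (1 / (1 + real n ^ 2 + abs (Im z) ^ 2))) = K * square_tail (abs (Im z))"
      unfolding square_tail_def by (intro suminf_mult summable_square_tail)
    have "norm (\<Sum>n. recip_prod us vs (z + of_nat n)) \<le> K * square_tail (abs (Im z))"
      unfolding sm[symmetric]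
    proof (intro norm_suminf_le s b)
      fix n
      show "real n ^ 2 \<le> Re (z + of_nat n) ^ 2" using z by (intro power_mono) auto
    qed auto
    moreover have "norm (\<Sum>n. recip_prod us vs (z - 1 - of_nat n)) \<le> K * square_tail (abs (Im z))"
      unfolding sm[symmetric]
    proof (intro norm_suminf_le s b)
      fix n
      have "real n ^ 2 \<le> (real n + (1 - Re z)) ^ 2" using z by (intro power_mono) auto
      also have "\<dots> = Re (z - 1 - of_nat n) ^ 2" by (simp add: power2_eq_square algebra_simps)
      finally show "real n ^ 2 \<le> Re (z - 1 - of_nat n) ^ 2" .
    qed auto
    ultimately have "norm (bilateral_sum us vs z) \<le> K * square_tail (abs (Im z)) + K * square_tail (abs (Im z))"
      unfolding bilateral_sum_def by (rule norm_triangle_mono)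
    thus ?thesis by (simp add: K_def mult_ac)
  qed
  have per: "bilateral_sum us vs (z + of_int k) = bilateral_sum us vs z" for z k
    by (rule periodic_of_int) (rule bilateral_sum_plus1[OF bal])
  show ?thesis
  proof (rule that[of "2 * C"])
    fix z
    define w where "w = z + of_int (- \<lfloor>Re z\<rfloor>)"
    have "norm (bilateral_sum us vs w) \<le> 2 * C * exp (4 * pi * abs (Im w)) * square_tail (abs (Im w))"
    proof (rule strip)
      show "0 \<le> Re w" by (simp add: w_def)
      show "Re w \<le> 1" by (simp add: w_def) linarith
    qed
    moreover have "bilateral_sum us vs w = bilateral_sum us vs z" unfolding w_def by (rule per)
    ultimately show "norm (bilateral_sum us vs z) \<le> 2 * C * exp (4 * pi * abs (Im z)) * square_tail (abs (Im z))"
      by (simp add: w_def)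
  qed (use C in auto)
qed

section \<open>Expressing K by two L functions\<close>

text \<open>The source of the sine brackets. For f, g, b, c, d it splits the coefficient of the
  value at 0 in the four-point relation; for the same five lowered by \<open>a\<close> it yields the
  bracket in \<open>B_2\<close>.\<close>

lemma sin_four_identity:
  fixes p q B C D :: complex
  shows "sin p * (sin (q - B) * sin (q - C) * sin (q - D)) - sin q * (sin (p - B) * sin (p - C) * sin (p - D)) =
    sin (q - p) * (sin B * sin C * sin D - sin (B + C + D - p - q) * sin p * sin q)"
proof -
  have 1: "cos x * cos x = 1 - sin x * sin x" for x :: complex
    using sin_cos_squared_add[of x] by (simp add: power2_eq_square algebra_simps)
  have 2: "cos x * (cos x * y) = y - sin x * (sin x * y)" for x y :: complex
    using 1[of x] by (simp add: mult.assoc[symmetric] left_diff_distrib)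
  show ?thesis unfolding sin_diff sin_add cos_diff cos_add by (simp add: algebra_simps 1 2)
qed

text \<open>In w = exp(2 pi i z) the function lives on the punctured plane, and |Im z| = |ln |w||/(2
  pi), so the bound is |w|^2 or |w|^-2 times a null factor. Multiplied by w^2 it extends to a
  polynomial without constant term and of degree at most 3.\<close>

lemma periodic_entire_trig_form:
  fixes E :: "complex \<Rightarrow> complex" and \<tau> :: "real \<Rightarrow> real"
  assumes hol: "E holomorphic_on UNIV" and per: "\<And>z. E (z + 1) = E z"
    and bd: "\<And>z. norm (E z) \<le> C * exp (4 * pi * abs (Im z)) * \<tau> (abs (Im z))"
    and \<tau>: "(\<tau> \<longlongrightarrow> 0) at_top" and C: "C \<ge> 0"
  obtains c1 c2 c3 where "\<And>z. E z * exp (2 * pi * \<i> * z) = c1 + c2 * exp (2 * pi * \<i> * z) + c3 * exp (2 * pi * \<i> * z) ^ 2"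
proof -
  define T where "T z = exp (2 * pi * \<i> * z)" for z :: complex
  define g where "g w = E (Ln w / (2 * pi * \<i>))" for w
  note per' = periodic_of_int[of E, OF per]
  have gT: "g w = E z" if "T z = w" for z w
  proof -
    have "w \<noteq> 0" using that by (auto simp: T_def)
    hence "exp (Ln w) = exp (2 * pi * \<i> * z)" using that by (simp add: T_def)
    then obtain n :: int where "Ln w = 2 * pi * \<i> * z + (of_int (2 * n) * pi) * \<i>"
      unfolding exp_eq by blast
    hence "Ln w / (2 * pi * \<i>) = z + of_int n" by (simp add: field_simps)
    thus ?thesis by (simp add: g_def per')
  qed
  have gb: "norm (g w) \<le> C * exp (2 * abs (ln (norm w))) * \<tau> (abs (ln (norm w)) / (2 * pi))" if "w \<noteq> 0" for w
  proof -
    have "Im (Ln w / (2 * pi * \<i>)) = - ln (norm w) / (2 * pi)"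
      using that by (simp add: Im_divide power2_eq_square)
    hence "\<bar>Im (Ln w / (2 * pi * \<i>))\<bar> = abs (ln (norm w)) / (2 * pi)" by simp
    thus ?thesis unfolding g_def using bd[of "Ln w / (2 * pi * \<i>)"] by simp
  qed
  \<comment> \<open>Near 0 the square absorbs |w|^-2 and only the null factor remains, so 0 is the
    continuous value at the origin.\<close>
  define h where "h w = (if w = 0 then 0 else w ^ 2 * g w)" for w
  have hb: "norm (h w) \<le> norm w ^ 2 * (C * exp (2 * abs (ln (norm w))) * \<tau> (abs (ln (norm w)) / (2 * pi)))" if "w \<noteq> 0" for w
    using gb[OF that] that by (simp add: h_def norm_mult norm_power mult_left_mono)
  have small: "norm (h w) \<le> C * \<tau> (- ln (norm w) / (2 * pi))" if "w \<noteq> 0" "norm w \<le> 1" for w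
  proof -
    have "abs (ln (norm w)) = - ln (norm w)" using that by simp
    moreover have "norm w ^ 2 * exp (2 * - ln (norm w)) = 1"
    proof -
      have "exp (2 * - ln (norm w)) = inverse (norm w) ^ 2"
        using that by (simp add: exp_double exp_minus power_inverse)
      thus ?thesis using that by (simp add: power_mult_distrib[symmetric])
    qed
    moreover have "norm w ^ 2 * (C * exp (2 * - ln (norm w)) * \<tau> (- ln (norm w) / (2 * pi))) =
       (norm w ^ 2 * exp (2 * - ln (norm w))) * (C * \<tau> (- ln (norm w) / (2 * pi)))"
      by (simp only: mult_ac)
    ultimately show ?thesis using hb[OF that(1)] by (simp only: mult_1_left)
  qed
  have large: "norm (h w) \<le> norm w ^ 4 * (C * \<tau> (ln (norm w) / (2 * pi)))" if "norm w \<ge> 1" for w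
  proof -
    have w0: "w \<noteq> 0" using that by auto
    have "abs (ln (norm w)) = ln (norm w)" using that by simp
    moreover have "exp (2 * ln (norm w)) = norm w ^ 2" using w0 by (simp add: exp_double)
    ultimately show ?thesis using hb[OF w0] by (simp add: mult_ac power2_eq_square power4_eq_xxxx)
  qed
  have hol_g: "g holomorphic_on (- {0})"
  proof -
    have E: "(\<lambda>w. E (f w)) holomorphic_on S" if "f holomorphic_on S" for f S
      using holomorphic_on_compose[OF that holomorphic_on_subset[OF hol]] by (simp add: o_def)
    have A: "g holomorphic_on (- \<real>\<^sub>\<le>\<^sub>0)" unfolding g_def
      by (intro E holomorphic_intros) auto
    \<comment> \<open>A second logarithm, cut along the nonnegative real axis. By periodicity it
      defines the same function, and the two cut planes cover the punctured plane.\<close>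
    have "(\<lambda>w. E ((Ln (- w) + \<i> * pi) / (2 * pi * \<i>))) holomorphic_on (- uminus ` \<real>\<^sub>\<le>\<^sub>0)"
    proof (intro E holomorphic_intros)
      show "- z \<notin> \<real>\<^sub>\<le>\<^sub>0" if "z \<in> - uminus ` \<real>\<^sub>\<le>\<^sub>0" for z :: complex
        using that by (metis ComplD image_eqI minus_minus)
    qed auto
    hence B: "g holomorphic_on (- uminus ` \<real>\<^sub>\<le>\<^sub>0)"
    proof (rule holomorphic_transform)
      fix w :: complex assume "w \<in> - uminus ` \<real>\<^sub>\<le>\<^sub>0"
      hence "w \<noteq> 0" by force
      have "T ((Ln (- w) + \<i> * pi) / (2 * pi * \<i>)) = exp (Ln (- w) + \<i> * pi)"
        unfolding T_def by simp
      also have "\<dots> = w" using \<open>w \<noteq> 0\<close> by (simp add: exp_add)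
      finally show "E ((Ln (- w) + \<i> * pi) / (2 * pi * \<i>)) = g w" by (rule gT[symmetric])
    qed
    have "open (- (uminus ` \<real>\<^sub>\<le>\<^sub>0 :: complex set))"
      by (intro open_Compl closed_negations closed_nonpos_Reals_complex)
    hence "g holomorphic_on (- \<real>\<^sub>\<le>\<^sub>0) \<union> (- uminus ` \<real>\<^sub>\<le>\<^sub>0)"
      using A B by (intro holomorphic_on_Un) (auto simp: closed_nonpos_Reals_complex)
    moreover have "- {0} \<subseteq> (- \<real>\<^sub>\<le>\<^sub>0) \<union> (- uminus ` \<real>\<^sub>\<le>\<^sub>0 :: complex set)"
      by (auto simp: complex_nonpos_Reals_iff complex_eq_iff)
    ultimately show ?thesis by (rule holomorphic_on_subset)
  qed
  have ln0: "filterlim (\<lambda>w::complex. - ln (norm w) / (2 * pi)) at_top (at 0)"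
  proof -
    have n0: "filterlim (\<lambda>w::complex. norm w) (at_right 0) (at 0)"
      by (auto simp: filterlim_at eventually_at_filter intro!: tendsto_eq_intros)
    have "filterlim (\<lambda>x::real. - ln x / (2 * pi)) at_top (at_right 0)" by real_asymp
    from filterlim_compose[OF this n0] show ?thesis .
  qed
  have lninf: "filterlim (\<lambda>w::complex. ln (norm w) / (2 * pi)) at_top at_infinity"
  proof -
    have "filterlim (\<lambda>x::real. ln x / (2 * pi)) at_top at_top" by real_asymp
    from filterlim_compose[OF this filterlim_norm_at_top] show ?thesis .
  qed
  have hol_h: "h holomorphic_on UNIV"
  proof (rule no_isolated_singularity'[where K = "{0}"])
    have "(h \<longlongrightarrow> 0) (at 0)"
    proof (rule Lim_null_comparison)
      have "eventually (\<lambda>w::complex. norm w \<le> 1 \<and> w \<noteq> 0) (at 0)"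
        unfolding eventually_at by (intro exI[of _ 1]) auto
      thus "eventually (\<lambda>w. norm (h w) \<le> C * \<tau> (- ln (norm w) / (2 * pi))) (at 0)"
        by eventually_elim (use small in auto)
      have "((\<lambda>w::complex. C * \<tau> (- ln (norm w) / (2 * pi))) \<longlongrightarrow> C * 0) (at 0)"
        by (intro tendsto_mult tendsto_const filterlim_compose[OF \<tau> ln0])
      thus "((\<lambda>w::complex. C * \<tau> (- ln (norm w) / (2 * pi))) \<longlongrightarrow> 0) (at 0)" by simp
    qed
    thus "(h \<longlongrightarrow> h z) (at z within UNIV)" if "z \<in> {0}" for z using that by (simp add: h_def)
    have "(\<lambda>w. w ^ 2 * g w) holomorphic_on (- {0})" by (intro holomorphic_intros hol_g)
    thus "h holomorphic_on (UNIV - {0})"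
      by (rule holomorphic_transform[THEN holomorphic_on_subset]) (auto simp: h_def)
  qed auto
  have "eventually (\<lambda>w::complex. \<tau> (ln (norm w) / (2 * pi)) < 1) at_infinity"
    using order_tendstoD(2)[OF filterlim_compose[OF \<tau> lninf], of 1] by simp
  then obtain R where R: "\<And>w::complex. norm w \<ge> R \<Longrightarrow> \<tau> (ln (norm w) / (2 * pi)) < 1"
    unfolding eventually_at_infinity by blast
  define c where "c k = (deriv ^^ k) h 0 / fact k" for k
  have poly: "h w = (\<Sum>k\<le>4. c k * w ^ k)" for w
    unfolding c_def
  proof (rule Liouville_polynomial[OF hol_h, where A = "max 1 R" and B = C])
    fix w :: complex assume w: "max 1 R \<le> norm w"
    have "norm (h w) \<le> norm w ^ 4 * (C * \<tau> (ln (norm w) / (2 * pi)))" by (rule large) (use w in auto)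
    also have "\<dots> \<le> norm w ^ 4 * (C * 1)" using R[of w] w C by (intro mult_left_mono) auto
    finally show "norm (h w) \<le> C * norm w ^ 4" by (simp add: mult_ac)
  qed
  hence poly': "h w = c 0 + c 1 * w + c 2 * w ^ 2 + c 3 * w ^ 3 + c 4 * w ^ 4" for w
    by (simp add: eval_nat_numeral)
  have c0: "c 0 = 0" using poly'[of 0] by (simp add: h_def)
  \<comment> \<open>Growth of order w^4 permits degree 4 a priori; the null factor at infinity
    excludes it. The surviving powers w, w^2, w^3 are the frequencies -1, 0, 1.\<close>
  have c4: "c 4 = 0"
  proof -
    have "((\<lambda>w. h w / w ^ 4) \<longlongrightarrow> 0) at_infinity"
    proof (rule Lim_null_comparison)
      have "eventually (\<lambda>w::complex. norm w \<ge> 1) at_infinity" unfolding eventually_at_infinity by auto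
      thus "eventually (\<lambda>w. norm (h w / w ^ 4) \<le> C * \<tau> (ln (norm w) / (2 * pi))) at_infinity"
      proof eventually_elim
        case (elim w)
        have "norm w ^ 4 > 0" using elim by (intro zero_less_power) auto
        thus ?case using large[OF elim] by (simp add: norm_divide norm_power pos_divide_le_eq mult_ac)
      qed
      have "((\<lambda>w::complex. C * \<tau> (ln (norm w) / (2 * pi))) \<longlongrightarrow> C * 0) at_infinity"
        by (intro tendsto_mult tendsto_const filterlim_compose[OF \<tau> lninf])
      thus "((\<lambda>w::complex. C * \<tau> (ln (norm w) / (2 * pi))) \<longlongrightarrow> 0) at_infinity" by simp
    qed
    moreover have "((\<lambda>w. c 1 * inverse w ^ 3 + c 2 * inverse w ^ 2 + c 3 * inverse w + c 4) \<longlongrightarrow>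
       c 1 * 0 ^ 3 + c 2 * 0 ^ 2 + c 3 * 0 + c 4) at_infinity"
      by (intro tendsto_intros tendsto_inverse_0)
    moreover have "eventually (\<lambda>w. c 1 * inverse w ^ 3 + c 2 * inverse w ^ 2 + c 3 * inverse w + c 4 = h w / w ^ 4) at_infinity"
    proof -
      have "eventually (\<lambda>w::complex. norm w \<ge> 1) at_infinity" unfolding eventually_at_infinity by auto
      thus ?thesis
      proof eventually_elim
        case (elim w)
        hence "w \<noteq> 0" by auto
        thus ?case by (simp add: poly' c0 field_simps eval_nat_numeral)
      qed
    qed
    ultimately have "((\<lambda>w. h w / w ^ 4) \<longlongrightarrow> c 4) at_infinity"
      by (simp add: Lim_transform_eventually)
    thus ?thesis using \<open>((\<lambda>w. h w / w ^ 4) \<longlongrightarrow> 0) at_infinity\<close> tendsto_unique trivial_limit_at_infinity by blast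
  qed
  show ?thesis
  proof (rule that)
    fix z
    have T0: "T z \<noteq> 0" by (simp add: T_def)
    have "T z ^ 2 * E z = c 1 * T z + c 2 * T z ^ 2 + c 3 * T z ^ 3"
      using poly'[of "T z"] T0 gT[of z "T z"] by (simp add: h_def c0 c4)
    hence "T z * (E z * T z) = T z * (c 1 + c 2 * T z + c 3 * T z ^ 2)"
      by (simp add: power2_eq_square power3_eq_cube algebra_simps)
    hence "E z * T z = c 1 + c 2 * T z + c 3 * T z ^ 2" using T0 by simp
    thus "E z * exp (2 * pi * \<i> * z) = c 1 + c 2 * exp (2 * pi * \<i> * z) + c 3 * exp (2 * pi * \<i> * z) ^ 2"
      by (simp add: T_def)
  qed
qed

text \<open>
  The four values lie in the three-dimensional space of trigonometric polynomials spanned by \<open>1\<close> and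
  \<open>exp (\<plusminus>2 \<pi> \<i> z)\<close>.
\<close>
lemma bilateral_four_point:
  assumes bal: "balanced us vs"
  defines "E \<equiv> bilateral_sum us vs" and "S \<equiv> \<lambda>x::complex. sin (pi * x)"
  shows "E z1 * (S (z2 - z3) * S (z2 - z4) * S (z3 - z4)) - E z2 * (S (z1 - z3) * S (z1 - z4) * S (z3 - z4))
    + E z3 * (S (z1 - z2) * S (z1 - z4) * S (z2 - z4)) - E z4 * (S (z1 - z2) * S (z1 - z3) * S (z2 - z3)) = 0"
proof -
  obtain C where C: "C \<ge> 0" "\<And>z. norm (E z) \<le> C * exp (4 * pi * abs (Im z)) * square_tail (abs (Im z))"
    unfolding E_def using bilateral_sum_decay[OF bal] by blast
  obtain c1 c2 c3 where c: "\<And>z. E z * exp (2 * pi * \<i> * z) = c1 + c2 * exp (2 * pi * \<i> * z) + c3 * exp (2 * pi * \<i> * z) ^ 2"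
  proof (rule periodic_entire_trig_form[of E C square_tail])
    show "E holomorphic_on UNIV" unfolding E_def by (rule holomorphic_bilateral_sum[OF bal])
    show "E (z + 1) = E z" for z unfolding E_def by (rule bilateral_sum_plus1[OF bal])
  qed (use C square_tail_tendsto in auto)
  \<comment> \<open>Half frequencies, so that the sine of a difference is (t x^2 - t y^2)/(2 i t x t
    y).\<close>
  define t where "t z = exp (pi * \<i> * z)" for z :: complex
  have t0: "t z \<noteq> 0" for z by (simp add: t_def)
  have tt: "exp (2 * pi * \<i> * z) = t z ^ 2" for z
    unfolding t_def by (simp add: exp_double[symmetric] mult_ac)
  have E: "E z = (c1 + c2 * t z ^ 2 + c3 * t z ^ 4) / t z ^ 2" for z
    using c[of z] t0[of z] unfolding tt by (simp add: field_simps flip: power_mult)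
  have S: "S (x - y) = (t x ^ 2 - t y ^ 2) / (2 * \<i> * t x * t y)" for x y
  proof -
    have "S (x - y) = (exp (\<i> * (pi * (x - y))) - exp (- (\<i> * (pi * (x - y))))) / (2 * \<i>)"
      unfolding S_def by (rule sin_exp_eq)
    also have "exp (\<i> * (pi * (x - y))) = t x / t y" by (simp add: t_def exp_diff[symmetric] algebra_simps)
    also have "exp (- (\<i> * (pi * (x - y)))) = t y / t x" by (simp add: t_def exp_diff[symmetric] algebra_simps)
    finally show ?thesis using t0[of x] t0[of y] by (simp add: field_simps power2_eq_square)
  qed
  define p where "p = t z1 ^ 2" define q where "q = t z2 ^ 2" define r where "r = t z3 ^ 2" define s where "s = t z4 ^ 2"
  define P where "P x = c1 + c2 * x + c3 * x ^ 2" for x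
  define k where "k = (2 * \<i>) ^ 3 * (p * q * r * s)"
  have nz: "p \<noteq> 0" "q \<noteq> 0" "r \<noteq> 0" "s \<noteq> 0" by (simp_all add: p_def q_def r_def s_def t0)
  have e4: "t z ^ 4 = (t z ^ 2) ^ 2" for z by (simp flip: power_mult)
  have tr: "X / t x ^ 2 * ((a - b) / (2 * \<i> * t y * t z) * ((a - d) / (2 * \<i> * t y * t w)) * ((b - d) / (2 * \<i> * t z * t w)))
     = X * ((a - b) * (a - d) * (b - d)) / ((2 * \<i>) ^ 3 * (t x ^ 2 * t y ^ 2 * t z ^ 2 * t w ^ 2))" for X x y z w a b d
    by (simp only: divide_inverse inverse_mult_distrib power2_eq_square power3_eq_cube mult_ac)
  have "E z1 * (S (z2 - z3) * S (z2 - z4) * S (z3 - z4)) = P p * ((q - r) * (q - s) * (r - s)) / k"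
    unfolding E S e4 P_def p_def[symmetric] q_def[symmetric] r_def[symmetric] s_def[symmetric] 
    unfolding p_def q_def r_def s_def k_def by (rule tr)
  moreover have "E z2 * (S (z1 - z3) * S (z1 - z4) * S (z3 - z4)) = P q * ((p - r) * (p - s) * (r - s)) / k"
    unfolding E S e4 P_def p_def q_def r_def s_def k_def by (subst tr) (simp add: mult_ac)
  moreover have "E z3 * (S (z1 - z2) * S (z1 - z4) * S (z2 - z4)) = P r * ((p - q) * (p - s) * (q - s)) / k"
    unfolding E S e4 P_def p_def q_def r_def s_def k_def by (subst tr) (simp add: mult_ac)
  moreover have "E z4 * (S (z1 - z2) * S (z1 - z3) * S (z2 - z3)) = P s * ((p - q) * (p - r) * (q - r)) / k"
    unfolding E S e4 P_def p_def q_def r_def s_def k_def by (subst tr) (simp add: mult_ac)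
  \<comment> \<open>A 4 by 4 determinant with rows 1, x, x^2, P x vanishes because \<open>P\<close>
    is quadratic; this is its expansion along the values of \<open>P\<close>.\<close>
  moreover have "P p * ((q - r) * (q - s) * (r - s)) - P q * ((p - r) * (p - s) * (r - s))
     + P r * ((p - q) * (p - s) * (q - s)) - P s * ((p - q) * (p - r) * (q - r)) = 0"
    unfolding P_def by algebra
  ultimately show ?thesis by (simp flip: diff_divide_distrib add_divide_distrib)
qed

lemma rGamma_shift_up:
  assumes "v \<notin> \<int>\<^sub>\<le>\<^sub>0"
  shows "rGamma (v + of_nat n) = rGamma v / pochhammer (v::complex) n"
proof -
  have "pochhammer v n \<noteq> 0" using assms pochhammer_eq_0_imp_nonpos_Int by blast
  thus ?thesis using pochhammer_rGamma[of v n] by (simp add: field_simps)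
qed

lemma rGamma_shift_down: "rGamma (1 - u - of_nat n) = (-1) ^ n * pochhammer u n * rGamma (1 - u :: complex)"
  using pochhammer_rGamma[of "1 - u - of_nat n" n] pochhammer_minus_nat[of "1 - u" n] by simp

text \<open>The lower parameter 1 contributes 1/Gamma(1+s), which vanishes at all negative integers
  and so leaves the one-sided series.\<close>

lemma bilateral_sum_0:
  assumes bal: "e + f + g = 1 + a + b + c + d" and "e \<notin> \<int>\<^sub>\<le>\<^sub>0" "f \<notin> \<int>\<^sub>\<le>\<^sub>0" "g \<notin> \<int>\<^sub>\<le>\<^sub>0"
  shows "bilateral_sum [a, b, c, d] [1, e, f, g] 0 =
    (rGamma (1 - a) * rGamma (1 - b) * rGamma (1 - c) * rGamma (1 - d)) * (rGamma e * rGamma f * rGamma g) * hyp4F3 a b c d e f g"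
proof -
  have left: "recip_prod us [1, e, f, g] (0 - 1 - of_nat n) = 0" for us n
  proof -
    have "1 + (0 - 1 - of_nat n) = - (of_nat n :: complex)" by simp
    hence "rGamma (1 + (0 - 1 - of_nat n) :: complex) = 0" by (simp only: rGamma_eq_zero_iff minus_of_nat_in_nonpos_Ints)
    thus ?thesis by (simp add: recip_prod_def)
  qed
  define P where "P = (rGamma (1 - a) * rGamma (1 - b) * rGamma (1 - c) * rGamma (1 - d)) * (rGamma e * rGamma f * rGamma g)"
  have right: "recip_prod [a, b, c, d] [1, e, f, g] (0 + of_nat n) = P * hyp_term a b c d e f g n" for n
  proof -
    have s: "(-1) ^ n * (-1) ^ n = (1::complex)" by (simp flip: power_mult_distrib)
    have f1: "rGamma (1 + of_nat n :: complex) = 1 / fact n"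
      by (subst rGamma_shift_up) (auto simp: pochhammer_fact)
    have aux: "(s * pa * A) * ((s * pb * B) * ((s * pc * C) * ((s * pd * D) * 1))) * (1 / F * (E / pe * (G / pf * (H / pg * 1))))
       = (A * B * C * D) * (E * G * H) * (pa * pb * pc * pd / (F * pe * pf * pg))" if "s * s = 1"
      for s pa A pb B pc C pd D F E pe G pf H pg :: complex
    proof -
      have eq: "(s * pa * A) * ((s * pb * B) * ((s * pc * C) * ((s * pd * D) * 1))) = (s * s) * (s * s) * ((pa * A) * (pb * B) * (pc * C) * (pd * D))"
        unfolding mult_1_right by (simp only: mult_ac)
      show ?thesis unfolding eq that
        by (simp only: divide_inverse inverse_mult_distrib mult_1_left mult_1_right mult_ac)
    qed
    show ?thesis
      unfolding recip_prod_def list.map prod_list.Cons prod_list.Nil add_0 rGamma_shift_down f1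
        rGamma_shift_up[OF assms(2)] rGamma_shift_up[OF assms(3)] rGamma_shift_up[OF assms(4)] P_def hyp_term_def
      by (rule aux[OF s])
  qed
  show ?thesis
    unfolding bilateral_sum_def left right hyp4F3_eq_suminf P_def[symmetric]
    using suminf_mult[OF summable_norm_cancel[OF summable_hyp_term[OF bal]], of P] by simp
qed

lemma hyp4F3_swap: "hyp4F3 a b c d e f g = hyp4F3 a b c d e g f"
  by (simp add: hyp4F3_def mult_ac)

lemma hyp4F3_rotate: "hyp4F3 a b c d e f g = hyp4F3 a b c d f g e"
  by (simp add: hyp4F3_def mult_ac)

lemma Lfun_swap: "Lfun a b c d e f g = Lfun a b c d e g f"
  unfolding Lfun_def hyp4F3_swap[of a b c d e f g]
    hyp4F3_swap[of "1 + a - e" "1 + b - e" "1 + c - e" "1 + d - e" "2 - e" "1 + f - e" "1 + g - e"]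
  by (simp only: mult_ac)

lemma not_nonpos_Int_if_not_Int: "x \<notin> \<int> \<Longrightarrow> x \<notin> \<int>\<^sub>\<le>\<^sub>0"
  by (auto elim!: nonpos_Ints_cases)

lemma sin_pi_one_minus: "sin (of_real pi * (1 - x)) = sin (of_real pi * x :: complex)"
proof -
  have "of_real pi * (1 - x) = of_real pi - of_real pi * x" by (simp add: algebra_simps)
  thus ?thesis by (simp add: sin_diff flip: sin_of_real cos_of_real)
qed

lemma sin_pi_not_Ints: "x \<notin> \<int> \<Longrightarrow> sin (of_real pi * x :: complex) \<noteq> 0"
proof
  assume "x \<notin> \<int>" "sin (of_real pi * x) = 0"
  hence "rGamma x * rGamma (1 - x) = 0" by (simp add: rGamma_reflection_complex)
  moreover have "1 - x \<notin> \<int>" using \<open>x \<notin> \<int>\<close> by (rule one_minus_not_Ints)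
  ultimately show False using \<open>x \<notin> \<int>\<close> rGamma_not_Ints_neq_0 by auto
qed

text \<open>The four-point relation at 0, 1 - f, 1 - g, -a involves the series shared by all three
  functions, the second series of the two L functions and that of K. The coefficient of the shared
  one splits so that K and both L functions can be completed.\<close>

lemma Kfun_Lfun:
  fixes a b c d e f g :: complex
  assumes bal: "e + f + g = 1 + a + b + c + d"
    and Z: "a \<notin> \<int>" "b \<notin> \<int>" "c \<notin> \<int>" "d \<notin> \<int>" "e \<notin> \<int>" "f \<notin> \<int>" "g \<notin> \<int>"
      "a - b \<notin> \<int>" "a - c \<notin> \<int>" "a - d \<notin> \<int>" "e - f \<notin> \<int>" "e - g \<notin> \<int>" "f - g \<notin> \<int>" "g - f \<notin> \<int>" "a - e \<notin> \<int>"
      "a - f \<notin> \<int>" "b - f \<notin> \<int>" "c - f \<notin> \<int>" "d - f \<notin> \<int>" "a - g \<notin> \<int>" "b - g \<notin> \<int>" "c - g \<notin> \<int>" "d - g \<notin> \<int>"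
  defines "S \<equiv> \<lambda>x::complex. sin (of_real pi * x)"
  shows "Kfun a b c d e f g = A a (1 + a - e) (1 + a - f) (1 + a - g) * of_real pi ^ 4 / (S a * S (e - a) * S (g - f)) *
    (Lfun a b c d g f e * A (g - a) (g - b) (g - c) (g - d) / S (g - a) - Lfun a b c d f g e * A (f - a) (f - b) (f - c) (f - d) / S (f - a))"
proof -
  define E where "E = bilateral_sum [a, b, c, d] [1, e, f, g]"
  define F0 where "F0 = rGamma e * rGamma f * rGamma g * hyp4F3 a b c d e f g"
  define Ff where "Ff = rGamma (2 - f) * rGamma (1 + g - f) * rGamma (1 + e - f) *
     hyp4F3 (1 + a - f) (1 + b - f) (1 + c - f) (1 + d - f) (2 - f) (1 + g - f) (1 + e - f)"
  define Fg where "Fg = rGamma (2 - g) * rGamma (1 + f - g) * rGamma (1 + e - g) *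
     hyp4F3 (1 + a - g) (1 + b - g) (1 + c - g) (1 + d - g) (2 - g) (1 + f - g) (1 + e - g)"
  define Fa where "Fa = rGamma (1 + a - b) * rGamma (1 + a - c) * rGamma (1 + a - d) *
     hyp4F3 a (1 + a - e) (1 + a - f) (1 + a - g) (1 + a - b) (1 + a - c) (1 + a - d)"
  note nn = not_nonpos_Int_if_not_Int
  have balanced: "balanced [a, b, c, d] [1, e, f, g]"
    using bal by (simp add: balanced_def algebra_simps)
  have mn: "y - x \<notin> \<int> \<Longrightarrow> x - y \<notin> \<int>" for x y :: complex by (metis Ints_minus minus_diff_eq)
  have om: "x \<notin> \<int> \<Longrightarrow> 1 - x \<notin> \<int>" "x \<notin> \<int> \<Longrightarrow> 2 - x \<notin> \<int>" for x :: complex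
    by (metis Ints_1 Ints_numeral Ints_diff diff_diff_eq2 add_diff_cancel_left')+
  have E0: "E 0 = A (1 - a) (1 - b) (1 - c) (1 - d) * F0"
    unfolding E_def by (subst bilateral_sum_0) (use Z nn bal in \<open>simp_all add: A_def F0_def\<close>)
  \<comment> \<open>The shift by 1 - f moves the lower parameter \<open>f\<close> to 1. The fact is
    kept general in \<open>f\<close> and \<open>g\<close> so that it also serves 1 - g.\<close>
  have E1: "bilateral_sum [a, b, c, d] [1, e, f, g] (1 - f) = A (f - a) (f - b) (f - c) (f - d) *
      (rGamma (2 - f) * rGamma (1 + g - f) * rGamma (1 + e - f) *
       hyp4F3 (1 + a - f) (1 + b - f) (1 + c - f) (1 + d - f) (2 - f) (1 + g - f) (1 + e - f))"
    if "e + f + g = 1 + a + b + c + d" "f \<notin> \<int>" "g - f \<notin> \<int>" "e - f \<notin> \<int>" for f g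
  proof -
    have perm: "bilateral_sum us [w, x, v, y] z = bilateral_sum us [v, w, y, x] z" for us v w x y z
      by (simp add: bilateral_sum_def recip_prod_def mult_ac)
    have "bilateral_sum [a, b, c, d] [1, e, f, g] (0 + (1 - f))
       = bilateral_sum [1 + a - f, 1 + b - f, 1 + c - f, 1 + d - f] [2 - f, 1 + e - f, 1, 1 + g - f] 0"
      unfolding bilateral_sum_shift by (simp add: algebra_simps)
    also have "\<dots> = A (1 - (1 + a - f)) (1 - (1 + b - f)) (1 - (1 + c - f)) (1 - (1 + d - f)) *
      (rGamma (2 - f) * rGamma (1 + g - f) * rGamma (1 + e - f) *
       hyp4F3 (1 + a - f) (1 + b - f) (1 + c - f) (1 + d - f) (2 - f) (1 + g - f) (1 + e - f))"
      unfolding A_def perm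
    proof (subst bilateral_sum_0)
      show "2 - f + (1 + g - f) + (1 + e - f) = 1 + (1 + a - f) + (1 + b - f) + (1 + c - f) + (1 + d - f)"
        using arg_cong[OF that(1), of "\<lambda>z. z + 4 - 4 * f"] by (simp add: algebra_simps)
      show "2 - f \<notin> \<int>\<^sub>\<le>\<^sub>0" "1 + g - f \<notin> \<int>\<^sub>\<le>\<^sub>0" "1 + e - f \<notin> \<int>\<^sub>\<le>\<^sub>0"
        by (rule nn; use that om in simp)+
    qed (simp add: mult_ac)
    finally show ?thesis by simp
  qed
  have Ef: "E (1 - f) = A (f - a) (f - b) (f - c) (f - d) * Ff"
    unfolding E_def Ff_def by (rule E1) (use bal Z in auto)
  have Eg: "E (1 - g) = A (g - a) (g - b) (g - c) (g - d) * Fg"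
  proof -
    have "E = bilateral_sum [a, b, c, d] [1, e, g, f]"
      by (rule ext) (simp add: E_def bilateral_sum_def recip_prod_def mult_ac)
    thus ?thesis unfolding Fg_def by (simp only:) (rule E1, use bal Z in \<open>auto simp: algebra_simps\<close>)
  qed
  \<comment> \<open>Reflection turns the upper parameter \<open>a\<close> into the lower parameter 1
    - a, and the shift by \<open>a\<close> moves it to 1.\<close>
  have Ea: "E (- a) = A (1 - a) (e - a) (f - a) (g - a) * Fa"
  proof -
    have "E (- (0 + a)) = bilateral_sum [a, 1 + a - e, 1 + a - f, 1 + a - g] [1, 1 + a - b, 1 + a - c, 1 + a - d] 0"
      unfolding E_def bilateral_sum_minus[OF balanced] bilateral_sum_shift by (simp add: algebra_simps)
    also have "\<dots> = A (1 - a) (1 - (1 + a - e)) (1 - (1 + a - f)) (1 - (1 + a - g)) * Fa"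
      unfolding A_def Fa_def
    proof (subst bilateral_sum_0)
      show "1 + a - b + (1 + a - c) + (1 + a - d) = 1 + a + (1 + a - e) + (1 + a - f) + (1 + a - g)"
        using arg_cong[OF bal, of "\<lambda>z. - z + 4 + 4 * a"] by (simp add: algebra_simps)
      show "1 + a - b \<notin> \<int>\<^sub>\<le>\<^sub>0" "1 + a - c \<notin> \<int>\<^sub>\<le>\<^sub>0" "1 + a - d \<notin> \<int>\<^sub>\<le>\<^sub>0"
        by (rule nn; use Z in simp)+
    qed (simp add: mult_ac)
    finally show ?thesis by simp
  qed
  have Sneg: "S (- x) = - S x" "S (1 - x) = S x" for x by (simp_all add: S_def sin_pi_one_minus)
  have R: "E 0 * (S (g - f) * S (f - a) * S (g - a)) + E (1 - f) * (S g * S a * S (g - a))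
    - E (1 - g) * (S f * S a * S (f - a)) - E (- a) * (S f * S g * S (g - f)) = 0"
  proof -
    have e: "(1 - f) - (1 - g) = g - f" "(1 - f) - (- a) = 1 - (f - a)" "(1 - g) - (- a) = 1 - (g - a)"
      "0 - (1 - g) = - (1 - g)" "0 - (1 - f) = - (1 - f)" "0 - (- a) = a" by simp_all
    have "E 0 * (S ((1 - f) - (1 - g)) * S ((1 - f) - (- a)) * S ((1 - g) - (- a)))
      - E (1 - f) * (S (0 - (1 - g)) * S (0 - (- a)) * S ((1 - g) - (- a)))
      + E (1 - g) * (S (0 - (1 - f)) * S (0 - (- a)) * S ((1 - f) - (- a)))
      - E (- a) * (S (0 - (1 - f)) * S (0 - (1 - g)) * S ((1 - f) - (1 - g))) = 0"
      unfolding E_def S_def by (rule bilateral_four_point[OF balanced])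
    thus ?thesis unfolding e Sneg by (simp add: mult_ac)
  qed
  have refl: "A (1 - w) (1 - x) (1 - y) (1 - z) * (of_real pi ^ 4 * A w x y z) = S w * S x * S y * S z" for w x y z
  proof -
    have r: "S t = of_real pi * (rGamma t * rGamma (1 - t))" for t by (simp add: S_def rGamma_reflection_complex)
    show ?thesis unfolding A_def r by (simp only: power4_eq_xxxx mult_ac)
  qed
  have Anz: "A w x y z \<noteq> 0" if "w \<notin> \<int>" "x \<notin> \<int>" "y \<notin> \<int>" "z \<notin> \<int>" for w x y z
    using that rGamma_not_Ints_neq_0 by (auto simp: A_def)
  \<comment> \<open>Each series is divided by the Gamma product that multiplies its partner in K or
    L. The functions then become multiples of T0 + Ta, T0 - Tf and T0 - Tg.\<close>
  define U where "U = A a b c d"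
  define A' where "A' = A a (1 + a - e) (1 + a - f) (1 + a - g)"
  define Qf where "Qf = A (1 + a - f) (1 + b - f) (1 + c - f) (1 + d - f)"
  define Qg where "Qg = A (1 + a - g) (1 + b - g) (1 + c - g) (1 + d - g)"
  have nz: "U \<noteq> 0" "A' \<noteq> 0" "Qf \<noteq> 0" "Qg \<noteq> 0"
    unfolding U_def A'_def Qf_def Qg_def by (rule Anz; use Z in simp)+
  define T0 Tf Tg Ta where "T0 = F0 / U" and "Tf = Ff / Qf" and "Tg = Fg / Qg" and "Ta = Fa / A'"
  define p where "p = (of_real pi :: complex) ^ 4"
  have p0: "p \<noteq> 0" by (simp add: p_def)
  have ph: "F0 = U * T0" "Ff = Qf * Tf" "Fg = Qg * Tg" "Fa = A' * Ta"
    using nz by (simp_all add: T0_def Tf_def Tg_def Ta_def)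
  have Af: "A (f - a) (f - b) (f - c) (f - d) * (p * Qf) = S (f - a) * S (f - b) * S (f - c) * S (f - d)"
  proof -
    have e: "1 + x - f = 1 - (f - x)" for x by simp
    show ?thesis using refl[of "1 - (f - a)" "1 - (f - b)" "1 - (f - c)" "1 - (f - d)"]
      unfolding Qf_def p_def e Sneg by simp
  qed
  have Ag: "A (g - a) (g - b) (g - c) (g - d) * (p * Qg) = S (g - a) * S (g - b) * S (g - c) * S (g - d)"
  proof -
    have e: "1 + x - g = 1 - (g - x)" for x by simp
    show ?thesis using refl[of "1 - (g - a)" "1 - (g - b)" "1 - (g - c)" "1 - (g - d)"]
      unfolding Qg_def p_def e Sneg by simp
  qed
  have A0: "A (1 - a) (1 - b) (1 - c) (1 - d) * (p * U) = S a * S b * S c * S d"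
    unfolding U_def p_def by (rule refl)
  have Aa: "A (1 - a) (e - a) (f - a) (g - a) * (p * A') = S a * S (e - a) * S (f - a) * S (g - a)"
  proof -
    have e: "1 + a - x = 1 - (x - a)" for x by simp
    show ?thesis using refl[of a "1 - (e - a)" "1 - (f - a)" "1 - (g - a)"]
      unfolding A'_def p_def e Sneg by simp
  qed
  have snz: "S a \<noteq> 0" "S f \<noteq> 0" "S g \<noteq> 0" "S (e - a) \<noteq> 0" "S (g - f) \<noteq> 0" "S (f - a) \<noteq> 0" "S (g - a) \<noteq> 0"
    unfolding S_def by (rule sin_pi_not_Ints; use Z mn in blast)+
  define F' where "F' = S (f - b) * S (f - c) * S (f - d)"
  define G' where "G' = S (g - b) * S (g - c) * S (g - d)"
  have R2: "T0 * (S b * S c * S d * S (g - f)) + Tf * F' * S g - Tg * G' * S f - Ta * (S (e - a) * S f * S g * S (g - f)) = 0"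
  proof -
    have "p * (E 0 * (S (g - f) * S (f - a) * S (g - a)) + E (1 - f) * (S g * S a * S (g - a))
      - E (1 - g) * (S f * S a * S (f - a)) - E (- a) * (S f * S g * S (g - f))) =
      (A (1 - a) (1 - b) (1 - c) (1 - d) * (p * U)) * T0 * (S (g - f) * S (f - a) * S (g - a))
      + (A (f - a) (f - b) (f - c) (f - d) * (p * Qf)) * Tf * (S g * S a * S (g - a))
      - (A (g - a) (g - b) (g - c) (g - d) * (p * Qg)) * Tg * (S f * S a * S (f - a))
      - (A (1 - a) (e - a) (f - a) (g - a) * (p * A')) * Ta * (S f * S g * S (g - f))"
      unfolding E0 Ef Eg Ea ph by (simp add: algebra_simps)
    also have "\<dots> = (S a * S (f - a) * S (g - a)) *
       (T0 * (S b * S c * S d * S (g - f)) + Tf * F' * S g - Tg * G' * S f - Ta * (S (e - a) * S f * S g * S (g - f)))"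
      unfolding A0 Af Ag Aa F'_def G'_def by (simp add: algebra_simps)
    finally show ?thesis unfolding R using snz by simp
  qed
  \<comment> \<open>By the balance e - a = 1 - (f + g - b - c - d), so the sine of e - a is minus
    the last one in \<open>sin_four_identity\<close>.\<close>
  have trig: "S f * G' - S g * F' = S (g - f) * (S b * S c * S d + S (e - a) * S f * S g)"
  proof -
    have e: "e - a = 1 - (f + g - b - c - d)" using bal by (simp add: algebra_simps)
    have "S (e - a) = - S (- (f + g - b - c - d))" unfolding e Sneg by simp
    also have "- (f + g - b - c - d) = b + c + d - f - g" by simp
    finally have "S (e - a) = - S (b + c + d - f - g)" .
    thus ?thesis
      using sin_four_identity[of "of_real pi * f" "of_real pi * g" "of_real pi * b" "of_real pi * c" "of_real pi * d"]
      unfolding F'_def G'_def S_def by (simp add: algebra_simps)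
  qed
  have key: "(T0 + Ta) * (S (e - a) * S f * S g * S (g - f)) = (T0 - Tg) * G' * S f - (T0 - Tf) * F' * S g"
  proof -
    have "(T0 + Ta) * (S (e - a) * S f * S g * S (g - f)) = T0 * (S (g - f) * (S b * S c * S d + S (e - a) * S f * S g))
      + Tf * F' * S g - Tg * G' * S f"
      using R2 by (simp add: algebra_simps)
    also have "\<dots> = (T0 - Tg) * G' * S f - (T0 - Tf) * F' * S g"
      unfolding trig[symmetric] by (simp add: algebra_simps)
    finally show ?thesis .
  qed
  have K: "Kfun a b c d e f g = A' * U * (T0 + Ta) / S a"
  proof -
    have "Kfun a b c d e f g = (F0 * A' + Fa * U) / S a"
      by (simp add: Kfun_def F0_def Fa_def A'_def U_def A_def S_def add_divide_distrib mult_ac)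
    thus ?thesis unfolding ph by (simp add: algebra_simps)
  qed
  have Lf: "Lfun a b c d f g e = U * Qf * (T0 - Tf) / S f"
  proof -
    have "Lfun a b c d f g e = (F0 * Qf - Ff * U) / S f"
      unfolding F0_def hyp4F3_rotate[of a b c d e]
      by (simp add: Lfun_def Ff_def Qf_def U_def A_def S_def diff_divide_distrib mult_ac)
    thus ?thesis unfolding ph by (simp add: algebra_simps)
  qed
  have Lg: "Lfun a b c d g f e = U * Qg * (T0 - Tg) / S g"
  proof -
    have "Lfun a b c d g f e = (F0 * Qg - Fg * U) / S g"
      unfolding F0_def hyp4F3_rotate[of a b c d e] hyp4F3_rotate[of a b c d f] hyp4F3_swap[of a b c d g e]
      by (simp add: Lfun_def Fg_def Qg_def U_def A_def S_def diff_divide_distrib mult_ac)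
    thus ?thesis unfolding ph by (simp add: algebra_simps)
  qed
  have "p * (Lfun a b c d g f e * A (g - a) (g - b) (g - c) (g - d) / S (g - a)) = U * (T0 - Tg) * G' / S g"
  proof -
    have "p * (Lfun a b c d g f e * A (g - a) (g - b) (g - c) (g - d) / S (g - a)) =
      U * (T0 - Tg) * (A (g - a) (g - b) (g - c) (g - d) * (p * Qg)) / S g / S (g - a)"
      unfolding Lg by (simp add: mult_ac)
    also have "\<dots> = U * (T0 - Tg) * G' / S g" unfolding Ag G'_def using snz by simp
    finally show ?thesis .
  qed
  moreover have "p * (Lfun a b c d f g e * A (f - a) (f - b) (f - c) (f - d) / S (f - a)) = U * (T0 - Tf) * F' / S f"
  proof -
    have "p * (Lfun a b c d f g e * A (f - a) (f - b) (f - c) (f - d) / S (f - a)) =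
      U * (T0 - Tf) * (A (f - a) (f - b) (f - c) (f - d) * (p * Qf)) / S f / S (f - a)"
      unfolding Lf by (simp add: mult_ac)
    also have "\<dots> = U * (T0 - Tf) * F' / S f" unfolding Af F'_def using snz by simp
    finally show ?thesis .
  qed
  ultimately have "A' * p / (S a * S (e - a) * S (g - f)) *
    (Lfun a b c d g f e * A (g - a) (g - b) (g - c) (g - d) / S (g - a) - Lfun a b c d f g e * A (f - a) (f - b) (f - c) (f - d) / S (f - a))
    = A' / (S a * S (e - a) * S (g - f)) * (U * (T0 - Tg) * G' / S g - U * (T0 - Tf) * F' / S f)"
    by (simp add: right_diff_distrib[of p, symmetric] mult_ac)
       (simp add: right_diff_distrib)
  also have "U * (T0 - Tg) * G' / S g - U * (T0 - Tf) * F' / S f = U * ((T0 - Tg) * G' * S f - (T0 - Tf) * F' * S g) / (S f * S g)"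
    using snz by (simp add: field_simps)
  also have "A' / (S a * S (e - a) * S (g - f)) * \<dots> = A' * U * (T0 + Ta) / S a"
    unfolding key[symmetric] using snz by simp
  finally show ?thesis unfolding K A'_def p_def by simp
qed

section \<open>The three-term relation\<close>

lemma hyp4F3_perm_upper: "hyp4F3 a b c d e f g = hyp4F3 c d a b e f g" "hyp4F3 a b c d e f g = hyp4F3 d c b a e f g"
  by (simp_all add: hyp4F3_def mult_ac)

lemma Lfun_perm_upper: "Lfun a b c d e f g = Lfun c d a b e f g" "Lfun a b c d e f g = Lfun d c b a e f g"
proof -
  show "Lfun a b c d e f g = Lfun c d a b e f g"
    unfolding Lfun_def hyp4F3_perm_upper(1)[of a b c d]
      hyp4F3_perm_upper(1)[of "1 + a - e" "1 + b - e" "1 + c - e" "1 + d - e"] by (simp only: mult_ac)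
  show "Lfun a b c d e f g = Lfun d c b a e f g"
    unfolding Lfun_def hyp4F3_perm_upper(2)[of a b c d]
      hyp4F3_perm_upper(2)[of "1 + a - e" "1 + b - e" "1 + c - e" "1 + d - e"] by (simp only: mult_ac)
qed

lemma Kfun_rotate: "Kfun a b c d e f g = Kfun a b c d g e f"
  by (simp add: Kfun_def hyp4F3_def mult_ac)

text \<open>The linear forms that must avoid the integers for the given and the dual parameters in
  \<open>Kfun_Lfun\<close> and for the two Whipple steps in either order of \<open>f\<close> and
  \<open>g\<close>; g + e - a - b and f + e - a - b are the intermediate parameters of these
  steps.\<close>

definition generic_forms where
  "generic_forms (a :: complex) b c d e f g = {a, b, c, d, e, f, g, e - f, e - g, f - g,
     a - b, a - c, a - d, e - a, e - b, e - c, e - d, a - f, b - f, c - f, d - f, a - g, b - g, c - g, d - g,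
     g + e - a - b, f + e - a - b, g - a - b, f - a - b, c - (g + e - a - b), d - (g + e - a - b),
     c - (f + e - a - b), d - (f + e - a - b), e - a - b, e - c - d}"

definition generic where
  "generic (a :: complex) b c d e f g \<longleftrightarrow> (\<forall>x\<in>generic_forms a b c d e f g. x \<notin> \<int>)"

lemma generic_minus: "generic a b c d e f g \<Longrightarrow> \<forall>x\<in>generic_forms a b c d e f g. - x \<notin> \<int>"
  unfolding generic_def by (simp only: minus_in_Ints_iff)

lemma Ints_minus_one_minus [simp]: "a - 1 - b \<in> \<int> \<longleftrightarrow> a - b \<in> \<int>" for a b :: complex
proof -
  have "a - 1 - b = a - b - 1" by simp
  thus ?thesis by (simp only: Ints_shift)
qed

text \<open>Both Whipple steps keep the lower parameter \<open>e\<close>: one acts on the pair a, b,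
  the other on c, d. The distinguished parameter goes from \<open>g\<close> over g + e - a - b to g
  + 2e - a - b - c - d, which is 1 + e - f by the balance.\<close>

lemma Lfun_dual:
  assumes bal: "e + f + g = 1 + a + b + c + d" and gen: "generic a b c d e f g"
  shows "Lfun a b c d g f e = Lfun (e - a) (e - b) (e - c) (e - d) (1 + e - f) (1 + e - g) e"
proof -
  define h' where "h' = g + e - a - b"
  define c' where "c' = f + e - a - b"
  note G = gen[unfolded generic_def generic_forms_def ball_simps]
    generic_minus[OF gen, unfolded generic_forms_def ball_simps minus_diff_eq]
  have "Lfun a b c d g e f = Lfun (e - b) (e - a) c d h' e c'"
  proof (rule Lfun_whipple)
    show "g + e + f = 1 + a + b + c + d" using bal by (simp add: algebra_simps)
    have "h' - e = g - a - b" "h' - g = e - a - b" by (simp_all add: h'_def)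
    thus "h' - e \<notin> \<int>" "h' - g \<notin> \<int>" using G by simp_all
  qed (unfold h'_def c'_def, (rule refl | use G in blast | simp)+)
  also have "\<dots> = Lfun c d (e - b) (e - a) h' e c'" by (rule Lfun_perm_upper)
  also have "\<dots> = Lfun (e - d) (e - c) (e - b) (e - a) (1 + e - f) e (1 + e - g)"
  proof (rule Lfun_whipple)
    show "h' + e + c' = 1 + c + d + (e - b) + (e - a)"
      using bal by (simp add: h'_def c'_def algebra_simps)
    show "1 + e - f = h' + e - c - d" "1 + e - g = c' + e - c - d"
      using bal by (simp_all add: h'_def c'_def algebra_simps)
    have "h' - e = g - a - b" "h' - c' = g - f" "e - b - h' = a - g" "e - a - h' = b - g"
      "1 + e - f - e = 1 - f" "e - b - (1 + e - f) = f - b - 1" "e - a - (1 + e - f) = f - a - 1"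
      by (simp_all add: h'_def c'_def)
    thus "h' - e \<notin> \<int>" "h' - c' \<notin> \<int>" "e - b - h' \<notin> \<int>" "e - a - h' \<notin> \<int>" "1 + e - f - e \<notin> \<int>"
      "e - b - (1 + e - f) \<notin> \<int>" "e - a - (1 + e - f) \<notin> \<int>"
      using G one_minus_not_Ints by simp_all
    have eq: "1 + e - f - h' = e - c - d" using bal by (simp add: h'_def algebra_simps)
    show "1 + e - f - h' \<notin> \<int>" unfolding eq using G by blast
  qed (unfold h'_def c'_def, (rule refl | use G in blast | simp)+)
  also have "\<dots> = Lfun (e - a) (e - b) (e - c) (e - d) (1 + e - f) e (1 + e - g)" by (rule Lfun_perm_upper)
  finally show ?thesis using Lfun_swap by metis
qed

lemma generic_swap:
  assumes gen: "generic a b c d e f g" shows "generic a b c d e g f"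
  using gen[unfolded generic_def generic_forms_def ball_simps]
    generic_minus[OF gen, unfolded generic_forms_def ball_simps minus_diff_eq]
  unfolding generic_def generic_forms_def ball_simps by blast

text \<open>Both K functions are combinations of X and Y. The Gamma products in the relation are
  those that give X the same coefficient in both.\<close>

lemma relation_generic:
  fixes a b c d e f g :: complex
  assumes bal: "e + f + g = 1 + a + b + c + d" and gen: "generic a b c d e f g"
  defines "S \<equiv> \<lambda>x::complex. sin (of_real pi * x)"
  shows "S (f - a) * A (1 - a) (e - a) (f - a) (g - a) * A (1 + a - g) (1 + b - g) (1 + c - g) (1 + d - g) * Kfun a b c d e f g
    - S (g - a) * A (f - a) (f - b) (f - c) (f - d) * A a (1 + a - e) (1 + a - f) (1 + a - g)
        * Kfun (e - a) (e - b) (e - c) (e - d) (1 + e - f) (1 + e - g) e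
    - 1 / of_real pi ^ 4 * (S (f - a) * S (g - a)) *
        (S (b - a) * S (c - a) * S (d - a) + S (e - 2 * a) * S (f - a) * S (g - a)) * Lfun a b c d g f e = 0"
proof -
  note G = gen[unfolded generic_def generic_forms_def ball_simps]
    generic_minus[OF gen, unfolded generic_forms_def ball_simps minus_diff_eq]
  have Sneg: "S (- x) = - S x" "S (1 - x) = S x" for x by (simp_all add: S_def sin_pi_one_minus)
  define P where "P = A a (1 + a - e) (1 + a - f) (1 + a - g)"
  define P' where "P' = A (1 - a) (e - a) (f - a) (g - a)"
  define Af where "Af = A (f - a) (f - b) (f - c) (f - d)"
  define Ag where "Ag = A (g - a) (g - b) (g - c) (g - d)"
  define Bf where "Bf = A (1 + a - f) (1 + b - f) (1 + c - f) (1 + d - f)"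
  define Bg where "Bg = A (1 + a - g) (1 + b - g) (1 + c - g) (1 + d - g)"
  define X where "X = Lfun a b c d f g e"
  define Y where "Y = Lfun a b c d g f e"
  define p where "p = (of_real pi :: complex) ^ 4"
  have p0: "p \<noteq> 0" by (simp add: p_def)
  have K: "Kfun a b c d e f g = P * p / (S a * S (e - a) * S (g - f)) * (Y * Ag / S (g - a) - X * Af / S (f - a))"
    unfolding P_def p_def X_def Y_def Af_def Ag_def S_def
    by (rule Kfun_Lfun[OF bal]; use G in blast)
  have K': "Kfun (e - a) (e - b) (e - c) (e - d) (1 + e - f) (1 + e - g) e
      = P' * p / (S (e - a) * S a * S (f - g)) * (X * Bg / S (g - a) - Y * Bf / S (f - a))"
  proof -
    have X': "X = Lfun (e - a) (e - b) (e - c) (e - d) (1 + e - g) (1 + e - f) e"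
      unfolding X_def by (rule Lfun_dual) (use bal generic_swap[OF gen] in \<open>auto simp: algebra_simps\<close>)
    have Y': "Y = Lfun (e - a) (e - b) (e - c) (e - d) (1 + e - f) (1 + e - g) e"
      unfolding Y_def by (rule Lfun_dual[OF bal gen])
    have f0: "f - 1 \<notin> \<int>" "g - 1 \<notin> \<int>" using G by simp_all
    \<comment> \<open>\<open>e\<close> is put in the first lower slot because
      \<open>Kfun_Lfun\<close> singles that slot out: the other two dual parameters are the ones
      whose L functions are X and Y. \<open>Kfun_rotate\<close> restores the order.\<close>
    have "Kfun (e - a) (e - b) (e - c) (e - d) e (1 + e - f) (1 + e - g) =
      A (e - a) (1 + (e - a) - e) (1 + (e - a) - (1 + e - f)) (1 + (e - a) - (1 + e - g)) * of_real pi ^ 4 /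
        (S (e - a) * S (e - (e - a)) * S (1 + e - g - (1 + e - f))) *
      (Lfun (e - a) (e - b) (e - c) (e - d) (1 + e - g) (1 + e - f) e *
         A (1 + e - g - (e - a)) (1 + e - g - (e - b)) (1 + e - g - (e - c)) (1 + e - g - (e - d)) / S (1 + e - g - (e - a))
       - Lfun (e - a) (e - b) (e - c) (e - d) (1 + e - f) (1 + e - g) e *
         A (1 + e - f - (e - a)) (1 + e - f - (e - b)) (1 + e - f - (e - c)) (1 + e - f - (e - d)) / S (1 + e - f - (e - a)))"
      unfolding S_def
    proof (rule Kfun_Lfun)
      show "e + (1 + e - f) + (1 + e - g) = 1 + (e - a) + (e - b) + (e - c) + (e - d)"
        using arg_cong[OF bal, of "\<lambda>z. 3 + 4 * e - z"] by (simp add: algebra_simps)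
      have "e - a - (e - x) = x - a" "e - (1 + e - f) = f - 1" "e - (1 + e - g) = g - 1" "1 + e - f - (1 + e - g) = g - f"
        "1 + e - g - (1 + e - f) = f - g" "e - a - e = - a" "e - x - (1 + e - f) = f - x - 1" "e - x - (1 + e - g) = g - x - 1" for x
        by simp_all
      thus "e - a - (e - b) \<notin> \<int>" "e - a - (e - c) \<notin> \<int>" "e - a - (e - d) \<notin> \<int>" "e - (1 + e - f) \<notin> \<int>" "e - (1 + e - g) \<notin> \<int>"
        "1 + e - f - (1 + e - g) \<notin> \<int>" "1 + e - g - (1 + e - f) \<notin> \<int>" "e - a - e \<notin> \<int>"
        "e - a - (1 + e - f) \<notin> \<int>" "e - b - (1 + e - f) \<notin> \<int>" "e - c - (1 + e - f) \<notin> \<int>" "e - d - (1 + e - f) \<notin> \<int>"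
        "e - a - (1 + e - g) \<notin> \<int>" "e - b - (1 + e - g) \<notin> \<int>" "e - c - (1 + e - g) \<notin> \<int>" "e - d - (1 + e - g) \<notin> \<int>"
        using G f0 by simp_all
    qed (use G in simp_all)
    moreover have "1 + (e - a) - e = 1 - a" "1 + (e - a) - (1 + e - x) = x - a" "e - (e - a) = a"
      "1 + e - x - (1 + e - y) = y - x" "1 + e - x - (e - y) = 1 + y - x" for x y by simp_all
    moreover have "1 + a - x = 1 - (x - a)" for x by simp
    hence "S (1 + a - x) = S (x - a)" for x by (simp only: Sneg)
    moreover have "A (e - a) (1 - a) (f - a) (g - a) = P'" by (simp add: P'_def A_def mult_ac)
    ultimately show ?thesis
      unfolding Kfun_rotate[of _ _ _ _ "1 + e - f"] X' Y' Bf_def Bg_def p_def by (simp only:)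
  qed
  have r: "S t = of_real pi * (rGamma t * rGamma (1 - t))" for t by (simp add: S_def rGamma_reflection_complex)
  have refl: "p * (A w x y z * A (1 - w) (1 - x) (1 - y) (1 - z)) = S w * S x * S y * S z" for w x y z
    unfolding A_def r p_def by (simp only: power4_eq_xxxx mult_ac)
  have PP: "p * (P * P') = S a * S (e - a) * S (f - a) * S (g - a)"
  proof -
    have e: "1 + a - x = 1 - (x - a)" for x by simp
    show ?thesis using refl[of a "1 - (e - a)" "1 - (f - a)" "1 - (g - a)"]
      unfolding P_def P'_def e Sneg by simp
  qed
  have AB: "p * (Af * Bf) = S (f - a) * S (f - b) * S (f - c) * S (f - d)" "p * (Ag * Bg) = S (g - a) * S (g - b) * S (g - c) * S (g - d)"
  proof -
    have e: "1 + x - y = 1 - (y - x)" for x y :: complex by simp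
    show "p * (Af * Bf) = S (f - a) * S (f - b) * S (f - c) * S (f - d)"
      unfolding Af_def Bf_def e by (rule refl)
    show "p * (Ag * Bg) = S (g - a) * S (g - b) * S (g - c) * S (g - d)"
      unfolding Ag_def Bg_def e by (rule refl)
  qed
  have snz: "S a \<noteq> 0" "S (e - a) \<noteq> 0" "S (g - f) \<noteq> 0" "S (f - a) \<noteq> 0" "S (g - a) \<noteq> 0"
    unfolding S_def by (rule sin_pi_not_Ints; use G in blast)+
  have Sfg: "S (f - g) = - S (g - f)" using Sneg(1)[of "g - f"] by simp
  define s t h where "s = S (f - a)" and "t = S (g - a)" and "h = S (g - f)"
  define M where "M = S (b - a) * S (c - a) * S (d - a) + S (e - 2 * a) * S (f - a) * S (g - a)"
  \<comment> \<open>The sine of e - 2a in \<open>B_2\<close> is the last sine of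
    \<open>sin_four_identity\<close> for parameters lowered by \<open>a\<close>, rewritten by the
    balance.\<close>
  have trig: "s * (S (g - b) * S (g - c) * S (g - d)) - t * (S (f - b) * S (f - c) * S (f - d)) = h * M"
  proof -
    have "e - 2 * a = 1 - ((f - a) + (g - a) - (b - a) - (c - a) - (d - a))"
      using bal by (simp add: algebra_simps)
    hence "S (e - 2 * a) = - S (- ((f - a) + (g - a) - (b - a) - (c - a) - (d - a)))" by (simp only: Sneg minus_minus)
    also have "- ((f - a) + (g - a) - (b - a) - (c - a) - (d - a)) = (b - a) + (c - a) + (d - a) - (f - a) - (g - a)" by simp
    finally have Se: "S (e - 2 * a) = - S ((b - a) + (c - a) + (d - a) - (f - a) - (g - a))" .
    have D: "of_real pi * (x - a) - of_real pi * (y - a) = of_real pi * (x - y)" for x y by (simp add: algebra_simps)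
    have D5: "of_real pi * (b - a) + of_real pi * (c - a) + of_real pi * (d - a) - of_real pi * (f - a) - of_real pi * (g - a)
      = of_real pi * ((b - a) + (c - a) + (d - a) - (f - a) - (g - a))"
      by (simp only: distrib_left right_diff_distrib)
    have "S (f - a) * (S (g - b) * S (g - c) * S (g - d)) - S (g - a) * (S (f - b) * S (f - c) * S (f - d)) =
      S (g - f) * (S (b - a) * S (c - a) * S (d - a) - S ((b - a) + (c - a) + (d - a) - (f - a) - (g - a)) * S (f - a) * S (g - a))"
      using sin_four_identity[of "of_real pi * (f - a)" "of_real pi * (g - a)" "of_real pi * (b - a)" "of_real pi * (c - a)" "of_real pi * (d - a)"]
      unfolding D5 unfolding D S_def .
    thus ?thesis unfolding s_def t_def h_def M_def Se by simp
  qed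
  have snz': "s \<noteq> 0" "t \<noteq> 0" "h \<noteq> 0" using snz by (simp_all add: s_def t_def h_def)
  have PP': "P * P' = S a * S (e - a) * s * t / p" using PP p0 by (simp add: s_def t_def field_simps)
  have 1: "s * P' * Bg * Kfun a b c d e f g = (s ^ 2 * (Ag * Bg) * Y - s * t * (Af * Bg) * X) / h"
  proof -
    have "s * P' * Bg * Kfun a b c d e f g = (P * P') * p / (S a * S (e - a)) * (s * Bg / h * (Y * Ag / t - X * Af / s))"
      unfolding K s_def[symmetric] t_def[symmetric] h_def[symmetric] by simp
    also have "(P * P') * p / (S a * S (e - a)) = s * t" unfolding PP' using snz p0 by simp
    also have "s * t * (s * Bg / h * (Y * Ag / t - X * Af / s)) = (s ^ 2 * (Ag * Bg) * Y - s * t * (Af * Bg) * X) / h" using snz' by (simp add: field_simps power2_eq_square)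
    finally show ?thesis .
  qed
  have 2: "t * Af * P * Kfun (e - a) (e - b) (e - c) (e - d) (1 + e - f) (1 + e - g) e = - (s * t * (Af * Bg) * X - t ^ 2 * (Af * Bf) * Y) / h"
  proof -
    have "t * Af * P * Kfun (e - a) (e - b) (e - c) (e - d) (1 + e - f) (1 + e - g) e
      = (P * P') * p / (S a * S (e - a)) * (- (t * Af / h * (X * Bg / t - Y * Bf / s)))"
      unfolding K' Sfg s_def[symmetric] t_def[symmetric] h_def[symmetric] by (simp add: mult_ac)
    also have "(P * P') * p / (S a * S (e - a)) = s * t" unfolding PP' using snz p0 by simp
    also have "s * t * (- (t * Af / h * (X * Bg / t - Y * Bf / s))) = - (s * t * (Af * Bg) * X - t ^ 2 * (Af * Bf) * Y) / h" using snz' by (simp add: field_simps power2_eq_square)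
    finally show ?thesis .
  qed
  \<comment> \<open>X cancels. Reflection turns both coefficients of Y into sine products, whose
    difference is evaluated by \<open>trig\<close>.\<close>
  have "s * P' * Bg * Kfun a b c d e f g - t * Af * P * Kfun (e - a) (e - b) (e - c) (e - d) (1 + e - f) (1 + e - g) e
    = (s ^ 2 * (p * (Ag * Bg)) - t ^ 2 * (p * (Af * Bf))) * Y / (h * p)"
    unfolding 1 2 using snz' p0 by (simp add: field_simps)
  also have "s ^ 2 * (p * (Ag * Bg)) - t ^ 2 * (p * (Af * Bf)) = s * t * (h * M)"
    unfolding trig[symmetric] AB s_def t_def by (simp add: power2_eq_square algebra_simps)
  also have "\<dots> * Y / (h * p) = 1 / p * (s * t) * M * Y" using snz' by simp
  finally show ?thesis
    unfolding s_def t_def P'_def Bg_def Af_def P_def p_def M_def Y_def by simp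
qed

section \<open>Continuity and the passage to all admissible parameters\<close>

lemma tendsto_rGamma: "(z \<longlongrightarrow> z0) F \<Longrightarrow> ((\<lambda>t. rGamma (z t :: complex)) \<longlongrightarrow> rGamma z0) F"
  by (rule isCont_tendsto_compose[OF isCont_rGamma[OF continuous_ident]])

lemma tendsto_sin_pi:
  assumes "(z \<longlongrightarrow> z0) F"
  shows "((\<lambda>t. sin (of_real pi * z t :: complex)) \<longlongrightarrow> sin (of_real pi * z0)) F"
  by (rule isCont_tendsto_compose[OF isCont_sin]) (intro tendsto_intros assms)

text \<open>\<open>K_defined\<close> at the limit point keeps the sine and the lower parameters of
  both series away from their singular values, and 1/Gamma is entire. The second series inherits its
  balance from the first.\<close>

lemma tendsto_Kfun:
  assumes lim: "(a \<longlongrightarrow> a0) F" "(b \<longlongrightarrow> b0) F" "(c \<longlongrightarrow> c0) F" "(d \<longlongrightarrow> d0) F"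
    "(e \<longlongrightarrow> e0) F" "(f \<longlongrightarrow> f0) F" "(g \<longlongrightarrow> g0) F"
    and bal: "eventually (\<lambda>t. e t + f t + g t = 1 + a t + b t + c t + d t) F"
    and K: "K_defined a0 b0 c0 d0 e0 f0 g0" and F: "F \<noteq> bot"
  shows "((\<lambda>t. Kfun (a t) (b t) (c t) (d t) (e t) (f t) (g t)) \<longlongrightarrow> Kfun a0 b0 c0 d0 e0 f0 g0) F"
proof -
  have nz: "sin (of_real pi * a0) \<noteq> 0" "e0 \<notin> \<int>\<^sub>\<le>\<^sub>0" "f0 \<notin> \<int>\<^sub>\<le>\<^sub>0" "g0 \<notin> \<int>\<^sub>\<le>\<^sub>0"
    "1 + a0 - b0 \<notin> \<int>\<^sub>\<le>\<^sub>0" "1 + a0 - c0 \<notin> \<int>\<^sub>\<le>\<^sub>0" "1 + a0 - d0 \<notin> \<int>\<^sub>\<le>\<^sub>0"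
    using K by (auto simp: K_defined_def)
  have bal': "eventually (\<lambda>t. (1 + a t - b t) + (1 + a t - c t) + (1 + a t - d t) =
      1 + a t + (1 + a t - e t) + (1 + a t - f t) + (1 + a t - g t)) F"
    using bal
  proof eventually_elim
    case (elim t)
    show ?case using arg_cong[OF elim, of "\<lambda>z. 4 + 4 * a t - z"] by (simp add: algebra_simps)
  qed
  show ?thesis unfolding Kfun_def
    by (intro tendsto_intros tendsto_sin_pi tendsto_hyp4F3 tendsto_rGamma lim bal bal' nz F)
qed

lemma tendsto_Lfun:
  assumes lim: "(a \<longlongrightarrow> a0) F" "(b \<longlongrightarrow> b0) F" "(c \<longlongrightarrow> c0) F" "(d \<longlongrightarrow> d0) F"
    "(e \<longlongrightarrow> e0) F" "(f \<longlongrightarrow> f0) F" "(g \<longlongrightarrow> g0) F"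
    and bal: "eventually (\<lambda>t. e t + f t + g t = 1 + a t + b t + c t + d t) F"
    and L: "L_defined a0 b0 c0 d0 e0 f0 g0" and F: "F \<noteq> bot"
  shows "((\<lambda>t. Lfun (a t) (b t) (c t) (d t) (e t) (f t) (g t)) \<longlongrightarrow> Lfun a0 b0 c0 d0 e0 f0 g0) F"
proof -
  have nz: "sin (of_real pi * e0) \<noteq> 0" "e0 \<notin> \<int>\<^sub>\<le>\<^sub>0" "f0 \<notin> \<int>\<^sub>\<le>\<^sub>0" "g0 \<notin> \<int>\<^sub>\<le>\<^sub>0"
    "2 - e0 \<notin> \<int>\<^sub>\<le>\<^sub>0" "1 + f0 - e0 \<notin> \<int>\<^sub>\<le>\<^sub>0" "1 + g0 - e0 \<notin> \<int>\<^sub>\<le>\<^sub>0"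
    using L by (auto simp: L_defined_def)
  have bal': "eventually (\<lambda>t. (2 - e t) + (1 + f t - e t) + (1 + g t - e t) =
      1 + (1 + a t - e t) + (1 + b t - e t) + (1 + c t - e t) + (1 + d t - e t)) F"
    using bal
  proof eventually_elim
    case (elim t)
    show ?case using arg_cong[OF elim, of "\<lambda>z. z + 4 - 4 * e t"] by (simp add: algebra_simps)
  qed
  show ?thesis unfolding Lfun_def
    by (intro tendsto_intros tendsto_sin_pi tendsto_hyp4F3 tendsto_rGamma lim bal bal' nz F)
qed

text \<open>The integers are closed and discrete, and the line leaves \<open>l\<close> for t
  \<noteq> 0, so an integral starting point is harmless.\<close>

lemma eventually_not_Ints_line:
  fixes l k :: complex
  assumes "k \<noteq> 0"
  shows "eventually (\<lambda>t. l + t * k \<notin> \<int>) (at 0)"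
proof -
  have "eventually (\<lambda>w. w \<notin> \<int>) (at l)"
  proof (cases "l \<in> \<int>")
    case True
    have "w \<notin> \<int>" if "w \<noteq> l" "dist w l < 1" for w
    proof
      assume "w \<in> \<int>"
      hence "w - l \<in> \<int>" using True by simp
      then obtain n :: int where n: "w - l = of_int n" by (auto elim: Ints_cases)
      hence "norm (w - l) = real_of_int \<bar>n\<bar>" by (simp only: norm_of_int)
      moreover have "n \<noteq> 0" using n that by auto
      ultimately show False using that by (simp add: dist_norm)
    qed
    thus ?thesis unfolding eventually_at by (intro exI[of _ 1]) auto
  next
    case False
    thus ?thesis
      by (intro eventually_at_in_open'[of "- \<int>", THEN eventually_mono]) (auto intro: open_Compl closed_Ints)
  qed
  moreover have "filterlim (\<lambda>t. l + t * k) (at l) (at 0)"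
    using assms by (auto simp: filterlim_at eventually_at_filter intro!: tendsto_eq_intros)
  ultimately show ?thesis by (rule eventually_compose_filterlim)
qed

text \<open>
  The direction is tangent to \<open>V\<close>, and no form in \<open>generic_forms\<close> is constant along it.
\<close>
lemma eventually_generic:
  fixes a b c d e f g :: complex
  shows "eventually (\<lambda>t. generic (a + t) (b + t * 10) (c + t * 100) (d + t * 1000) (e + t * 20000) (f + t * 300000) (g - t * 318889)) (at 0)"
proof -
  \<comment> \<open>The slopes 1, 10, 100, 1000, 20000, 300000 have different decimal magnitudes, so
    that no listed form has slope 0. The last slope is determined by the balance: 1111 - 320000 =
    -318889.\<close>
  define L where "L = {(a, 1), (b, 10), (c, 100), (d, 1000), (e, 20000), (f, 300000), (g, - 318889),
    (e - f, 20000 - 300000), (e - g, 20000 + 318889), (f - g, 300000 + 318889),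
    (a - b, 1 - 10), (a - c, 1 - 100), (a - d, 1 - 1000), (e - a, 20000 - 1), (e - b, 20000 - 10), (e - c, 20000 - 100), (e - d, 20000 - 1000),
    (a - f, 1 - 300000), (b - f, 10 - 300000), (c - f, 100 - 300000), (d - f, 1000 - 300000),
    (a - g, 1 + 318889), (b - g, 10 + 318889), (c - g, 100 + 318889), (d - g, 1000 + 318889),
    (g + e - a - b, 20000 - 318889 - 11), (f + e - a - b, 300000 + 20000 - 11), (g - a - b, - 318889 - 11), (f - a - b, 300000 - 11),
    (c - (g + e - a - b), 100 - (20000 - 318889 - 11)), (d - (g + e - a - b), 1000 - (20000 - 318889 - 11)),
    (c - (f + e - a - b), 100 - (300000 + 20000 - 11)), (d - (f + e - a - b), 1000 - (300000 + 20000 - 11)),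
    (e - a - b, 20000 - 11), (e - c - d, 20000 - 1100 :: complex)}"
  have "finite L" by (simp add: L_def)
  moreover have "eventually (\<lambda>t. fst p + t * snd p \<notin> \<int>) (at 0)" if "p \<in> L" for p
  proof (rule eventually_not_Ints_line)
    have "\<forall>p\<in>L. snd p \<noteq> 0" unfolding L_def by simp
    thus "snd p \<noteq> 0" using that by blast
  qed
  ultimately have "eventually (\<lambda>t. \<forall>p\<in>L. fst p + t * snd p \<notin> \<int>) (at 0)"
    by (simp add: eventually_ball_finite)
  thus ?thesis
  proof eventually_elim
    case (elim t)
    show ?case using elim unfolding generic_def generic_forms_def L_def by (simp add: algebra_simps)
  qed
qed

theorem proposition6p6:
  fixes a b c d e f g :: complex and x :: c7
  assumes x: "x = (a, b, c, d, e, f, g)"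
    and V: "x \<in> V"
    and "K_p0_defined x" and "K_n4_defined x" and "L_4_defined x"
  shows "sin_prod [f - a] * A (1 - a) (e - a) (f - a) (g - a)
           * A (1 + a - g) (1 + b - g) (1 + c - g) (1 + d - g) * K_p0 x
       - sin_prod [g - a] * A (f - a) (f - b) (f - c) (f - d)
           * A a (1 + a - e) (1 + a - f) (1 + a - g) * K_n4 x
       - B_2 x * L_4 x = 0"
proof -
  have K1: "K_defined a b c d e f g" and K2: "K_defined (e - a) (e - b) (e - c) (e - d) (1 + e - f) (1 + e - g) e"
    and L: "L_defined a b c d g f e"
    using assms(3-5) by (simp_all add: x)
  have bal: "e + f + g = 1 + a + b + c + d"
    using V by (simp add: x V_def algebra_simps)
  define S where "S = (\<lambda>x::complex. sin (of_real pi * x))"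
  define R where "R a b c d e f g =
     S (f - a) * A (1 - a) (e - a) (f - a) (g - a) * A (1 + a - g) (1 + b - g) (1 + c - g) (1 + d - g) * Kfun a b c d e f g
    - S (g - a) * A (f - a) (f - b) (f - c) (f - d) * A a (1 + a - e) (1 + a - f) (1 + a - g)
        * Kfun (e - a) (e - b) (e - c) (e - d) (1 + e - f) (1 + e - g) e
    - 1 / of_real pi ^ 4 * (S (f - a) * S (g - a)) *
        (S (b - a) * S (c - a) * S (d - a) + S (e - 2 * a) * S (f - a) * S (g - a)) * Lfun a b c d g f e" for a b c d e f g
  define a' b' c' d' e' f' g' where "a' = (\<lambda>t. a + t)" and "b' = (\<lambda>t. b + t * 10)" and "c' = (\<lambda>t. c + t * 100)"
    and "d' = (\<lambda>t. d + t * 1000)" and "e' = (\<lambda>t. e + t * 20000)" and "f' = (\<lambda>t. f + t * 300000)"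
    and "g' = (\<lambda>t. g - t * 318889)"
  have lim: "(a' \<longlongrightarrow> a) (at 0)" "(b' \<longlongrightarrow> b) (at 0)" "(c' \<longlongrightarrow> c) (at 0)" "(d' \<longlongrightarrow> d) (at 0)"
    "(e' \<longlongrightarrow> e) (at 0)" "(f' \<longlongrightarrow> f) (at 0)" "(g' \<longlongrightarrow> g) (at 0)"
    unfolding a'_def b'_def c'_def d'_def e'_def f'_def g'_def by (auto intro!: tendsto_eq_intros)
  have bal': "e' t + f' t + g' t = 1 + a' t + b' t + c' t + d' t" for t
    using bal unfolding a'_def b'_def c'_def d'_def e'_def f'_def g'_def by (simp add: algebra_simps)
  have bal2: "1 + e' t - f' t + (1 + e' t - g' t) + e' t = 1 + (e' t - a' t) + (e' t - b' t) + (e' t - c' t) + (e' t - d' t)" for t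
    using arg_cong[OF bal'[of t], of "\<lambda>z. 3 + 4 * e' t - z"] by (simp add: algebra_simps)
  have bal3: "g' t + f' t + e' t = 1 + a' t + b' t + c' t + d' t" for t
    using bal'[of t] by (simp add: algebra_simps)
  \<comment> \<open>Definedness enters at t = 0 only, as continuity of K and L there; the relation
    itself is taken from the generic points t \<noteq> 0.\<close>
  have "((\<lambda>t. R (a' t) (b' t) (c' t) (d' t) (e' t) (f' t) (g' t)) \<longlongrightarrow> R a b c d e f g) (at 0)"
    unfolding R_def A_def S_def
    by (intro tendsto_intros tendsto_sin_pi tendsto_rGamma tendsto_Kfun[OF _ _ _ _ _ _ _ _ K1]
          tendsto_Kfun[OF _ _ _ _ _ _ _ _ K2] tendsto_Lfun[OF _ _ _ _ _ _ _ _ L] lim always_eventually allI bal' bal2 bal3) auto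
  moreover have "((\<lambda>t. R (a' t) (b' t) (c' t) (d' t) (e' t) (f' t) (g' t)) \<longlongrightarrow> 0) (at 0)"
  proof (rule tendsto_eventually)
    have "eventually (\<lambda>t. generic (a' t) (b' t) (c' t) (d' t) (e' t) (f' t) (g' t)) (at 0)"
      unfolding a'_def b'_def c'_def d'_def e'_def f'_def g'_def by (rule eventually_generic)
    thus "eventually (\<lambda>t. R (a' t) (b' t) (c' t) (d' t) (e' t) (f' t) (g' t) = 0) (at 0)"
    proof eventually_elim
      case (elim t)
      show ?case unfolding R_def S_def by (rule relation_generic[OF bal' elim])
    qed
  qed
  ultimately have "R a b c d e f g = 0"
    using tendsto_unique[OF trivial_limit_at] by blast
  thus ?thesis by (simp add: R_def S_def x sin_prod_def mult.assoc)
qed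

end
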